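(* Let $1<p\le2$, $\alpha_0>-1$, let $X^{1,p}_\infty=X^{1,p}_\infty(\alpha_0,p-1)$, and let $\mathcal S=\{u\in X^{1,p}_\infty:\|u\|_{X^{1,p}_\infty}=1\}$. There exists $\mu_*>0$ such that for every $\mu\in(0,\mu_* )$ the supremum $$d_{p,\mu}:=\sup_{u\in\mathcal S}\int_0^\infty\exp_p\left(\mu|u|^{\frac p{p-1}}\right)r^{\alpha_0}\,dr$$ is not attained, i.e. no $u\in\mathcal S$ satisfies $\int_0^\infty\exp_p\left(\mu|u|^{\frac p{p-1}}\right)r^{\alpha_0}\,dr=d_{p,\mu}$. Moreover, for all such small $\mu>0$ the functional $$u\mapsto\int_0^\infty\exp_p\left(\mu|u|^{\frac p{p-1}}\right)r^{\alpha_0}\,dr,\qquad u\in\mathcal S,$$ does not have a critical point on $\mathcal S$.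
   Context: For $q\ge1$ and $\theta\in\mathbb R$, $L^q_\theta=L^q_\theta(0,\infty)$ is the space of measurable $u:(0,\infty)\to\mathbb R$ with $\|u\|_{L^q_\theta}=\left(\int_0^\infty|u|^q r^\theta\,dr\right)^{1/q}<\infty$. $X^{1,p}_\infty(\alpha_0,p-1)$ is the space of functions $u:(0,\infty)\to\mathbb R$ with $u\in L^p_{\alpha_0}$ and weak derivative $u'\in L^p_{p-1}$, with norm $\|u\|_{X^{1,p}_\infty}=\left(\|u'\|^p_{L^p_{p-1}}+\|u\|^p_{L^p_{\alpha_0}}\right)^{1/p}$. For real $p\ge1$ and $t\ge0$, $\exp_p(t):=\sum_{j=0}^\infty\dfrac{t^{p-1+j}}{\Gamma(p+j)}$. A critical point on $\mathcal S$ means a critical point of the functional restricted to $\mathcal S$ (the derivative of the functional along every differentiable curve in $\mathcal S$ through the point vanishes there). *)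

theory Defs
  imports "HOL-Analysis.Analysis"
begin

text \<open>Functions on \<open>(0,\<infinity>)\<close> are total functions \<open>real \<Rightarrow> real\<close> whose values outside
  \<open>(0,\<infinity>)\<close> are never used. They are not quotiented by almost everywhere equality;
  the (semi)norms below only see the almost everywhere class.\<close>

definition wLp_space :: "real \<Rightarrow> real \<Rightarrow> (real \<Rightarrow> real) set" where
  "wLp_space q \<theta> = {u. u \<in> borel_measurable (lebesgue_on {0<..}) \<and>
     integrable (lebesgue_on {0<..}) (\<lambda>r. \<bar>u r\<bar> powr q * r powr \<theta>)}"

definition wLp_norm :: "real \<Rightarrow> real \<Rightarrow> (real \<Rightarrow> real) \<Rightarrow> real" where
  "wLp_norm q \<theta> u = (LINT r|lebesgue_on {0<..}. \<bar>u r\<bar> powr q * r powr \<theta>) powr (1 / q)"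

definition test_functions :: "real set \<Rightarrow> (real \<Rightarrow> real) set" where
  "test_functions S = {\<phi>. (\<forall>n x. ((deriv ^^ n) \<phi>) differentiable (at x)) \<and>
     compact (closure {x. \<phi> x \<noteq> 0}) \<and> closure {x. \<phi> x \<noteq> 0} \<subseteq> S}"

definition loc_integrable :: "(real \<Rightarrow> real) \<Rightarrow> bool" where
  "loc_integrable u \<longleftrightarrow> (\<forall>a b. 0 < a \<longrightarrow> a < b \<longrightarrow> set_integrable lebesgue {a..b} u)"

definition has_weak_deriv :: "(real \<Rightarrow> real) \<Rightarrow> (real \<Rightarrow> real) \<Rightarrow> bool" where
  "has_weak_deriv u v \<longleftrightarrow> loc_integrable u \<and> loc_integrable v \<and>
     (\<forall>\<phi>\<in>test_functions {0<..}.
        (LINT r|lebesgue_on {0<..}. u r * deriv \<phi> r) = - (LINT r|lebesgue_on {0<..}. v r * \<phi> r))"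

text \<open>A weak derivative is unique up to null sets, so the representative chosen here does not
  affect any of the integrals below.\<close>

definition weak_deriv :: "(real \<Rightarrow> real) \<Rightarrow> real \<Rightarrow> real" where
  "weak_deriv u = (SOME v. has_weak_deriv u v)"

definition X_space :: "real \<Rightarrow> real \<Rightarrow> real \<Rightarrow> (real \<Rightarrow> real) set" where
  "X_space p \<alpha>\<^sub>0 \<alpha>\<^sub>1 = {u \<in> wLp_space p \<alpha>\<^sub>0. \<exists>v\<in>wLp_space p \<alpha>\<^sub>1. has_weak_deriv u v}"

definition X_norm :: "real \<Rightarrow> real \<Rightarrow> real \<Rightarrow> (real \<Rightarrow> real) \<Rightarrow> real" where
  "X_norm p \<alpha>\<^sub>0 \<alpha>\<^sub>1 u =
     (wLp_norm p \<alpha>\<^sub>1 (weak_deriv u) powr p + wLp_norm p \<alpha>\<^sub>0 u powr p) powr (1 / p)"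

definition X_sphere :: "real \<Rightarrow> real \<Rightarrow> real \<Rightarrow> (real \<Rightarrow> real) set" where
  "X_sphere p \<alpha>\<^sub>0 \<alpha>\<^sub>1 = {u \<in> X_space p \<alpha>\<^sub>0 \<alpha>\<^sub>1. X_norm p \<alpha>\<^sub>0 \<alpha>\<^sub>1 u = 1}"

text \<open>Meant for \<open>t \<ge> 0\<close>. Since \<open>0 powr 0 = 0\<close>, the value at \<open>t = 0\<close> is \<open>0\<close>, which is the
  intended value for \<open>p > 1\<close> but not for \<open>p = 1\<close>.\<close>

definition exp_p :: "real \<Rightarrow> real \<Rightarrow> real" where
  "exp_p p t = (\<Sum>j. t powr (p - 1 + real j) / Gamma (p + real j))"

text \<open>The functional takes values in \<open>[0,\<infinity>]\<close>, so that neither finiteness of the integral nor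
  boundedness of the supremum is presupposed.\<close>

definition TM_functional :: "real \<Rightarrow> real \<Rightarrow> real \<Rightarrow> (real \<Rightarrow> real) \<Rightarrow> ennreal" where
  "TM_functional p \<alpha>\<^sub>0 \<mu> u =
     (\<integral>\<^sup>+ r. ennreal (exp_p p (\<mu> * \<bar>u r\<bar> powr (p / (p - 1))) * r powr \<alpha>\<^sub>0) \<partial>lebesgue_on {0<..})"

definition has_X_derivative ::
    "real \<Rightarrow> real \<Rightarrow> real \<Rightarrow> (real \<Rightarrow> real \<Rightarrow> real) \<Rightarrow> (real \<Rightarrow> real) \<Rightarrow> real \<Rightarrow> bool" where
  "has_X_derivative p \<alpha>\<^sub>0 \<alpha>\<^sub>1 \<gamma> w s \<longleftrightarrow> w \<in> X_space p \<alpha>\<^sub>0 \<alpha>\<^sub>1 \<and>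
     ((\<lambda>h. X_norm p \<alpha>\<^sub>0 \<alpha>\<^sub>1 (\<lambda>r. (\<gamma> (s + h) r - \<gamma> s r) / h - w r)) \<longlongrightarrow> 0) (at 0)"

definition diff_curve_through ::
    "real \<Rightarrow> real \<Rightarrow> real \<Rightarrow> (real \<Rightarrow> real) set \<Rightarrow> (real \<Rightarrow> real) \<Rightarrow> (real \<Rightarrow> real \<Rightarrow> real) \<Rightarrow> bool" where
  "diff_curve_through p \<alpha>\<^sub>0 \<alpha>\<^sub>1 S u \<gamma> \<longleftrightarrow> \<gamma> 0 = u \<and>
     (\<exists>\<epsilon>>0. \<forall>s\<in>{-\<epsilon><..<\<epsilon>}. \<gamma> s \<in> S \<and> (\<exists>w. has_X_derivative p \<alpha>\<^sub>0 \<alpha>\<^sub>1 \<gamma> w s))"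

text \<open>The vanishing of the derivative is phrased so that a curve along which \<open>F\<close> happens not to be
  differentiable does not by itself disqualify \<open>u\<close> from being critical. Absence of critical
  points therefore means that through each \<open>u\<close> there is a curve along which the derivative of
  \<open>F\<close> exists and is nonzero.\<close>

definition critical_point_on ::
    "real \<Rightarrow> real \<Rightarrow> real \<Rightarrow> (real \<Rightarrow> real) set \<Rightarrow> ((real \<Rightarrow> real) \<Rightarrow> real) \<Rightarrow> (real \<Rightarrow> real) \<Rightarrow> bool" where
  "critical_point_on p \<alpha>\<^sub>0 \<alpha>\<^sub>1 S F u \<longleftrightarrow> u \<in> S \<and>
     (\<forall>\<gamma>. diff_curve_through p \<alpha>\<^sub>0 \<alpha>\<^sub>1 S u \<gamma> \<longrightarrow>
       (\<forall>D. ((\<lambda>t. F (\<gamma> t)) has_real_derivative D) (at 0) \<longrightarrow> D = 0))"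

end

theory Submission
  imports Defs
begin

text \<open>A point \<open>u\<close> of the sphere that is critical satisfies a weak Euler--Lagrange equation
  \<open>-(r\<^sup>p\<^sup>-\<^sup>1|u'|\<^sup>p\<^sup>-\<^sup>2u')' = f(u)r\<^sup>a\<close>, where \<open>a = \<alpha>\<^sub>0\<close>. In one dimension such a \<open>u\<close> is \<open>C\<^sup>1\<close>, so a
  Pohozaev identity holds without any further regularity assumption. With \<open>A\<close> and \<open>B\<close> the two
  parts of the \<open>p\<close>-th power of the norm, \<open>A + B = 1\<close>, and \<open>\<lambda>\<close> the Lagrange multiplier, it says that the functional
  has the value \<open>\<lambda>B\<close> at \<open>u\<close>. Hence \<open>\<lambda>A\<close> is the contribution of the terms \<open>j \<ge> 1\<close> of the exponential
  series, which a scale-invariant Trudinger--Moser inequality bounds by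
  \<open>C\<mu>\<^sup>pA\<^bsup>1/(p-1)\<^esup>B \<le> C\<mu>\<^sup>pAB\<close>; this is where \<open>p \<le> 2\<close> enters. As \<open>\<lambda> \<ge> \<mu>\<^sup>p\<^sup>-\<^sup>1B/\<Gamma>(p)\<close>, this is
  impossible for small \<open>\<mu>\<close>. A maximizer would be critical, so the supremum is not attained.\<close>

section \<open>Smooth functions and bumps\<close>

text \<open>Both sides of the final comparison carry the same factor A B: the multiplier leaves at
  least \<open>p * c0 * A * B\<close>, the excess at most \<open>q * c0 * \<mu> * K * A * B\<close>.
  What remains is p \<le> q \<mu> K, and q (p - 1) = p turns this into the threshold (p - 1) / K. A
  bound without the factor A would not do, since A may be arbitrarily small; hence the exponential
  inequality is proved for every gradient bound M, with an explicit power of M.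

  The other threshold, \<open>\<mu>0 / 4 powr q\<close>, comes from differentiating the functional.
  This is done only along normalised lines u + s \<phi> with a test function \<phi>; they stay below
  4 max(|u|, |\<phi>|), and the factor 4 has to be absorbed by the exponent.

  Two obstacles shape the rest. Functions are arbitrary representatives and
  \<open>weak_deriv\<close> is a choice, so pointwise arguments first pass to a continuous
  primitive. And no decay of a critical point or of its flux is known, so the boundary terms in the
  Pohozaev identity vanish only along sequences, found by integrability against dr / r.\<close>

definition smooth :: "(real \<Rightarrow> real) \<Rightarrow> bool" where
  "smooth f \<longleftrightarrow> (\<forall>n x. ((deriv ^^ n) f) differentiable (at x))"

lemma smooth_deriv: "smooth f \<Longrightarrow> smooth (deriv f)"
  unfolding smooth_def by (metis comp_apply funpow_Suc_right)

lemma smooth_differentiable: "smooth f \<Longrightarrow> f differentiable (at x)"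
  unfolding smooth_def by (metis funpow_0)

lemma smooth_has_deriv: "smooth f \<Longrightarrow> (f has_real_derivative deriv f x) (at x)"
  using smooth_differentiable DERIV_deriv_iff_real_differentiable by blast

text \<open>\<open>smooth\<close> quantifies over iterates of \<open>deriv\<close>, for which closed
  forms are rarely at hand. A class of differentiable functions that \<open>deriv\<close> maps into
  itself settles all iterates at once.\<close>

lemma smooth_coinduct:
  assumes "P f" and step: "\<And>g. P g \<Longrightarrow> (\<forall>x. g differentiable (at x)) \<and> P (deriv g)"
  shows "smooth f"
proof -
  have "P ((deriv ^^ n) f)" for n
    by (induction n) (use assms in auto)
  then show ?thesis
    using step unfolding smooth_def by blast
qed

lemma smooth_primitive:
  assumes "\<And>x. (F has_real_derivative f x) (at x)" "smooth f"
  shows "smooth F"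
proof -
  have "deriv F = f"
    using assms(1) by (auto simp: DERIV_imp_deriv)
  moreover have "F differentiable (at x)" for x
    using assms(1) real_differentiable_def by blast
  ultimately show ?thesis
    using assms(2) by (intro smooth_coinduct[where P = "\<lambda>g. g = F \<or> smooth g"])
      (auto simp: smooth_deriv smooth_differentiable)
qed

text \<open>By the Leibniz rule, products alone are not stable under differentiation. Together with
  sums, constants and affine substitutions they are, so coinduction applies to the whole
  class.\<close>

inductive smooth_closure :: "(real \<Rightarrow> real) \<Rightarrow> bool" where
  base: "smooth f \<Longrightarrow> smooth_closure f"
| const: "smooth_closure (\<lambda>x. c)"
| add: "smooth_closure f \<Longrightarrow> smooth_closure g \<Longrightarrow> smooth_closure (\<lambda>x. f x + g x)"
| mult: "smooth_closure f \<Longrightarrow> smooth_closure g \<Longrightarrow> smooth_closure (\<lambda>x. f x * g x)"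
| affine: "smooth_closure f \<Longrightarrow> smooth_closure (\<lambda>x. f (c * x + d))"

lemma smooth_closure_step:
  "smooth_closure f \<Longrightarrow> \<exists>f'. smooth_closure f' \<and> (\<forall>x. (f has_real_derivative f' x) (at x))"
proof (induction rule: smooth_closure.induct)
  case (base f)
  then show ?case
    using smooth_closure.base smooth_deriv smooth_has_deriv by blast
next
  case (const c)
  show ?case
    by (rule exI[of _ "\<lambda>x. 0"]) (auto intro: smooth_closure.const)
next
  case (add f g)
  then obtain f' g' where "smooth_closure f'" "smooth_closure g'"
    "\<And>x. (f has_real_derivative f' x) (at x)" "\<And>x. (g has_real_derivative g' x) (at x)"
    by blast
  then show ?case
    by (intro exI[of _ "\<lambda>x. f' x + g' x"]) (auto intro!: smooth_closure.add derivative_intros)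
next
  case (mult f g)
  then obtain f' g' where fg: "smooth_closure f'" "smooth_closure g'"
    "\<And>x. (f has_real_derivative f' x) (at x)" "\<And>x. (g has_real_derivative g' x) (at x)"
    by blast
  have "((\<lambda>x. f x * g x) has_real_derivative f' x * g x + f x * g' x) (at x)" for x
    using fg DERIV_mult'[OF fg(3)[of x] fg(4)[of x]] by (simp add: add.commute)
  then show ?case
    using fg mult.hyps
    by (intro exI[of _ "\<lambda>x. f' x * g x + f x * g' x"])
      (auto intro!: smooth_closure.add smooth_closure.mult)
next
  case (affine f c d)
  then obtain f' where f': "smooth_closure f'" "\<And>x. (f has_real_derivative f' x) (at x)"
    by blast
  have "((\<lambda>x. f (c * x + d)) has_real_derivative f' (c * x + d) * c) (at x)" for x
    by (rule DERIV_chain2[OF f'(2)]) (auto intro!: derivative_eq_intros)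
  then show ?case
    using f' by (intro exI[of _ "\<lambda>x. f' (c * x + d) * c"])
      (auto intro!: smooth_closure.mult smooth_closure.const smooth_closure.affine)
qed

lemma smooth_closure_smooth: "smooth_closure f \<Longrightarrow> smooth f"
proof (erule smooth_coinduct)
  fix g
  assume "smooth_closure g"
  then obtain g' where g': "smooth_closure g'" "\<And>x. (g has_real_derivative g' x) (at x)"
    using smooth_closure_step by blast
  then have "deriv g = g'"
    by (auto simp: DERIV_imp_deriv)
  then show "(\<forall>x. g differentiable (at x)) \<and> smooth_closure (deriv g)"
    using g' real_differentiable_def by blast
qed

lemma smooth_mult: "smooth f \<Longrightarrow> smooth g \<Longrightarrow> smooth (\<lambda>x. f x * g x)"
  by (rule smooth_closure_smooth) (intro smooth_closure.mult smooth_closure.base)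

lemma smooth_diff: "smooth f \<Longrightarrow> smooth g \<Longrightarrow> smooth (\<lambda>x. f x - g x)"
proof -
  assume "smooth f" "smooth g"
  then have "smooth (\<lambda>x. f x + (- 1) * g x)"
    by (intro smooth_closure_smooth[OF smooth_closure.add] smooth_closure.mult
        smooth_closure.const smooth_closure.base)
  then show ?thesis by simp
qed

lemma smooth_affine: "smooth f \<Longrightarrow> smooth (\<lambda>x. f (c * x + d))"
  by (rule smooth_closure_smooth) (intro smooth_closure.affine smooth_closure.base)

section \<open>Functions flat at the origin and smooth bumps\<close>

definition flat_fun :: "real poly \<Rightarrow> real \<Rightarrow> real" where
  "flat_fun P x = (if x > 0 then poly P (1 / x) * exp (- 1 / x) else 0)"

lemma poly_times_exp_tendsto_0:
  "((\<lambda>y. poly P y * exp (- y)) \<longlongrightarrow> (0::real)) at_top"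
proof -
  have "((\<lambda>y. \<Sum>i\<le>degree P. coeff P i * (y ^ i / exp y)) \<longlongrightarrow> (\<Sum>i\<le>degree P. coeff P i * 0)) at_top"
    by (intro tendsto_sum tendsto_mult tendsto_const tendsto_power_div_exp_0)
  then show ?thesis
    by (simp add: poly_altdef sum_distrib_right exp_minus divide_inverse mult.assoc)
qed

text \<open>With y = 1 / x, the x-derivative of P(y) exp(-y) is y^2 (P - P')(y) exp(-y), and
  \<open>[:0, 0, 1:]\<close> is y^2. The family is therefore closed under differentiation.\<close>

lemma flat_fun_deriv:
  "(flat_fun P has_real_derivative flat_fun ([:0, 0, 1:] * (P - pderiv P)) x) (at x)"
proof -
  consider "x > 0" | "x < 0" | "x = 0" by linarith
  then show ?thesis
  proof cases
    case 1
    have "((\<lambda>x. poly P (1 / x) * exp (- 1 / x)) has_real_derivative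
        flat_fun ([:0, 0, 1:] * (P - pderiv P)) x) (at x)"
    proof -
      have "((\<lambda>x. poly P (1 / x)) has_real_derivative poly (pderiv P) (1 / x) * (- 1 / x ^ 2)) (at x)"
        by (rule DERIV_chain2[OF poly_DERIV])
          (use 1 in \<open>auto intro!: derivative_eq_intros simp: power2_eq_square\<close>)
      moreover have "((\<lambda>x. exp (- 1 / x)) has_real_derivative exp (- 1 / x) * (1 / x ^ 2)) (at x)"
        by (rule DERIV_chain2[OF DERIV_exp])
          (use 1 in \<open>auto intro!: derivative_eq_intros simp: power2_eq_square\<close>)
      ultimately have "((\<lambda>x. poly P (1 / x) * exp (- 1 / x)) has_real_derivative
          poly P (1 / x) * (exp (- 1 / x) * (1 / x ^ 2))
          + poly (pderiv P) (1 / x) * (- 1 / x ^ 2) * exp (- 1 / x)) (at x)"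
        by (rule DERIV_mult')
      then show ?thesis
        using 1 by (simp add: flat_fun_def algebra_simps power2_eq_square)
    qed
    then show ?thesis
      by (rule has_field_derivative_transform_within_open[where S = "{0<..}"])
        (use 1 in \<open>auto simp: flat_fun_def\<close>)
  next
    case 2
    have "((\<lambda>x. 0) has_real_derivative flat_fun ([:0, 0, 1:] * (P - pderiv P)) x) (at x)"
      using 2 by (simp add: flat_fun_def)
    then show ?thesis
      by (rule has_field_derivative_transform_within_open[where S = "{..<0}"])
        (use 2 in \<open>auto simp: flat_fun_def\<close>)
  next
    case 3
    \<comment> \<open>\<open>pCons 0 P\<close> is y P(y): dividing by h is multiplying by y = 1 / h,
      so the difference quotient at 0 is again a polynomial times exp(-y).\<close>
    have "((\<lambda>h. poly (pCons 0 P) (inverse h) * exp (- inverse h)) \<longlongrightarrow> 0) (at_right 0)"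
      using filterlim_compose[OF poly_times_exp_tendsto_0 filterlim_inverse_at_top_right] .
    then have "((\<lambda>h. flat_fun P h / h) \<longlongrightarrow> 0) (at_right 0)"
      by (rule tendsto_cong[THEN iffD1, rotated])
        (auto simp: eventually_at_right_field flat_fun_def field_simps intro!: exI[of _ 1])
    moreover have "((\<lambda>h. flat_fun P h / h) \<longlongrightarrow> 0) (at_left 0)"
      by (rule tendsto_eventually)
        (auto simp: eventually_at_left_field flat_fun_def intro!: exI[of _ "-1"])
    ultimately have "((\<lambda>h. flat_fun P h / h) \<longlongrightarrow> 0) (at 0)"
      by (simp add: filterlim_at_split)
    then show ?thesis
      using 3 by (simp add: DERIV_def flat_fun_def)
  qed
qed

lemma smooth_flat_fun: "smooth (flat_fun P)"
proof (rule smooth_coinduct[where P = "\<lambda>g. \<exists>P. g = flat_fun P"])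
  fix g
  assume "\<exists>P. g = flat_fun P"
  then obtain P where "g = flat_fun P" by blast
  then show "(\<forall>x. g differentiable (at x)) \<and> (\<exists>P. deriv g = flat_fun P)"
    using flat_fun_deriv[of P] DERIV_imp_deriv[OF flat_fun_deriv[of P]]
    by (auto simp: real_differentiable_def)
qed blast

text \<open>With N = n + 1 this is exp(-1 / (N x)) exp(-1 / (N (h - x))) on (0, h). It stays below 1
  and tends to the indicator of (0, h), so dominated convergence can replace mollification.\<close>

definition interval_bump :: "real \<Rightarrow> nat \<Rightarrow> real \<Rightarrow> real" where
  "interval_bump h n x = flat_fun 1 (real (Suc n) * x) * flat_fun 1 (real (Suc n) * (h - x))"

lemma smooth_interval_bump: "smooth (interval_bump h n)"
proof -
  have "smooth (\<lambda>x. flat_fun 1 (real (Suc n) * x + 0) * flat_fun 1 (- real (Suc n) * x + real (Suc n) * h))"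
    by (intro smooth_mult smooth_affine smooth_flat_fun)
  moreover have "interval_bump h n = (\<lambda>x. flat_fun 1 (real (Suc n) * x + 0)
      * flat_fun 1 (- real (Suc n) * x + real (Suc n) * h))"
    by (rule ext) (simp add: interval_bump_def right_diff_distrib del: of_nat_Suc)
  ultimately show ?thesis
    by simp
qed

lemma interval_bump_bounds: "0 \<le> interval_bump h n x" "interval_bump h n x \<le> 1"
  unfolding interval_bump_def by (simp_all add: flat_fun_def mult_le_one del: of_nat_Suc)

lemma interval_bump_eq_0: "x \<le> 0 \<or> h \<le> x \<Longrightarrow> interval_bump h n x = 0"
  unfolding interval_bump_def by (auto simp: flat_fun_def zero_less_mult_iff)

lemma interval_bump_tendsto:
  "(\<lambda>n. interval_bump h n x) \<longlonglongrightarrow> indicat_real {0<..<h} x"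
proof (cases "0 < x \<and> x < h")
  case True
  have *: "(\<lambda>n. flat_fun 1 (real (Suc n) * y)) \<longlonglongrightarrow> 1" if "y > 0" for y
  proof -
    have "(\<lambda>n. exp (- (1 / y) * inverse (real (Suc n)))) \<longlonglongrightarrow> exp (- (1 / y) * 0)"
      by (intro tendsto_intros LIMSEQ_inverse_real_of_nat)
    then show ?thesis
      using that by (simp add: flat_fun_def zero_less_mult_iff field_simps del: of_nat_Suc)
  qed
  have "(\<lambda>n. interval_bump h n x) \<longlonglongrightarrow> 1 * 1"
    unfolding interval_bump_def using True by (intro tendsto_mult *) auto
  then show ?thesis using True by simp
next
  case False
  then show ?thesis by (auto simp: interval_bump_eq_0)
qed

section \<open>Local integrability\<close>

abbreviation lebpos :: "real measure" where
  "lebpos \<equiv> lebesgue_on {0<..}"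

abbreviation wpow :: "real \<Rightarrow> real \<Rightarrow> (real \<Rightarrow> real) \<Rightarrow> real \<Rightarrow> real" where
  "wpow p b f \<equiv> \<lambda>r. \<bar>f r\<bar> powr p * r powr b"

abbreviation wint :: "real \<Rightarrow> real \<Rightarrow> (real \<Rightarrow> real) \<Rightarrow> real" where
  "wint p b f \<equiv> LINT r|lebpos. \<bar>f r\<bar> powr p * r powr b"

lemma AE_lebpos_iff_negligible:
  "(AE r in lebpos. P r) \<longleftrightarrow> (\<exists>N. negligible N \<and> (\<forall>r>0. r \<notin> N \<longrightarrow> P r))"
proof -
  have "(AE r in lebpos. P r) \<longleftrightarrow> (AE r in lebesgue. r > 0 \<longrightarrow> P r)"
    by (subst AE_restrict_space_iff) auto
  also have "\<dots> \<longleftrightarrow> (\<exists>N. negligible N \<and> (\<forall>r>0. r \<notin> N \<longrightarrow> P r))"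
    by (auto simp: eventually_ae_filter negligible_iff_null_sets)
  finally show ?thesis .
qed

lemma loc_integrable_absolutely:
  assumes "loc_integrable u" "0 < a"
  shows "u absolutely_integrable_on {a..b}"
proof -
  have "u absolutely_integrable_on {a..max b (a + 1)}"
    using assms unfolding loc_integrable_def by (auto simp: less_max_iff_disj)
  then show ?thesis
    by (rule set_integrable_subset) auto
qed

lemma loc_integrable_lebpos:
  assumes "loc_integrable u" "0 < a"
  shows "integrable lebpos (\<lambda>r. indicator {a..b} r * u r)"
proof -
  have "(\<lambda>r. indicator {0<..} r *\<^sub>R (indicat_real {a..b} r * u r)) = (\<lambda>r. indicator {a..b} r *\<^sub>R u r)"
    using assms(2) by (auto simp: indicator_def)
  then show ?thesis
    using loc_integrable_absolutely[OF assms] unfolding set_integrable_def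
    by (subst integrable_restrict_space) auto
qed

lemma loc_integrable_measurable:
  assumes "loc_integrable u"
  shows "u \<in> borel_measurable lebpos"
proof (rule borel_measurable_LIMSEQ_metric)
  show "(\<lambda>r. indicator {1 / real (Suc n)..real n} r * u r) \<in> borel_measurable lebpos" for n
    using loc_integrable_lebpos[OF assms, of "1 / real (Suc n)"] by auto
  fix r assume "r \<in> space lebpos"
  then have "r > 0" by simp
  then have "\<forall>\<^sub>F n in sequentially. 1 / real (Suc n) < r"
    by real_asymp
  moreover have "\<forall>\<^sub>F n in sequentially. r < real n"
    by real_asymp
  ultimately have "\<forall>\<^sub>F n in sequentially. indicator {1 / real (Suc n)..real n} r * u r = u r"
    by eventually_elim auto
  then show "(\<lambda>n. indicator {1 / real (Suc n)..real n} r * u r) \<longlonglongrightarrow> u r"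
    by (rule tendsto_eventually)
qed

lemma loc_integrable_integrable_on:
  "loc_integrable u \<Longrightarrow> 0 < a \<Longrightarrow> u integrable_on {a..b}"
  using loc_integrable_absolutely set_lebesgue_integral_eq_integral(1) by blast

lemma LINT_lebpos_interval:
  assumes "loc_integrable u" "0 < a"
  shows "(LINT r|lebpos. indicator {a..b} r * u r) = integral {a..b} u"
proof -
  have "(\<lambda>r. indicator {0<..} r *\<^sub>R (indicat_real {a..b} r * u r)) = (\<lambda>r. indicator {a..b} r *\<^sub>R u r)"
    using assms(2) by (auto simp: indicator_def)
  then have "(LINT r|lebpos. indicator {a..b} r * u r) = (LINT r:{a..b}|lebesgue. u r)"
    by (subst integral_restrict_space) (auto simp: set_lebesgue_integral_def)
  also have "\<dots> = integral {a..b} u"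
    using loc_integrable_absolutely[OF assms] set_lebesgue_integral_eq_integral(2) by blast
  finally show ?thesis .
qed

text \<open>Lebesgue differentiation with averages to the right of c, applied to truncations of u to
  compact intervals; the countably many exceptional null sets are united.\<close>

lemma loc_integrable_lebesgue_point:
  assumes "loc_integrable u"
  shows "AE c in lebpos. (\<lambda>n. real (Suc n) * integral {c..c + 1 / real (Suc n)} u) \<longlonglongrightarrow> u c"
proof -
  \<comment> \<open>The range of c is half-open so that short intervals to the right of c stay
    inside the truncation.\<close>
  have "AE c in lebpos. c \<in> {1 / real (Suc k)..<real (Suc k)} \<longrightarrow>
     (\<lambda>n. real (Suc n) * integral {c..c + 1 / real (Suc n)} u) \<longlonglongrightarrow> u c" for k
  proof -
    define f where "f = (\<lambda>r. if r \<in> {1 / real (Suc k)..real (Suc k)} then u r else 0)"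
    have "f integrable_on UNIV"
      unfolding f_def
      using loc_integrable_integrable_on[OF assms, of "1 / real (Suc k)" "real (Suc k)"]
      by (subst integrable_restrict_UNIV) auto
    then have "f integrable_on cbox a b" for a b
      by (rule integrable_on_subcbox) auto
    then obtain N where N: "negligible N"
      "\<And>x e. \<lbrakk>x \<notin> N; 0 < e\<rbrakk> \<Longrightarrow> \<exists>d>0. \<forall>h. 0 < h \<and> h < d \<longrightarrow>
          norm (integral (cbox x (x + h *\<^sub>R One)) f /\<^sub>R h ^ DIM(real) - f x) < e"
      using integrable_ccontinuous_explicit[of f] by metis
    have "(\<lambda>n. real (Suc n) * integral {c..c + 1 / real (Suc n)} u) \<longlonglongrightarrow> u c"
      if c: "c \<notin> N" "c \<in> {1 / real (Suc k)..<real (Suc k)}" for c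
    proof (rule LIMSEQ_I)
      fix e :: real assume "e > 0"
      then obtain d where d: "d > 0" "\<And>h. 0 < h \<Longrightarrow> h < d \<Longrightarrow>
          norm (integral (cbox c (c + h *\<^sub>R One)) f /\<^sub>R h ^ DIM(real) - f c) < e"
        using N(2)[OF c(1)] by blast
      have "\<forall>\<^sub>F n in sequentially. 1 / real (Suc n) < min d (real (Suc k) - c)"
        using d(1) c(2) by (intro order_tendstoD(2)[of _ 0]) (real_asymp, auto)
      then obtain n0 where n0: "\<And>n. n \<ge> n0 \<Longrightarrow> 1 / real (Suc n) < min d (real (Suc k) - c)"
        by (auto simp: eventually_sequentially)
      have "norm (real (Suc n) * integral {c..c + 1 / real (Suc n)} u - u c) < e" if "n \<ge> n0" for n
      proof -
        let ?h = "1 / real (Suc n)"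
        have h: "0 < ?h" "?h < d" "c + ?h < real (Suc k)" using n0[OF that] by auto
        have "integral {c..c + ?h} f = integral {c..c + ?h} u"
          by (rule integral_cong) (use c h in \<open>auto simp: f_def\<close>)
        moreover have "f c = u c" using c by (auto simp: f_def)
        ultimately show ?thesis
          using d(2)[OF h(1,2)] by (simp add: field_simps)
      qed
      then show "\<exists>no. \<forall>n\<ge>no. norm (real (Suc n) * integral {c..c + 1 / real (Suc n)} u - u c) < e"
        by blast
    qed
    then show ?thesis
      unfolding AE_lebpos_iff_negligible using N(1) by blast
  qed
  then have "AE c in lebpos. \<forall>k. c \<in> {1 / real (Suc k)..<real (Suc k)} \<longrightarrow>
     (\<lambda>n. real (Suc n) * integral {c..c + 1 / real (Suc n)} u) \<longlonglongrightarrow> u c"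
    by (subst AE_all_countable) blast
  moreover have "\<exists>k. c \<in> {1 / real (Suc k)..<real (Suc k)}" if "c > 0" for c :: real
  proof -
    have "\<forall>\<^sub>F n in sequentially. 1 / real (Suc n) < c \<and> c < real (Suc n)"
      using that by (intro eventually_conj; real_asymp)
    then obtain n where "1 / real (Suc n) < c \<and> c < real (Suc n)"
      by (auto simp: eventually_sequentially)
    then show ?thesis by (intro exI[of _ n]) auto
  qed
  ultimately show ?thesis
    unfolding AE_lebpos_iff_negligible by blast
qed

text \<open>The set where two continuous functions differ is open, and an open null set is
  empty.\<close>

lemma continuous_AE_eq_imp_eq:
  fixes f g :: "real \<Rightarrow> real"
  assumes "continuous_on {0<..} f" "continuous_on {0<..} g" "AE r in lebpos. f r = g r" "r > 0"
  shows "f r = g r"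
proof -
  obtain N where N: "negligible N" "\<And>r. r > 0 \<Longrightarrow> r \<notin> N \<Longrightarrow> f r = g r"
    using assms(3) unfolding AE_lebpos_iff_negligible by blast
  have "open {r \<in> {0<..}. f r - g r \<in> - {0}}"
    using continuous_open_preimage[of "{0<..}" "\<lambda>r. f r - g r" "- {0}"] assms(1,2)
    by (auto intro!: continuous_intros simp: vimage_def Int_def)
  moreover have "negligible {r \<in> {0<..}. f r - g r \<in> - {0}}"
    by (rule negligible_subset[OF N(1)]) (use N(2) in auto)
  ultimately have "{r \<in> {0<..}. f r - g r \<in> - {0}} = {}"
    using open_not_negligible by blast
  then show ?thesis using assms(4) by auto
qed

section \<open>Weak derivatives and primitives\<close>

lemma test_functionI:
  assumes "smooth \<phi>" "0 < a" "\<And>r. r \<notin> {a..b} \<Longrightarrow> \<phi> r = 0"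
  shows "\<phi> \<in> test_functions {0<..}"
proof -
  have "{x. \<phi> x \<noteq> 0} \<subseteq> {a..b}"
    using assms(3) by blast
  then have sub: "closure {x. \<phi> x \<noteq> 0} \<subseteq> {a..b}"
    by (rule closure_minimal) simp
  then have "compact (closure {x. \<phi> x \<noteq> 0})"
    by (meson bounded_closed_interval bounded_subset closed_closure compact_eq_bounded_closed)
  then show ?thesis
    using assms(1,2) sub unfolding test_functions_def smooth_def by auto
qed

lemma test_functionE:
  assumes "\<phi> \<in> test_functions {0<..}"
  obtains a b where "smooth \<phi>" "0 < a" "a < b" "\<And>r. r \<notin> {a..b} \<Longrightarrow> \<phi> r = 0"
    "\<And>r. r \<notin> {a..b} \<Longrightarrow> deriv \<phi> r = 0"
proof -
  let ?K = "closure {x. \<phi> x \<noteq> 0}"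
  have K: "compact ?K" "?K \<subseteq> {0<..}" and sm: "smooth \<phi>"
    using assms unfolding test_functions_def smooth_def by auto
  obtain a b where ab: "0 < a" "a < b" "?K \<subseteq> {a..b}"
  proof (cases "?K = {}")
    case True
    then show ?thesis using that[of 1 2] by auto
  next
    case False
    then obtain x y where "x \<in> ?K" "y \<in> ?K" "\<And>z. z \<in> ?K \<Longrightarrow> x \<le> z" "\<And>z. z \<in> ?K \<Longrightarrow> z \<le> y"
      using compact_attains_inf[OF K(1)] compact_attains_sup[OF K(1)] by blast
    then show ?thesis
      using K(2) that[of x "y + 1"] by force
  qed
  have z: "\<phi> r = 0" if "r \<notin> {a..b}" for r
    using ab(3) closure_subset[of "{x. \<phi> x \<noteq> 0}"] that by auto
  have "deriv \<phi> r = 0" if "r \<notin> {a..b}" for r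
  proof -
    have "(\<phi> has_real_derivative 0) (at r)"
      by (rule has_field_derivative_transform_within_open[where S = "- {a..b}" and f = "\<lambda>_. 0"])
        (use that z in auto)
    then show ?thesis by (rule DERIV_imp_deriv)
  qed
  then show ?thesis using that ab(1,2) sm z by blast
qed

text \<open>The primitive of the indicator of (0, h) that vanishes at 0, hence the limit of the
  primitives of \<open>interval_bump h n\<close>.\<close>

definition ramp :: "real \<Rightarrow> real \<Rightarrow> real" where
  "ramp h y = min (max y 0) h"

text \<open>Integration keeps the bumps smooth and turns their convergence to an indicator into
  convergence to \<open>ramp\<close>. To the right of h the value is a positive constant depending
  on n, so \<open>\<Phi> n\<close> alone is no test function.\<close>

lemma interval_bump_primitive:
  assumes "h > 0"
  obtains \<Phi> where "\<And>n y. (\<Phi> n has_real_derivative interval_bump h n y) (at y)"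
    "\<And>n y. y \<le> 0 \<Longrightarrow> \<Phi> n y = 0" "\<And>n y. h \<le> y \<Longrightarrow> \<Phi> n y = \<Phi> n h"
    "\<And>n y. \<bar>\<Phi> n y\<bar> \<le> h" "\<And>y. (\<lambda>n. \<Phi> n y) \<longlonglongrightarrow> ramp h y"
proof -
  have cont: "isCont (interval_bump h n) y" for n y
    by (rule DERIV_isCont[OF smooth_has_deriv[OF smooth_interval_bump]])
  have "\<exists>F. \<forall>y. (F has_real_derivative interval_bump h n y) (at y)" for n
    using einterval_antiderivative[of "-\<infinity>" "\<infinity>" "interval_bump h n"] cont
    by (simp add: has_real_derivative_iff_has_vector_derivative)
  then obtain F where F: "\<And>n y. (F n has_real_derivative interval_bump h n y) (at y)"
    by metis
  define \<Phi> where "\<Phi> = (\<lambda>n y. F n y - F n 0)"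
  have d: "(\<Phi> n has_real_derivative interval_bump h n y) (at y)" for n y
    unfolding \<Phi>_def using F by (auto intro!: derivative_eq_intros)
  have const: "\<Phi> n y = \<Phi> n z" if yz: "y \<le> z" "z \<le> 0 \<or> h \<le> y" for n y z
  proof (cases "y = z")
    case False
    then have "y < z" using yz(1) by simp
    then obtain x where x: "y < x" "x < z" "\<Phi> n z - \<Phi> n y = (z - y) * interval_bump h n x"
      using MVT2[OF _ d, of y z n] by blast
    then have "interval_bump h n x = 0"
      using yz(2) by (intro interval_bump_eq_0) linarith
    then show ?thesis using x(3) by simp
  qed simp
  have z: "\<Phi> n y = 0" if "y \<le> 0" for n y
    using const[OF that, of n] by (simp add: \<Phi>_def)
  have c: "\<Phi> n y = \<Phi> n h" if "h \<le> y" for n y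
    using const[OF that, of n] by simp
  have int: "(interval_bump h n has_integral \<Phi> n y) {0..y}" if "0 \<le> y" for n y
  proof -
    have "(interval_bump h n has_integral \<Phi> n y - \<Phi> n 0) {0..y}"
      by (rule fundamental_theorem_of_calculus[OF that], rule has_vector_derivative_at_within)
        (use d in \<open>simp add: has_real_derivative_iff_has_vector_derivative\<close>)
    then show ?thesis using z[of 0 n] by simp
  qed
  have mono: "\<Phi> n y \<ge> 0" "\<Phi> n y \<le> y" if "0 \<le> y" for n y
  proof -
    show "\<Phi> n y \<ge> 0"
      by (rule has_integral_nonneg[OF int[OF that]]) (rule interval_bump_bounds)
    have "\<Phi> n y \<le> measure lborel {0..y} *\<^sub>R (1::real)"
      by (rule has_integral_le[OF int[OF that] has_integral_const_real]) (rule interval_bump_bounds)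
    then show "\<Phi> n y \<le> y" using that by simp
  qed
  have b: "\<bar>\<Phi> n y\<bar> \<le> h" for n y
  proof -
    consider "y \<le> 0" | "0 \<le> y" "y \<le> h" | "h \<le> y" by linarith
    then show ?thesis
    proof cases
      case 1
      then show ?thesis using z assms by simp
    next
      case 2
      then show ?thesis using mono[of y n] by linarith
    next
      case 3
      then show ?thesis using c[OF 3, of n] mono[of h n] assms by linarith
    qed
  qed
  have lim: "(\<lambda>n. \<Phi> n y) \<longlonglongrightarrow> ramp h y" for y
  proof (cases "y \<le> 0")
    case True
    then show ?thesis using z assms by (simp add: ramp_def)
  next
    case False
    have *: "(\<lambda>n. \<Phi> n y) \<longlonglongrightarrow> y" if "0 \<le> y" "y \<le> h" for y
    proof -
      have "(\<lambda>n. integral {0..y} (interval_bump h n)) \<longlonglongrightarrow> integral {0..y} (indicat_real {0<..<h})"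
      proof (rule dominated_convergence(2)[where h = "\<lambda>_. 1"])
        show "interval_bump h n integrable_on {0..y}" for n
          using int[OF that(1)] by (rule has_integral_integrable)
        show "norm (interval_bump h n x) \<le> 1" for n x
          using interval_bump_bounds[of h n x] by simp
      qed (auto intro: interval_bump_tendsto)
      moreover have "integral {0..y} (indicat_real {0<..<h}) = integral {0..y} (\<lambda>_. 1)"
        by (rule integral_spike[of "{0, h}"]) (use that in auto)
      ultimately show ?thesis
        using integral_unique[OF int[OF that(1)]] that(1) by simp
    qed
    show ?thesis
    proof (cases "y \<le> h")
      case True
      then show ?thesis using *[of y] False by (simp add: ramp_def)
    next
      case F: False
      then have "(\<lambda>n. \<Phi> n y) = (\<lambda>n. \<Phi> n h)" by (intro ext c) simp
      then show ?thesis using *[of h] F assms by (simp add: ramp_def)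
    qed
  qed
  show ?thesis using that[OF d z c b lim] .
qed

section \<open>The weak derivative tested against trapezoids\<close>

lemma abs_mult_le_indicator:
  fixes a b C :: real
  assumes "r \<notin> S \<Longrightarrow> b = 0" "\<bar>b\<bar> \<le> C"
  shows "norm (a * b) \<le> C * \<bar>indicator S r * a\<bar>"
proof (cases "r \<in> S")
  case True
  have "norm (a * b) = \<bar>b\<bar> * \<bar>a\<bar>" by (simp add: abs_mult)
  also have "\<dots> \<le> C * \<bar>a\<bar>" by (rule mult_right_mono[OF assms(2)]) simp
  finally show ?thesis using True by simp
qed (use assms(1) in simp)

text \<open>The defining identity of the weak derivative extends to the trapezoid test functions whose
  derivative is the difference of two indicators of intervals of equal length.\<close>

lemma has_weak_deriv_trapezoid:
  assumes uv: "has_weak_deriv u v" and "0 < c" "c < d" "0 < h"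
  shows "integral {c..c + h} u - integral {d..d + h} u
    = - (LINT r|lebpos. v r * (ramp h (r - c) - ramp h (r - d)))"
proof -
  obtain \<Phi> where \<Phi>: "\<And>n y. (\<Phi> n has_real_derivative interval_bump h n y) (at y)"
    "\<And>n y. y \<le> 0 \<Longrightarrow> \<Phi> n y = 0" "\<And>n y. h \<le> y \<Longrightarrow> \<Phi> n y = \<Phi> n h"
    "\<And>n y. \<bar>\<Phi> n y\<bar> \<le> h" "\<And>y. (\<lambda>n. \<Phi> n y) \<longlonglongrightarrow> ramp h y"
    by (rule interval_bump_primitive[OF \<open>0 < h\<close>]) (rule that)
  have loc: "loc_integrable u" "loc_integrable v"
    and weak: "\<And>\<phi>. \<phi> \<in> test_functions {0<..} \<Longrightarrow>
      (LINT r|lebpos. u r * deriv \<phi> r) = - (LINT r|lebpos. v r * \<phi> r)"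
    using uv unfolding has_weak_deriv_def by auto
  \<comment> \<open>A difference of two translates: beyond both intervals the plateau heights
    cancel, which gives compact support.\<close>
  define \<phi> where "\<phi> = (\<lambda>n r. \<Phi> n (r - c) - \<Phi> n (r - d))"
  define \<psi> where "\<psi> = (\<lambda>n r. interval_bump h n (r - c) - interval_bump h n (r - d))"
  have shift: "((\<lambda>r. \<Phi> n (r - e)) has_real_derivative interval_bump h n (r - e)) (at r)" for n e r
    using DERIV_shift[THEN iffD1, of "\<Phi> n" "interval_bump h n (r - e)" r "- e"] \<Phi>(1)[of n "r - e"]
    by simp
  have deriv: "(\<phi> n has_real_derivative \<psi> n r) (at r)" for n r
    unfolding \<phi>_def \<psi>_def
    by (rule DERIV_diff[OF shift shift])
  have smooth_shift: "smooth (\<lambda>r. interval_bump h n (r - e))" for n e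
    using smooth_affine[OF smooth_interval_bump[of h n], of 1 "- e"] by simp
  have smooth_\<psi>: "smooth (\<psi> n)" for n
    unfolding \<psi>_def by (intro smooth_diff smooth_shift)
  have sm: "smooth (\<phi> n)" for n
    using smooth_primitive[OF deriv smooth_\<psi>] .
  have \<phi>_out: "\<phi> n r = 0" if "r \<notin> {c..d + h}" for n r
  proof (cases "r < c")
    case True
    then show ?thesis using \<open>c < d\<close> by (simp add: \<phi>_def \<Phi>(2))
  next
    case False
    then have "h \<le> r - c" "h \<le> r - d" using that \<open>c < d\<close> by auto
    then show ?thesis
      using \<Phi>(3)[of "r - c" n] \<Phi>(3)[of "r - d" n] unfolding \<phi>_def by linarith
  qed
  have \<psi>_out: "\<psi> n r = 0" if "r \<notin> {c..d + h}" for n r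
    using that \<open>c < d\<close> \<open>0 < h\<close> by (auto simp: \<psi>_def interval_bump_eq_0)
  have "\<phi> n \<in> test_functions {0<..}" for n
    by (rule test_functionI[OF sm \<open>0 < c\<close> \<phi>_out])
  moreover have "deriv (\<phi> n) = \<psi> n" for n
    using deriv by (auto simp: DERIV_imp_deriv)
  ultimately have eq: "(LINT r|lebpos. u r * \<psi> n r) = - (LINT r|lebpos. v r * \<phi> n r)" for n
    using weak[of "\<phi> n"] by simp
  note um = loc_integrable_measurable[OF loc(1)] and vm = loc_integrable_measurable[OF loc(2)]
  have cont_m: "f \<in> borel_measurable lebpos" if "\<And>x. isCont f x" for f :: "real \<Rightarrow> real"
    by (rule continuous_imp_measurable_on_sets_lebesgue)
      (use that in \<open>auto intro: continuous_at_imp_continuous_on\<close>)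
  have \<psi>_m: "\<psi> n \<in> borel_measurable lebpos" and \<phi>_m: "\<phi> n \<in> borel_measurable lebpos" for n
    by (rule cont_m, rule DERIV_isCont[OF smooth_has_deriv[OF smooth_\<psi>]],
        rule cont_m, rule DERIV_isCont[OF deriv])
  have bump1: "\<bar>interval_bump h n y\<bar> \<le> 1" for n y
    using interval_bump_bounds by (simp add: abs_of_nonneg)
  have \<psi>_b: "\<bar>\<psi> n r\<bar> \<le> 2" for n r
    unfolding \<psi>_def using bump1[of n "r - c"] bump1[of n "r - d"] by linarith
  have \<phi>_b: "\<bar>\<phi> n r\<bar> \<le> 2 * h" for n r
    unfolding \<phi>_def using \<Phi>(4)[of n "r - c"] \<Phi>(4)[of n "r - d"] by linarith
  have ind_m: "(\<lambda>r. indicat_real {e<..<e + h} r) \<in> borel_measurable lebpos" for e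
    by (intro measurable_restrict_space1 borel_measurable_indicator) auto
  have ind_shift: "indicat_real {0<..<h} (r - e) = indicat_real {e<..<e + h} r" for r e
    by (auto simp: indicator_def)
  have lim1: "(\<lambda>n. LINT r|lebpos. u r * \<psi> n r) \<longlonglongrightarrow>
      (LINT r|lebpos. u r * (indicat_real {c<..<c + h} r - indicat_real {d<..<d + h} r))"
  proof (rule integral_dominated_convergence[where w = "\<lambda>r. 2 * \<bar>indicator {c..d + h} r * u r\<bar>"])
    show "AE r in lebpos. norm (u r * \<psi> n r) \<le> 2 * \<bar>indicator {c..d + h} r * u r\<bar>" for n
      by (intro AE_I2 abs_mult_le_indicator \<psi>_out \<psi>_b)
    show "AE r in lebpos. (\<lambda>n. u r * \<psi> n r) \<longlonglongrightarrow>
        u r * (indicat_real {c<..<c + h} r - indicat_real {d<..<d + h} r)"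
      unfolding \<psi>_def ind_shift[symmetric]
      by (intro AE_I2 tendsto_intros interval_bump_tendsto)
    show "integrable lebpos (\<lambda>r. 2 * \<bar>indicator {c..d + h} r * u r\<bar>)"
      by (rule integrable_mult_right[OF integrable_abs[OF loc_integrable_lebpos[OF loc(1) \<open>0 < c\<close>]]])
    show "(\<lambda>r. u r * \<psi> n r) \<in> borel_measurable lebpos" for n
      by (rule borel_measurable_times[OF um \<psi>_m])
    show "(\<lambda>r. u r * (indicat_real {c<..<c + h} r - indicat_real {d<..<d + h} r)) \<in> borel_measurable lebpos"
      by (rule borel_measurable_times[OF um borel_measurable_diff[OF ind_m ind_m]])
  qed
  have ramp_m: "(\<lambda>r. ramp h (r - e)) \<in> borel_measurable lebpos" for e
    by (rule continuous_imp_measurable_on_sets_lebesgue) (auto simp: ramp_def intro!: continuous_intros)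
  have lim2: "(\<lambda>n. LINT r|lebpos. v r * \<phi> n r) \<longlonglongrightarrow>
      (LINT r|lebpos. v r * (ramp h (r - c) - ramp h (r - d)))"
  proof (rule integral_dominated_convergence[where w = "\<lambda>r. 2 * h * \<bar>indicator {c..d + h} r * v r\<bar>"])
    show "AE r in lebpos. norm (v r * \<phi> n r) \<le> 2 * h * \<bar>indicator {c..d + h} r * v r\<bar>" for n
      by (intro AE_I2 abs_mult_le_indicator \<phi>_out \<phi>_b)
    show "AE r in lebpos. (\<lambda>n. v r * \<phi> n r) \<longlonglongrightarrow> v r * (ramp h (r - c) - ramp h (r - d))"
      unfolding \<phi>_def by (intro AE_I2 tendsto_intros \<Phi>(5))
    show "integrable lebpos (\<lambda>r. 2 * h * \<bar>indicator {c..d + h} r * v r\<bar>)"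
      by (rule integrable_mult_right[OF integrable_abs[OF loc_integrable_lebpos[OF loc(2) \<open>0 < c\<close>]]])
    show "(\<lambda>r. v r * \<phi> n r) \<in> borel_measurable lebpos" for n
      by (rule borel_measurable_times[OF vm \<phi>_m])
    show "(\<lambda>r. v r * (ramp h (r - c) - ramp h (r - d))) \<in> borel_measurable lebpos"
      by (rule borel_measurable_times[OF vm borel_measurable_diff[OF ramp_m ramp_m]])
  qed
  \<comment> \<open>The bumps converge to indicators of open intervals; the closed ones differ from
    them in a null set.\<close>
  have ind_int: "integrable lebpos (\<lambda>r. u r * indicat_real {e<..<e + h} r)"
    "(LINT r|lebpos. u r * indicat_real {e<..<e + h} r) = integral {e..e + h} u" if "0 < e" for e
  proof -
    have ae: "AE r in lebpos. indicator {e..e + h} r * u r = u r * indicat_real {e<..<e + h} r"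
      unfolding AE_lebpos_iff_negligible
      by (rule exI[of _ "{e, e + h}"]) (auto simp: indicator_def)
    have m: "(\<lambda>r. u r * indicat_real {e<..<e + h} r) \<in> borel_measurable lebpos"
      using um ind_m by (rule borel_measurable_times)
    note i = loc_integrable_lebpos[OF loc(1) that, of "e + h"]
    show "integrable lebpos (\<lambda>r. u r * indicat_real {e<..<e + h} r)"
      using integrable_cong_AE[OF borel_measurable_integrable[OF i] m ae] i by simp
    show "(LINT r|lebpos. u r * indicat_real {e<..<e + h} r) = integral {e..e + h} u"
      using integral_cong_AE[OF borel_measurable_integrable[OF i] m ae]
        LINT_lebpos_interval[OF loc(1) that, of "e + h"] by simp
  qed
  have "integral {c..c + h} u - integral {d..d + h} u =
      (LINT r|lebpos. u r * (indicat_real {c<..<c + h} r - indicat_real {d<..<d + h} r))"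
    unfolding right_diff_distrib
    using \<open>0 < c\<close> \<open>c < d\<close>
    by (subst Bochner_Integration.integral_diff[OF ind_int(1) ind_int(1)]) (auto simp only: ind_int(2))
  also have "\<dots> = - (LINT r|lebpos. v r * (ramp h (r - c) - ramp h (r - d)))"
  proof (rule LIMSEQ_unique[OF lim1])
    show "(\<lambda>n. LINT r|lebpos. u r * \<psi> n r) \<longlonglongrightarrow>
        - (LINT r|lebpos. v r * (ramp h (r - c) - ramp h (r - d)))"
      by (rule Lim_transform_eventually[OF tendsto_minus[OF lim2] always_eventually])
        (intro allI eq[symmetric])
  qed
  finally show ?thesis .
qed

section \<open>Locally absolutely continuous representatives\<close>

definition is_primitive :: "(real \<Rightarrow> real) \<Rightarrow> (real \<Rightarrow> real) \<Rightarrow> bool" where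
  "is_primitive w v \<longleftrightarrow> loc_integrable v \<and> (\<forall>c d. 0 < c \<longrightarrow> c \<le> d \<longrightarrow> w d - w c = integral {c..d} v)"

lemma is_primitive_continuous:
  assumes "is_primitive w v"
  shows "continuous_on {0<..} w"
proof (rule continuous_at_imp_continuous_on, intro ballI)
  fix x :: real assume "x \<in> {0<..}"
  then have "x > 0" by simp
  have cont: "continuous_on {x/2..x+1} (\<lambda>d. w (x/2) + integral {x/2..d} v)"
    using assms \<open>x > 0\<close> unfolding is_primitive_def
    by (intro continuous_intros indefinite_integral_continuous_1 loc_integrable_integrable_on) auto
  have "w (x/2) + integral {x/2..d} v = w d" if "d \<in> {x/2..x+1}" for d
  proof -
    have "w d - w (x/2) = integral {x/2..d} v"
      using assms \<open>x > 0\<close> that unfolding is_primitive_def by simp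
    then show ?thesis by linarith
  qed
  from continuous_on_eq[OF cont this] have "continuous_on {x/2..x+1} w" .
  then show "isCont w x"
    by (rule continuous_on_interior) (use \<open>x > 0\<close> in auto)
qed

text \<open>Divide the trapezoid identity by h and let h tend to 0. At Lebesgue points c and d of u
  the left side tends to u c - u d, while the trapezoids tend to the indicator of the interval from
  c to d. This is the fundamental theorem off a null set; the primitive w extends it to all
  points.\<close>

theorem has_weak_deriv_imp_primitive:
  assumes uv: "has_weak_deriv u v"
  obtains w where "is_primitive w v" "AE r in lebpos. u r = w r"
proof -
  have loc: "loc_integrable u" "loc_integrable v"
    using uv unfolding has_weak_deriv_def by auto
  note vint = loc_integrable_integrable_on[OF loc(2)]
  let ?P = "\<lambda>c. (\<lambda>n. real (Suc n) * integral {c..c + 1 / real (Suc n)} u) \<longlonglongrightarrow> u c"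
  obtain N where N: "negligible N" "\<And>c. c > 0 \<Longrightarrow> c \<notin> N \<Longrightarrow> ?P c"
    using loc_integrable_lebesgue_point[OF loc(1)] unfolding AE_lebpos_iff_negligible by blast
  have diff: "u d - u c = integral {c..d} v" if cd: "0 < c" "c < d" "c \<notin> N" "d \<notin> N" for c d
  proof -
    \<comment> \<open>The trapezoid of height 1 whose sloping sides have width 1 / (n + 1).\<close>
    define q where "q = (\<lambda>n r. real (Suc n) * (ramp (1 / real (Suc n)) (r - c) - ramp (1 / real (Suc n)) (r - d)))"
    have q_out: "q n r = 0" if "r \<notin> {c..d + 1}" for n r
    proof (cases "r < c")
      case True
      then show ?thesis using cd by (simp add: q_def ramp_def)
    next
      case False
      then have "r > d + 1" using that by auto
      moreover have "1 / real (Suc n) \<le> 1" by simp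
      ultimately have *: "1 / real (Suc n) \<le> r - d" "1 / real (Suc n) \<le> r - c" using cd by linarith+
      have "ramp (1 / real (Suc n)) y = 1 / real (Suc n)" if "1 / real (Suc n) \<le> y" for y
        using that order_trans[OF _ that, of 0] by (simp add: ramp_def)
      then show ?thesis
        unfolding q_def using * by (simp only: diff_self mult_zero_right)
    qed
    have r0: "0 \<le> real (Suc n) * ramp (1 / real (Suc n)) y" "real (Suc n) * ramp (1 / real (Suc n)) y \<le> 1" for n y
    proof -
      have "0 \<le> ramp (1 / real (Suc n)) y" "ramp (1 / real (Suc n)) y \<le> 1 / real (Suc n)"
        by (auto simp: ramp_def)
      then show "0 \<le> real (Suc n) * ramp (1 / real (Suc n)) y" "real (Suc n) * ramp (1 / real (Suc n)) y \<le> 1"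
        using mult_left_mono[of "ramp (1 / real (Suc n)) y" "1 / real (Suc n)" "real (Suc n)"] by auto
    qed
    have q_b: "\<bar>q n r\<bar> \<le> 1" for n r
      unfolding q_def right_diff_distrib using r0[of n "r - c"] r0[of n "r - d"] by linarith
    have ramp_lim: "(\<lambda>n. real (Suc n) * ramp (1 / real (Suc n)) y) \<longlonglongrightarrow> (if y > 0 then 1 else 0)" for y
    proof (cases "y > 0")
      case True
      then have "\<forall>\<^sub>F n in sequentially. 1 / real (Suc n) < y" by real_asymp
      then have "\<forall>\<^sub>F n in sequentially. real (Suc n) * ramp (1 / real (Suc n)) y = 1"
        by eventually_elim (use True in \<open>simp add: ramp_def del: of_nat_Suc\<close>)
      then show ?thesis using True by (simp add: tendsto_eventually)
    next
      case False
      then have "ramp (1 / real (Suc n)) y = 0" for n by (simp add: ramp_def max_def min_def)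
      then show ?thesis using False by simp
    qed
    let ?J = "\<lambda>r. (if r - c > 0 then 1 else 0) - (if r - d > 0 then 1 else 0)"
    have q_lim: "(\<lambda>n. v r * q n r) \<longlonglongrightarrow> v r * ?J r" for r
      unfolding q_def right_diff_distrib[of "real _"] by (intro tendsto_intros ramp_lim)
    have "q n \<in> borel_measurable lebpos" for n
      by (rule continuous_imp_measurable_on_sets_lebesgue)
        (auto simp: q_def ramp_def intro!: continuous_intros)
    then have vq_m: "(\<lambda>r. v r * q n r) \<in> borel_measurable lebpos" for n
      by (rule borel_measurable_times[OF loc_integrable_measurable[OF loc(2)]])
    have lim_m: "(\<lambda>r. v r * ?J r)
        \<in> borel_measurable lebpos"
      by (rule borel_measurable_LIMSEQ_metric[OF vq_m]) (rule q_lim)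
    have lim: "(\<lambda>n. LINT r|lebpos. v r * q n r) \<longlonglongrightarrow> 
        (LINT r|lebpos. v r * ?J r)"
    proof (rule integral_dominated_convergence[where w = "\<lambda>r. \<bar>indicator {c..d + 1} r * v r\<bar>"])
      show "AE r in lebpos. norm (v r * q n r) \<le> \<bar>indicator {c..d + 1} r * v r\<bar>" for n
      proof (rule AE_I2)
        fix r
        have "norm (v r * q n r) \<le> 1 * \<bar>indicator {c..d + 1} r * v r\<bar>"
          by (intro abs_mult_le_indicator q_out q_b)
        then show "norm (v r * q n r) \<le> \<bar>indicator {c..d + 1} r * v r\<bar>" by simp
      qed
      show "AE r in lebpos. (\<lambda>n. v r * q n r) \<longlonglongrightarrow>
          v r * ?J r"
        by (rule AE_I2) (rule q_lim)
      show "(\<lambda>r. v r * q n r) \<in> borel_measurable lebpos" for n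
        by (rule vq_m)
      show "(\<lambda>r. v r * ?J r)
          \<in> borel_measurable lebpos"
        by (rule lim_m)
      show "integrable lebpos (\<lambda>r. \<bar>indicator {c..d + 1} r * v r\<bar>)"
        by (intro integrable_abs loc_integrable_lebpos loc(2) cd(1))
    qed
    have "(LINT r|lebpos. v r * ?J r)
        = (LINT r|lebpos. indicator {c..d} r * v r)"
    proof (rule integral_cong_AE)
      show "AE r in lebpos. v r * ?J r = indicator {c..d} r * v r"
        unfolding AE_lebpos_iff_negligible by (rule exI[of _ "{c}"]) (use cd in \<open>auto simp: indicator_def\<close>)
      show "(\<lambda>r. indicator {c..d} r * v r) \<in> borel_measurable lebpos"
        using loc_integrable_lebpos[OF loc(2) cd(1)] by auto
      show "(\<lambda>r. v r * ?J r) \<in> borel_measurable lebpos"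
        by (rule lim_m)
    qed
    then have lim': "(\<lambda>n. - (LINT r|lebpos. v r * q n r)) \<longlonglongrightarrow> - integral {c..d} v"
      using tendsto_minus[OF lim] LINT_lebpos_interval[OF loc(2) cd(1), of d] by simp
    have "- (LINT r|lebpos. v r * q n r) = real (Suc n) * integral {c..c + 1 / real (Suc n)} u
         - real (Suc n) * integral {d..d + 1 / real (Suc n)} u" for n
    proof -
      have "(LINT r|lebpos. v r * q n r) = (LINT r|lebpos. real (Suc n) * (v r * (ramp (1 / real (Suc n)) (r - c) - ramp (1 / real (Suc n)) (r - d))))"
        unfolding q_def by (simp only: mult.left_commute)
      also have "\<dots> = real (Suc n) * (LINT r|lebpos. v r * (ramp (1 / real (Suc n)) (r - c) - ramp (1 / real (Suc n)) (r - d)))"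
        by (rule integral_mult_right_zero)
      also have "- \<dots> = real (Suc n) * (integral {c..c + 1 / real (Suc n)} u - integral {d..d + 1 / real (Suc n)} u)"
        using has_weak_deriv_trapezoid[OF uv cd(1,2), of "1 / real (Suc n)"] by (simp del: of_nat_Suc)
      finally show ?thesis by (simp only: right_diff_distrib)
    qed
    then have "(\<lambda>n. - (LINT r|lebpos. v r * q n r)) \<longlonglongrightarrow> u c - u d"
      using tendsto_diff[OF N(2)[of c] N(2)[of d]] cd by simp
    from LIMSEQ_unique[OF lim' this] show ?thesis by linarith
  qed
  \<comment> \<open>The anchor of the primitive must be a Lebesgue point; a null set cannot contain
    (1, 2).\<close>
  obtain e where e: "e > 0" "e \<notin> N"
  proof -
    have "\<not> {1<..<2} \<subseteq> N"
      using negligible_subset[OF N(1)] open_not_negligible[of "{1<..<2::real}"] by auto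
    then obtain e where "e \<in> {1<..<2}" "e \<notin> N" by blast
    then show ?thesis by (intro that[of e]) simp_all
  qed
  \<comment> \<open>Two branches, because \<open>integral {e..r} v\<close> is 0 for r < e instead of
    changing sign.\<close>
  define w where "w = (\<lambda>r. if e \<le> r then u e + integral {e..r} v else u e - integral {r..e} v)"
  have "w d - w c = integral {c..d} v" if "0 < c" "c \<le> d" for c d
  proof -
    consider "e \<le> c" | "c < e" "e \<le> d" | "d < e" by linarith
    then show ?thesis
    proof cases
      case 1
      then show ?thesis
        using Henstock_Kurzweil_Integration.integral_combine[of e c d v, OF _ _ vint] e(1) that
        by (simp add: w_def)
    next
      case 2
      then show ?thesis
        using Henstock_Kurzweil_Integration.integral_combine[of c e d v, OF _ _ vint] e(1) that
        by (simp add: w_def)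
    next
      case 3
      then show ?thesis
        using Henstock_Kurzweil_Integration.integral_combine[of c d e v, OF _ _ vint] e(1) that
        by (simp add: w_def)
    qed
  qed
  then have "is_primitive w v" using loc(2) unfolding is_primitive_def by blast
  moreover have "u r = w r" if "r > 0" "r \<notin> N" for r
    using diff[of r e] diff[of e r] e that by (cases "r = e") (auto simp: w_def)
  then have "AE r in lebpos. u r = w r"
    unfolding AE_lebpos_iff_negligible using N(1) by blast
  ultimately show ?thesis using that by blast
qed

text \<open>Increments of w fix the averages over short intervals to the right of c, and these
  determine both densities at their common Lebesgue points.\<close>

lemma is_primitive_unique:
  assumes "is_primitive w v1" "is_primitive w v2"
  shows "AE r in lebpos. v1 r = v2 r"
proof -
  have loc: "loc_integrable v1" "loc_integrable v2"
    using assms unfolding is_primitive_def by auto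
  have "integral {c..d} v1 = integral {c..d} v2" if "0 < c" "c \<le> d" for c d
    using assms that unfolding is_primitive_def by metis
  then have eq: "integral {c..c + 1 / real (Suc n)} v1 = integral {c..c + 1 / real (Suc n)} v2" if "0 < c" for c n
    using that by simp
  show ?thesis
    using loc_integrable_lebesgue_point[OF loc(1)] loc_integrable_lebesgue_point[OF loc(2)] AE_space
    by eventually_elim (use eq LIMSEQ_unique in \<open>fastforce simp del: of_nat_Suc\<close>)
qed

text \<open>The primitives of both weak derivatives agree with u almost everywhere, hence with each
  other everywhere by continuity. So both weak derivatives are densities of a single
  primitive.\<close>

lemma has_weak_deriv_unique:
  assumes "has_weak_deriv u v1" "has_weak_deriv u v2"
  shows "AE r in lebpos. v1 r = v2 r"
proof -
  obtain w1 where w1: "is_primitive w1 v1" "AE r in lebpos. u r = w1 r"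
    using has_weak_deriv_imp_primitive[OF assms(1)] .
  obtain w2 where w2: "is_primitive w2 v2" "AE r in lebpos. u r = w2 r"
    using has_weak_deriv_imp_primitive[OF assms(2)] .
  have "AE r in lebpos. w1 r = w2 r"
    using w1(2) w2(2) by eventually_elim simp
  then have "w1 r = w2 r" if "r > 0" for r
    using continuous_AE_eq_imp_eq that w1(1) w2(1) is_primitive_continuous by blast
  then have "is_primitive w1 v2"
    using w2(1) unfolding is_primitive_def by simp
  then show ?thesis using is_primitive_unique[OF w1(1)] by blast
qed

text \<open>This makes the choice in \<open>weak_deriv\<close> harmless: any explicit weak
  derivative may stand in for it under an integral.\<close>

lemma weak_deriv_AE_eq:
  assumes "has_weak_deriv u v"
  shows "AE r in lebpos. weak_deriv u r = v r" "has_weak_deriv u (weak_deriv u)"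
proof -
  show "has_weak_deriv u (weak_deriv u)"
    unfolding weak_deriv_def by (rule someI[of "has_weak_deriv u", OF assms])
  then show "AE r in lebpos. weak_deriv u r = v r"
    using has_weak_deriv_unique assms by blast
qed

section \<open>The scale-invariant exponential inequality\<close>

lemma loc_integrable_continuous:
  "continuous_on {0<..} u \<Longrightarrow> loc_integrable u"
  unfolding loc_integrable_def
  by (auto intro!: absolutely_integrable_continuous_real elim: continuous_on_subset)

lemma has_integral_inverse_ln:
  fixes x y :: real
  assumes "0 < x" "x \<le> y"
  shows "((\<lambda>r. 1 / r) has_integral ln (y / x)) {x..y}"
proof -
  have "((\<lambda>r. 1 / r) has_integral ln y - ln x) {x..y}"
    by (rule fundamental_theorem_of_calculus[OF assms(2)])
      (use assms in \<open>auto intro!: derivative_eq_intros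
        simp: has_real_derivative_iff_has_vector_derivative[symmetric]\<close>)
  then show ?thesis using assms by (simp add: ln_div)
qed

text \<open>The exponent \<open>p - 1\<close> is the borderline weight for which \<open>|u'|\<^sup>p\<close> controls the
  increments of \<open>u\<close> on the logarithmic scale; Young's inequality replaces Hoelder's.\<close>

lemma increment_log_bound:
  assumes p: "1 < p" and M: "0 < M" and prim: "is_primitive w v"
    and int: "integrable lebpos (wpow p (p - 1) v)"
    and le: "(wint p (p - 1) v) \<le> M powr p"
    and xy: "0 < x" "x \<le> y"
  shows "\<bar>w y - w x\<bar> \<le> M * ln (y / x) powr (1 - 1 / p)"
proof (cases "x = y")
  case True
  then show ?thesis using xy by simp
next
  case False
  define q where "q = p / (p - 1)"
  define L where "L = ln (y / x)"
  \<comment> \<open>The value that balances Young's inequality: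
    \<open>\<delta> powr p * M powr p\<close> and \<open>\<delta> powr (- q) * L\<close> both become
    \<open>M * L powr (1 / q)\<close>.\<close>
  define \<delta> where "\<delta> = M powr (- 1 / q) * L powr (1 / (p * q))"
  have q: "q > 1" "1 / p + 1 / q = 1" using p by (auto simp: q_def field_simps)
  have invq: "1 / q = 1 - 1 / p" using q by simp
  have L: "L > 0" using False xy by (simp add: L_def)
  have \<delta>: "\<delta> > 0" using L M by (simp add: \<delta>_def)
  have loc: "loc_integrable v" using prim by (simp add: is_primitive_def)
  have loc1: "loc_integrable (\<lambda>r. 1 / r)"
    by (rule loc_integrable_continuous) (auto intro!: continuous_intros)
  have pw: "\<bar>v r\<bar> \<le> \<delta> powr p / p * (\<bar>v r\<bar> powr p * r powr (p - 1)) + \<delta> powr (- q) / q * (1 / r)"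
    if "r > 0" for r
  proof -
    \<comment> \<open>The factor r^(1/q) is moved so that the p-th power receives the weight r^(p-1)
      and the q-th power the density 1 / r of logarithmic length.\<close>
    have "\<bar>v r\<bar> = (\<delta> * \<bar>v r\<bar> * r powr (1 / q)) * (r powr (- 1 / q) / \<delta>)"
      using that \<delta> by (simp add: powr_minus field_simps)
    also have "\<dots> \<le> (\<delta> * \<bar>v r\<bar> * r powr (1 / q)) powr p / p + (r powr (- 1 / q) / \<delta>) powr q / q"
      using p q \<delta> that by (intro Youngs_inequality) auto
    also have "(\<delta> * \<bar>v r\<bar> * r powr (1 / q)) powr p = \<delta> powr p * (\<bar>v r\<bar> powr p * r powr (p - 1))"
    proof -
      have "(1 / q) * p = p - 1" using p by (simp add: q_def)
      then show ?thesis using \<delta> that by (simp add: powr_mult powr_powr mult.assoc)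
    qed
    also have "(r powr (- 1 / q) / \<delta>) powr q = \<delta> powr (- q) * (1 / r)"
      using \<delta> that q by (simp add: powr_divide powr_powr powr_minus powr_mult field_simps)
    finally show ?thesis by (simp add: field_simps)
  qed
  have iv: "integrable lebpos (\<lambda>r. indicator {x..y} r * v r)"
    by (rule loc_integrable_lebpos[OF loc xy(1)])
  have i1: "integrable lebpos (\<lambda>r. indicator {x..y} r * (1 / r))"
    by (rule loc_integrable_lebpos[OF loc1 xy(1)])
  have I1: "(LINT r|lebpos. indicator {x..y} r * (1 / r)) = L"
    unfolding LINT_lebpos_interval[OF loc1 xy(1)] L_def
    by (rule integral_unique[OF has_integral_inverse_ln[OF xy]])
  have "w y - w x = (LINT r|lebpos. indicator {x..y} r * v r)"
    using prim xy LINT_lebpos_interval[OF loc xy(1)] by (simp add: is_primitive_def)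
  then have "\<bar>w y - w x\<bar> \<le> (LINT r|lebpos. \<bar>indicator {x..y} r * v r\<bar>)"
    using integral_abs_bound by metis
  also have "\<dots> \<le> (LINT r|lebpos. \<delta> powr p / p * (\<bar>v r\<bar> powr p * r powr (p - 1))
      + \<delta> powr (- q) / q * (indicator {x..y} r * (1 / r)))"
  proof (rule integral_mono)
    show "integrable lebpos (\<lambda>r. \<bar>indicator {x..y} r * v r\<bar>)"
      using iv by (rule integrable_abs)
    show "integrable lebpos (\<lambda>r. \<delta> powr p / p * (\<bar>v r\<bar> powr p * r powr (p - 1))
      + \<delta> powr (- q) / q * (indicator {x..y} r * (1 / r)))"
      using int i1 by (intro Bochner_Integration.integrable_add integrable_mult_right)
    fix r assume "r \<in> space lebpos"
    then show "\<bar>indicator {x..y} r * v r\<bar> \<le> \<delta> powr p / p * (\<bar>v r\<bar> powr p * r powr (p - 1))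
      + \<delta> powr (- q) / q * (indicator {x..y} r * (1 / r))"
      using pw[of r] p \<delta> by (cases "r \<in> {x..y}") auto
  qed
  also have "\<dots> = \<delta> powr p / p * (wint p (p - 1) v) + \<delta> powr (- q) / q * L"
    by (simp only: Bochner_Integration.integral_add[OF integrable_mult_right[OF int] integrable_mult_right[OF i1]]
        integral_mult_right_zero I1)
  also have "\<dots> \<le> \<delta> powr p / p * M powr p + \<delta> powr (- q) / q * L"
    using le p by (intro add_right_mono mult_left_mono) auto
  also have "\<delta> powr p * M powr p = M * L powr (1 / q)"
  proof -
    have "- 1 / q * p + p = 1" using p by (simp add: invq field_simps q_def)
    then have "M powr (- 1 / q * p) * M powr p = M" using M by (simp add: powr_add[symmetric])
    then show ?thesis
      using M L p by (simp add: \<delta>_def powr_mult powr_powr mult.commute mult.left_commute)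
  qed
  then have "\<delta> powr p / p * M powr p = M * L powr (1 / q) / p" by (simp add: field_simps)
  also have "\<delta> powr (- q) * L = M * L powr (1 / q)"
  proof -
    have "\<delta> powr (- q) = M * L powr (- 1 / p)"
      using M L p q by (simp add: \<delta>_def powr_mult powr_powr)
    moreover have "L powr (- 1 / p) * L = L powr (1 / q)"
      using L by (simp add: invq powr_diff powr_minus field_simps)
    ultimately show ?thesis by simp
  qed
  then have "\<delta> powr (- q) / q * L = M * L powr (1 / q) / q" by (simp add: field_simps)
  also have "M * L powr (1 / q) / p + M * L powr (1 / q) / q = M * L powr (1 / q) * (1 / p + 1 / q)"
    by (simp add: distrib_left)
  finally show ?thesis using q by (simp add: L_def invq)
qed

text \<open>Raise y \<le> exp y at y = c x / p to the power p.\<close>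

lemma powr_le_exp:
  fixes x c p :: real
  assumes "0 \<le> x" "0 < c" "0 < p"
  shows "x powr p \<le> (p / c) powr p * exp (c * x)"
proof (cases "x = 0")
  case False
  have "x powr p = (p / c) powr p * (c * x / p) powr p"
    using assms False by (simp add: powr_mult[symmetric])
  also have "(c * x / p) powr p \<le> exp (c * x / p) powr p"
  proof (rule powr_mono2)
    show "c * x / p \<le> exp (c * x / p)"
      using exp_ge_add_one_self[of "c * x / p"] by linarith
  qed (use assms in auto)
  also have "exp (c * x / p) powr p = exp (c * x)"
    using assms by (simp add: powr_def)
  finally show ?thesis by (simp add: mult_left_mono)
qed simp

lemma first_crossing:
  fixes w :: "real \<Rightarrow> real"
  assumes cont: "continuous_on {0<..} w" and x: "0 < x" "M < \<bar>w x\<bar>"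
    and ex: "\<exists>y\<ge>x. \<bar>w y\<bar> \<le> M"
  obtains e where "x < e" "\<bar>w e\<bar> \<le> M" "\<And>y. x \<le> y \<Longrightarrow> y < e \<Longrightarrow> M < \<bar>w y\<bar>"
proof -
  define S where "S = {y \<in> {x..}. \<bar>w y\<bar> \<in> {..M}}"
  have "continuous_on {x..} (\<lambda>y. \<bar>w y\<bar>)"
    using x(1) by (intro continuous_intros continuous_on_subset[OF cont]) auto
  then have "closed S"
    using continuous_closed_preimage[of "{x..}" "\<lambda>y. \<bar>w y\<bar>" "{..M}"]
    by (simp add: S_def vimage_def Int_def)
  moreover have "S \<noteq> {}" "bdd_below S"
    using ex by (auto simp: S_def bdd_below_def)
  ultimately have "Inf S \<in> S" by (simp add: closed_contains_Inf)
  then have e: "x \<le> Inf S" "\<bar>w (Inf S)\<bar> \<le> M" by (auto simp: S_def)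
  have "x < Inf S"
    using e x(2) by (cases "x = Inf S") auto
  moreover have "M < \<bar>w y\<bar>" if "x \<le> y" "y < Inf S" for y
  proof (rule ccontr)
    assume "\<not> M < \<bar>w y\<bar>"
    then have "y \<in> S" using that by (simp add: S_def)
    then have "Inf S \<le> y" using \<open>bdd_below S\<close> by (rule cInf_lower)
    then show False using that by simp
  qed
  ultimately show ?thesis using that e by blast
qed

text \<open>For a > -1 the weight r^a has infinite mass near infinity, so a lower bound |w| > M on
  all of [x, \<infinity>) would make the norm infinite. This supplies the crossing point in the
  averaging argument.\<close>

lemma weighted_Lp_not_bounded_below:
  assumes p: "0 < p" and a: "-1 < a" and M: "0 < M" and x: "0 < x"
    and int: "integrable lebpos (wpow p a w)"
  shows "\<exists>y\<ge>x. \<bar>w y\<bar> \<le> M"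
proof (rule ccontr)
  assume "\<not> (\<exists>y\<ge>x. \<bar>w y\<bar> \<le> M)"
  then have big: "M < \<bar>w y\<bar>" if "x \<le> y" for y using that by force
  define B where "B = (wint p a w)"
  have "B \<ge> 0" unfolding B_def by (rule integral_nonneg_AE) auto
  define k where "k = a + 1"
  have k: "k > 0" using a by (simp add: k_def)
  \<comment> \<open>Chosen so that \<open>M powr p\<close> times the weighted mass of [x, R] is B +
    M^p / k, just above B.\<close>
  define R where "R = (x powr k + k * B / M powr p + 1) powr (1 / k)"
  have loc: "loc_integrable (\<lambda>r. r powr a)"
    by (rule loc_integrable_continuous) (auto intro!: continuous_intros)
  have Rk: "R powr k = x powr k + k * B / M powr p + 1"
    using k \<open>B \<ge> 0\<close> M by (simp add: R_def powr_powr)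
  then have "x powr k \<le> R powr k" using k \<open>B \<ge> 0\<close> M by simp
  then have xR: "x \<le> R"
    using powr_less_mono2[of k R x] k x by (force simp: R_def not_le)
  have "((\<lambda>r. r powr a) has_integral (R powr k / k - x powr k / k)) {x..R}"
  proof (rule fundamental_theorem_of_calculus[OF xR])
    fix r assume "r \<in> {x..R}"
    then have "r > 0" using x by simp
    have "((\<lambda>r. r powr k / k) has_real_derivative r powr a) (at r)"
      using \<open>r > 0\<close> k by (auto intro!: derivative_eq_intros simp: k_def)
    then show "((\<lambda>r. r powr k / k) has_vector_derivative r powr a) (at r within {x..R})"
      by (simp add: has_real_derivative_iff_has_vector_derivative has_vector_derivative_at_within)
  qed
  then have I: "(LINT r|lebpos. indicator {x..R} r * r powr a) = (R powr k - x powr k) / k"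
    using LINT_lebpos_interval[OF loc x] by (simp add: integral_unique diff_divide_distrib)
  have "M powr p * ((R powr k - x powr k) / k) = (LINT r|lebpos. M powr p * (indicator {x..R} r * r powr a))"
    unfolding I[symmetric] by simp
  also have "\<dots> \<le> B"
    unfolding B_def
  proof (rule integral_mono)
    show "integrable lebpos (\<lambda>r. M powr p * (indicator {x..R} r * r powr a))"
      by (intro integrable_mult_right loc_integrable_lebpos loc x)
    show "M powr p * (indicator {x..R} r * r powr a) \<le> \<bar>w r\<bar> powr p * r powr a"
      for r
    proof (cases "r \<in> {x..R}")
      case True
      then have "M powr p \<le> \<bar>w r\<bar> powr p"
        using big[of r] M p by (intro powr_mono2) auto
      then show ?thesis using True by (simp add: mult_right_mono)
    qed simp
  qed (rule int)
  finally have "M powr p * ((k * B / M powr p + 1) / k) \<le> B" using Rk by simp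
  moreover have "M powr p * ((k * B / M powr p + 1) / k) = B + M powr p / k"
    using M k by (simp add: field_simps)
  ultimately have "M powr p / k \<le> 0" by simp
  moreover have "M powr p / k > 0" using M k by simp
  ultimately show False by simp
qed

section \<open>Integrals for the averaging argument\<close>

lemma nn_integral_lebpos:
  "(\<integral>\<^sup>+ r. f r \<partial>lebpos) = (\<integral>\<^sup>+ r. f r * indicator {0<..} r \<partial>lborel)"
  by (simp add: nn_integral_restrict_space nn_integral_completion)

lemma nn_integral_powr_from_0:
  assumes "-1 < a" "0 \<le> c"
  shows "(\<integral>\<^sup>+ x. (if 0 < x \<and> x < c then ennreal (x powr a) else 0) \<partial>lborel) = ennreal (c powr (a + 1) / (a + 1))"
proof -
  define f where "f = (\<lambda>x::real. if x \<in> {0<..<c} then x powr a else 0)"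
  have "((\<lambda>x. x powr a) has_integral (c powr (a + 1) / (a + 1))) {0<..<c}"
    using has_integral_powr_from_0[OF assms] by (simp add: has_integral_Icc_iff_Ioo)
  then have "(f has_integral (c powr (a + 1) / (a + 1))) UNIV"
    unfolding f_def by (subst has_integral_restrict_UNIV)
  then have "integral\<^sup>N lborel f = c powr (a + 1) / (a + 1)"
    by (intro nn_integral_has_integral_lborel) (auto simp: f_def)
  moreover have "ennreal (f x) = (if 0 < x \<and> x < c then ennreal (x powr a) else 0)" for x
    by (simp add: f_def)
  ultimately show ?thesis by simp
qed

text \<open>Here e is a variable point and \<open>exp 1\<close> is Euler's number. The interval has
  length one for dr / r, so averaging over it costs no constant.\<close>

lemma nn_integral_inverse_log_unit:
  assumes "0 < e"
  shows "(\<integral>\<^sup>+ y. (if e / exp 1 < y \<and> y < e then ennreal (1 / y) else 0) \<partial>lborel) = 1"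
proof -
  define f where "f = (\<lambda>x::real. if x \<in> {e / exp 1<..<e} then 1 / x else 0)"
  have pos: "0 < e / exp 1" using assms by simp
  have "e / exp 1 \<le> e" using assms by (simp add: divide_le_eq)
  from has_integral_inverse_ln[OF pos this] have "((\<lambda>x. 1 / x) has_integral 1) {e / exp 1<..<e}"
    using assms by (simp add: has_integral_Icc_iff_Ioo)
  then have "(f has_integral 1) UNIV"
    unfolding f_def by (subst has_integral_restrict_UNIV)
  then have "integral\<^sup>N lborel f = ennreal 1"
    using pos by (intro nn_integral_has_integral_lborel) (auto simp: f_def)
  moreover have "ennreal (f x) = (if e / exp 1 < x \<and> x < e then ennreal (1 / x) else 0)" for x
    by (simp add: f_def)
  ultimately show ?thesis by simp
qed

text \<open>With q = p / (p - 1) one has p q = p + q, so for t = \<mu> |s|^q this is t^p exp t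
  divided by \<mu>^p. It controls the terms j \<ge> 1 of \<open>exp_p p t\<close>, that is,
  everything beyond the p-th power of |s|.\<close>

definition exp_growth :: "real \<Rightarrow> real \<Rightarrow> real \<Rightarrow> real" where
  "exp_growth p \<mu> s = \<bar>s\<bar> powr (p + p / (p - 1)) * exp (\<mu> * \<bar>s\<bar> powr (p / (p - 1)))"

lemma exp_growth_mono:
  assumes "1 < p" "0 \<le> \<mu>" "\<bar>s\<bar> \<le> \<bar>t\<bar>"
  shows "exp_growth p \<mu> s \<le> exp_growth p \<mu> t"
  unfolding exp_growth_def using assms
  by (intro mult_mono powr_mono2) (auto intro!: mult_left_mono powr_mono2)

text \<open>One factor |s|^q pays for the gain M^q; the remaining |s|^p is left for integration, and
  the exponential is bounded since |s| is.\<close>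

lemma exp_growth_small:
  assumes p: "1 < p" and "0 \<le> \<mu>" "\<bar>s\<bar> \<le> C * M" "0 < M" "M \<le> 1" "0 < C"
  shows "exp_growth p \<mu> s \<le> C powr (p / (p - 1)) * exp (\<mu> * C powr (p / (p - 1))) * M powr (p / (p - 1)) * \<bar>s\<bar> powr p"
proof -
  define q where "q = p / (p - 1)"
  have q: "q > 0" using p by (simp add: q_def)
  have "\<bar>s\<bar> powr q \<le> (C * M) powr q" using assms q by (intro powr_mono2) auto
  then have 1: "\<bar>s\<bar> powr q \<le> C powr q * M powr q" using assms by (simp add: powr_mult)
  moreover have "M powr q \<le> 1" using assms q by (simp add: powr_le1)
  ultimately have 2: "\<bar>s\<bar> powr q \<le> C powr q"
    using mult_left_mono[of "M powr q" 1 "C powr q"] by simp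
  have "exp_growth p \<mu> s = \<bar>s\<bar> powr p * (\<bar>s\<bar> powr q * exp (\<mu> * \<bar>s\<bar> powr q))"
    by (simp add: exp_growth_def q_def powr_add)
  also have "\<dots> \<le> \<bar>s\<bar> powr p * (C powr q * M powr q * exp (\<mu> * C powr q))"
    using 1 2 assms by (intro mult_left_mono mult_mono) (auto intro: mult_left_mono)
  finally show ?thesis by (simp add: q_def mult_ac)
qed

text \<open>Since |s| \<le> 2 M (1 + l)^(1/q), the parameter k / (4 * 2^q) keeps the exponent below
  (k / 4)(1 + l). A second factor exp((k / 4)(1 + l)) absorbs the power (1 + l)^p. With k = a + 1
  and l = ln (y / x) the total rate k / 2 still leaves the weight x^a integrable at 0.\<close>

lemma exp_growth_log_bound:
  assumes p: "1 < p" and k: "0 < k" and M: "0 < M" "M \<le> 1" and l: "0 \<le> l"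
    and s: "\<bar>s\<bar> \<le> M + M * (1 + l) powr (1 - 1 / p)"
  defines "q \<equiv> p / (p - 1)"
  shows "exp_growth p (k / (4 * 2 powr q)) s
    \<le> 2 powr (p + q) * (4 * p / k) powr p * exp (k / 2) * M powr q * M powr p * exp (k / 2 * l)"
proof -
  define t where "t = 2 * M * (1 + l) powr (1 / q)"
  have q: "q > 0" "1 / q = 1 - 1 / p" "(p + q) / q = p"
    using p by (simp_all add: q_def field_simps)
  have "1 \<le> (1 + l) powr (1 / q)" using l q(1) by (intro ge_one_powr_ge_zero) auto
  then have "M \<le> M * (1 + l) powr (1 / q)" using M by (simp add: mult_left_mono)
  moreover have "\<bar>t\<bar> = M * (1 + l) powr (1 / q) + M * (1 + l) powr (1 / q)"
    using M by (simp add: t_def)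
  ultimately have st: "\<bar>s\<bar> \<le> \<bar>t\<bar>" using s unfolding q(2) by linarith
  have tpow: "\<bar>t\<bar> powr (p + q) = 2 powr (p + q) * (M powr q * M powr p) * (1 + l) powr p"
  proof -
    have "((1 + l) powr (1 / q)) powr (p + q) = (1 + l) powr p"
      by (simp only: powr_powr times_divide_eq_left mult_1 q(3))
    moreover have "\<bar>t\<bar> powr (p + q) = 2 powr (p + q) * M powr (p + q) * ((1 + l) powr (1 / q)) powr (p + q)"
      using M by (simp add: t_def abs_mult powr_mult)
    ultimately show ?thesis by (simp add: powr_add mult_ac)
  qed
  have tq: "\<bar>t\<bar> powr q = 2 powr q * M powr q * (1 + l)"
    using M l q(1) by (simp add: t_def abs_mult powr_mult powr_powr)
  have Mq: "M powr q \<le> 1" using M q by (simp add: powr_le1)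
  have "k / (4 * 2 powr q) * \<bar>t\<bar> powr q = k / 4 * (1 + l) * M powr q"
    unfolding tq by simp
  also have "\<dots> \<le> k / 4 * (1 + l) * 1"
    using Mq k l by (intro mult_left_mono) auto
  finally have e: "exp (k / (4 * 2 powr q) * \<bar>t\<bar> powr q) \<le> exp (k / 4 * (1 + l))" by simp
  have "(1 + l) powr p \<le> (p / (k / 4)) powr p * exp (k / 4 * (1 + l))"
    using l k p by (intro powr_le_exp) auto
  then have pw: "(1 + l) powr p \<le> (4 * p / k) powr p * exp (k / 4 * (1 + l))"
    by (simp add: mult.commute)
  have "exp_growth p (k / (4 * 2 powr q)) s \<le> exp_growth p (k / (4 * 2 powr q)) t"
    using p k st by (intro exp_growth_mono) auto
  also have "\<dots> = 2 powr (p + q) * (M powr q * M powr p) * ((1 + l) powr p * exp (k / (4 * 2 powr q) * \<bar>t\<bar> powr q))"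
    unfolding exp_growth_def q_def[symmetric] tpow by simp
  also have "\<dots> \<le> 2 powr (p + q) * (M powr q * M powr p) *
      (((4 * p / k) powr p * exp (k / 4 * (1 + l))) * exp (k / 4 * (1 + l)))"
    using e pw by (intro mult_left_mono mult_mono) auto
  also have "\<dots> = 2 powr (p + q) * (4 * p / k) powr p * M powr q * M powr p * (exp (k / 4 * (1 + l)) * exp (k / 4 * (1 + l)))"
    by simp
  also have "exp (k / 4 * (1 + l)) * exp (k / 4 * (1 + l)) = exp (k / 2) * exp (k / 2 * l)"
    by (simp add: exp_add[symmetric] field_simps)
  finally show ?thesis by (simp add: mult_ac)
qed

text \<open>For k = a + 1 this is the product of the weight x^a, the growth exp((k / 2) ln (y / x)),
  the averaging density 1 / y and |w y|^p. Integrating out x in (0, y) returns the density |w y|^p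
  y^a of the norm with the factor 2 / k.\<close>

abbreviation log_kernel :: "real \<Rightarrow> real \<Rightarrow> (real \<Rightarrow> real) \<Rightarrow> real \<Rightarrow> real \<Rightarrow> ennreal" where
  "log_kernel p k w x y \<equiv>
    if 0 < x \<and> x < y then ennreal (\<bar>w y\<bar> powr p * y powr (k / 2 - 1) * x powr (k / 2 - 1)) else 0"

text \<open>Where \<open>|w| > 2M\<close>, let \<open>e\<close> be the first later point with \<open>|w| \<le> M\<close>. The increment bound
  forces \<open>ln (e/x) > 1\<close>, so \<open>|w| \<ge> M\<close> on the interval of logarithmic length one that ends in \<open>e\<close>;
  averaging over this interval turns the pointwise bound into an integral one.\<close>

lemma exp_growth_kernel_bound:
  assumes p: "1 < p" and a: "-1 < a" and M: "0 < M" "M \<le> 1"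
    and w[measurable]: "w \<in> borel_measurable borel" and cont: "continuous_on {0<..} w"
    and incr: "\<And>x y. 0 < x \<Longrightarrow> x \<le> y \<Longrightarrow> \<bar>w y - w x\<bar> \<le> M * ln (y / x) powr (1 - 1 / p)"
    and ex: "\<exists>y\<ge>x. \<bar>w y\<bar> \<le> M" and x: "0 < x" "2 * M < \<bar>w x\<bar>"
  defines "q \<equiv> p / (p - 1)" and "k \<equiv> a + 1"
  shows "ennreal (exp_growth p (k / (4 * 2 powr q)) (w x) * x powr a)
    \<le> ennreal (2 powr (p + q) * (4 * p / k) powr p * exp (k / 2) * M powr q) *
      (\<integral>\<^sup>+ y. log_kernel p k w x y \<partial>lborel)"
proof -
  define C where "C = 2 powr (p + q) * (4 * p / k) powr p * exp (k / 2) * M powr q"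
  define E where "E = exp_growth p (k / (4 * 2 powr q)) (w x)"
  have k: "k > 0" using a by (simp add: k_def)
  have C: "C \<ge> 0" by (simp add: C_def)
  have E: "E \<ge> 0" by (simp add: E_def exp_growth_def)
  obtain e where e: "x < e" "\<bar>w e\<bar> \<le> M" "\<And>y. x \<le> y \<Longrightarrow> y < e \<Longrightarrow> M < \<bar>w y\<bar>"
    by (rule first_crossing[OF cont x(1) _ ex]) (use x M in auto)
  have inc: "\<bar>w x\<bar> \<le> M + M * ln (e / x) powr (1 - 1 / p)"
    using incr[OF x(1) less_imp_le[OF e(1)]] e(2) by linarith
  have ln1: "ln (e / x) > 1"
  proof (rule ccontr)
    assume "\<not> ln (e / x) > 1"
    then have "ln (e / x) powr (1 - 1 / p) \<le> 1"
      using p e(1) x(1) by (intro powr_le1) auto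
    then have "M * ln (e / x) powr (1 - 1 / p) \<le> M" using M by (simp add: mult_left_le)
    then show False using inc x(2) by linarith
  qed
  have "exp 1 < exp (ln (e / x))" using ln1 by (simp only: exp_less_cancel_iff)
  then have "exp 1 < e / x" using e(1) x(1) by simp
  then have ex1: "x < e / exp 1" using x(1) by (simp add: field_simps)
  have main: "E * x powr a * (1 / y) \<le> C * (\<bar>w y\<bar> powr p * y powr (k / 2 - 1) * x powr (k / 2 - 1))"
    if y: "e / exp 1 < y" "y < e" for y
  proof -
    have xy: "x < y" using y ex1 by simp
    define l where "l = ln (y / x)"
    have l: "l \<ge> 0" using xy x(1) by (simp add: l_def)
    \<comment> \<open>Every y within logarithmic distance 1 below e may replace e, at the cost of
      the summand 1.\<close>
    have "ln (e / x) \<le> ln (exp 1 * (y / x))"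
      using y e(1) x(1) xy by (intro ln_mono) (auto simp: field_simps)
    also have "\<dots> = ln (exp 1) + ln (y / x)" using xy x(1) by (intro ln_mult_pos) auto
    also have "\<dots> = 1 + l" by (simp add: l_def)
    finally have "ln (e / x) powr (1 - 1 / p) \<le> (1 + l) powr (1 - 1 / p)"
      using ln1 p by (intro powr_mono2) auto
    then have "M * ln (e / x) powr (1 - 1 / p) \<le> M * (1 + l) powr (1 - 1 / p)"
      using M by (intro mult_left_mono) auto
    then have "\<bar>w x\<bar> \<le> M + M * (1 + l) powr (1 - 1 / p)" using inc by linarith
    then have "E \<le> C * M powr p * exp (k / 2 * l)"
      unfolding E_def C_def q_def by (rule exp_growth_log_bound[OF p k M l])
    also have "\<dots> \<le> C * \<bar>w y\<bar> powr p * exp (k / 2 * l)"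
      using e(3)[of y] xy y M p C by (intro mult_right_mono mult_left_mono powr_mono2) auto
    also have "exp (k / 2 * l) = y powr (k / 2) * x powr (- (k / 2))"
    proof -
      have "k / 2 * l = k / 2 * ln y + - (k / 2) * ln x"
        using xy x(1) by (simp add: l_def ln_div right_diff_distrib)
      then have "exp (k / 2 * l) = exp (k / 2 * ln y) * exp (- (k / 2) * ln x)"
        by (simp only: exp_add)
      then show ?thesis using xy x(1) by (simp add: powr_def)
    qed
    finally have "E * (x powr a * (1 / y)) \<le> C * \<bar>w y\<bar> powr p * (y powr (k / 2) * x powr (- (k / 2))) * (x powr a * (1 / y))"
      using xy x(1) by (intro mult_right_mono) auto
    also have "\<dots> = C * \<bar>w y\<bar> powr p * (y powr (k / 2) / y) * (x powr (- (k / 2)) * x powr a)"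
      by simp
    also have "y powr (k / 2) / y = y powr (k / 2 - 1)"
      using xy x(1) by (simp add: powr_diff)
    also have "x powr (- (k / 2)) * x powr a = x powr (k / 2 - 1)"
    proof -
      have "- (k / 2) + a = k / 2 - 1" by (simp add: k_def field_simps)
      then show ?thesis using powr_add[of x "- (k / 2)" a] by simp
    qed
    finally show ?thesis by (simp add: mult_ac)
  qed
  have e0: "e > 0" using e(1) x(1) by simp
  have "ennreal (E * x powr a) = ennreal (E * x powr a) *
      (\<integral>\<^sup>+ y. (if e / exp 1 < y \<and> y < e then ennreal (1 / y) else 0) \<partial>lborel)"
    using nn_integral_inverse_log_unit[OF e0] by simp
  also have "\<dots> = (\<integral>\<^sup>+ y. ennreal (E * x powr a) * (if e / exp 1 < y \<and> y < e then ennreal (1 / y) else 0) \<partial>lborel)"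
    by (rule nn_integral_cmult[symmetric]) measurable
  also have "\<dots> \<le> (\<integral>\<^sup>+ y. ennreal C * log_kernel p k w x y \<partial>lborel)"
  proof (rule nn_integral_mono)
    fix y :: real
    show "ennreal (E * x powr a) * (if e / exp 1 < y \<and> y < e then ennreal (1 / y) else 0)
      \<le> ennreal C * log_kernel p k w x y"
    proof (cases "e / exp 1 < y \<and> y < e")
      case True
      then have "x < y" using ex1 by simp
      have "ennreal (E * x powr a) * ennreal (1 / y) = ennreal (E * x powr a * (1 / y))"
        using E by (intro ennreal_mult'[symmetric]) auto
      also have "\<dots> \<le> ennreal (C * (\<bar>w y\<bar> powr p * y powr (k / 2 - 1) * x powr (k / 2 - 1)))"
        using main True by (intro ennreal_leI) auto
      also have "\<dots> = ennreal C * ennreal (\<bar>w y\<bar> powr p * y powr (k / 2 - 1) * x powr (k / 2 - 1))"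
        using C by (intro ennreal_mult') auto
      finally show ?thesis using True \<open>x < y\<close> x(1) by simp
    qed auto
  qed
  also have "\<dots> = ennreal C * (\<integral>\<^sup>+ y. log_kernel p k w x y \<partial>lborel)"
    by (rule nn_integral_cmult) measurable
  finally show ?thesis unfolding E_def C_def .
qed

lemma kernel_tonelli:
  assumes k: "0 < k" and w[measurable]: "w \<in> borel_measurable borel"
  shows "(\<integral>\<^sup>+ x. \<integral>\<^sup>+ y. log_kernel p k w x y \<partial>lborel \<partial>lborel)
    = ennreal (2 / k) * (\<integral>\<^sup>+ y. ennreal (\<bar>w y\<bar> powr p * y powr (k - 1)) \<partial>lebpos)"
proof -
  define f where "f = (\<lambda>x y. if 0 < x \<and> x < y then ennreal (\<bar>w y\<bar> powr p * y powr (k / 2 - 1) * x powr (k / 2 - 1)) else 0)"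
  have m: "case_prod f \<in> borel_measurable (lborel \<Otimes>\<^sub>M lborel)"
    unfolding f_def case_prod_beta by measurable
  have inner: "(\<integral>\<^sup>+ x. f x y \<partial>lborel) = ennreal (2 / k) * (ennreal (\<bar>w y\<bar> powr p * y powr (k - 1)) * indicator {0<..} y)" for y
  proof (cases "y > 0")
    case True
    have "(\<integral>\<^sup>+ x. f x y \<partial>lborel) = (\<integral>\<^sup>+ x. ennreal (\<bar>w y\<bar> powr p * y powr (k / 2 - 1)) * (if 0 < x \<and> x < y then ennreal (x powr (k / 2 - 1)) else 0) \<partial>lborel)"
      unfolding f_def by (rule nn_integral_cong) (auto simp: ennreal_mult'[symmetric])
    also have "\<dots> = ennreal (\<bar>w y\<bar> powr p * y powr (k / 2 - 1)) * (\<integral>\<^sup>+ x. (if 0 < x \<and> x < y then ennreal (x powr (k / 2 - 1)) else 0) \<partial>lborel)"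
      by (rule nn_integral_cmult) measurable
    also have "\<dots> = ennreal (\<bar>w y\<bar> powr p * y powr (k / 2 - 1)) * ennreal (y powr (k / 2) / (k / 2))"
      using nn_integral_powr_from_0[of "k / 2 - 1" y] k True by simp
    also have "\<dots> = ennreal (2 / k * (\<bar>w y\<bar> powr p * (y powr (k / 2 - 1) * y powr (k / 2))))"
      using k by (subst ennreal_mult'[symmetric]) (auto simp: mult_ac)
    also have "y powr (k / 2 - 1) * y powr (k / 2) = y powr (k - 1)"
      by (simp add: powr_add[symmetric])
    finally show ?thesis using True k by (simp add: ennreal_mult'[symmetric])
  next
    case False
    then have "(\<lambda>x. f x y) = (\<lambda>x. 0)" by (auto simp: f_def)
    then show ?thesis using False by simp
  qed
  have "(\<integral>\<^sup>+ x. \<integral>\<^sup>+ y. f x y \<partial>lborel \<partial>lborel) = (\<integral>\<^sup>+ y. \<integral>\<^sup>+ x. f x y \<partial>lborel \<partial>lborel)"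
    by (rule lborel_pair.Fubini'[OF m, symmetric])
  also have "\<dots> = ennreal (2 / k) * (\<integral>\<^sup>+ y. ennreal (\<bar>w y\<bar> powr p * y powr (k - 1)) * indicator {0<..} y \<partial>lborel)"
    unfolding inner by (rule nn_integral_cmult) measurable
  finally show ?thesis unfolding f_def nn_integral_lebpos .
qed

text \<open>Scale-invariant Trudinger--Moser inequality in the manner of Adachi and Tanaka.\<close>

theorem scale_exp_bound:
  assumes p: "1 < p" and a: "-1 < a"
  defines "q \<equiv> p / (p - 1)"
  obtains K \<mu>0 where "0 < K" "0 < \<mu>0"
    "\<And>w v M. is_primitive w v \<Longrightarrow> 0 < M \<Longrightarrow> M \<le> 1 \<Longrightarrow>
      integrable lebpos (wpow p (p - 1) v) \<Longrightarrow>
      (wint p (p - 1) v) \<le> M powr p \<Longrightarrow>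
      integrable lebpos (wpow p a w) \<Longrightarrow>
      integrable lebpos (\<lambda>r. exp_growth p \<mu>0 (w r) * r powr a) \<and>
      (LINT r|lebpos. exp_growth p \<mu>0 (w r) * r powr a) \<le> K * M powr q * (wint p a w)"
proof -
  define k where "k = a + 1"
  have k: "k > 0" using a by (simp add: k_def)
  have q: "q > 0" using p by (simp add: q_def)
  define \<mu>0 where "\<mu>0 = k / (4 * 2 powr q)"
  define c1 where "c1 = 2 powr q * exp (\<mu>0 * 2 powr q)"
  define C1 where "C1 = 2 powr (p + q) * (4 * p / k) powr p * exp (k / 2)"
  \<comment> \<open>\<open>c1\<close> accounts for the points with |w| \<le> 2 M,
    \<open>C1 * (2 / k)\<close> for the others after Tonelli.\<close>
  define K where "K = c1 + C1 * (2 / k)"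
  have pos: "\<mu>0 > 0" "c1 > 0" "C1 > 0" using k p by (auto simp: \<mu>0_def c1_def C1_def)
  then have "K > 0" using k by (simp add: K_def add_pos_pos)
  have main: "integrable lebpos (\<lambda>r. exp_growth p \<mu>0 (w r) * r powr a) \<and>
      (LINT r|lebpos. exp_growth p \<mu>0 (w r) * r powr a) \<le> K * M powr q * (wint p a w)"
    if prim0: "is_primitive w0 v" and M: "0 < M" "M \<le> 1"
      and iv: "integrable lebpos (wpow p (p - 1) v)"
      and le: "(wint p (p - 1) v) \<le> M powr p"
      and iw: "integrable lebpos (wpow p a w)"
      and w_def: "w = (\<lambda>r. if r > 0 then w0 r else 0)" for w0 w v M
  proof -
    have prim: "is_primitive w v" using prim0 by (simp add: is_primitive_def w_def)
    have cont: "continuous_on {0<..} w" by (rule is_primitive_continuous[OF prim])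
    have "(\<lambda>r. indicator {0<..} r *\<^sub>R w r) \<in> borel_measurable borel"
      by (rule borel_measurable_continuous_on_indicator[OF _ cont]) simp
    also have "(\<lambda>r. indicator {0<..} r *\<^sub>R w r) = w" by (auto simp: w_def)
    finally have w[measurable]: "w \<in> borel_measurable borel" .
    have wl: "w \<in> borel_measurable lebpos"
      by (rule continuous_imp_measurable_on_sets_lebesgue[OF cont]) simp
    define B where "B = (wint p a w)"
    have "B \<ge> 0" unfolding B_def by (rule integral_nonneg_AE) auto
    have B: "(\<integral>\<^sup>+ r. ennreal (\<bar>w r\<bar> powr p * r powr a) \<partial>lebpos) = ennreal B"
      unfolding B_def by (rule nn_integral_eq_integral[OF iw]) auto
    define f where "f = (\<lambda>x y. if 0 < x \<and> x < y then ennreal (\<bar>w y\<bar> powr p * y powr (k / 2 - 1) * x powr (k / 2 - 1)) else 0)"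
    have pw: "ennreal (exp_growth p \<mu>0 (w x) * x powr a)
        \<le> ennreal (c1 * M powr q) * ennreal (\<bar>w x\<bar> powr p * x powr a) + ennreal (C1 * M powr q) * (\<integral>\<^sup>+ y. f x y \<partial>lborel)"
      if "x > 0" for x
    proof (cases "\<bar>w x\<bar> \<le> 2 * M")
      case True
      have "exp_growth p \<mu>0 (w x) \<le> c1 * M powr q * \<bar>w x\<bar> powr p"
        using exp_growth_small[OF p _ True M, of \<mu>0] pos by (simp add: c1_def q_def)
      then have "exp_growth p \<mu>0 (w x) * x powr a \<le> c1 * M powr q * (\<bar>w x\<bar> powr p * x powr a)"
        by (simp add: mult_right_mono mult.assoc[symmetric])
      then have "ennreal (exp_growth p \<mu>0 (w x) * x powr a) \<le> ennreal (c1 * M powr q) * ennreal (\<bar>w x\<bar> powr p * x powr a)"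
        using pos by (subst ennreal_mult'[symmetric]) (auto intro!: ennreal_leI)
      then show ?thesis by (rule add_increasing2[OF zero_le])
    next
      case False
      have "ennreal (exp_growth p \<mu>0 (w x) * x powr a) \<le> ennreal (C1 * M powr q) * (\<integral>\<^sup>+ y. f x y \<partial>lborel)"
        unfolding \<mu>0_def C1_def f_def q_def k_def
      proof (rule exp_growth_kernel_bound[OF p a M w cont _ _ that])
        show "\<bar>w y - w x\<bar> \<le> M * ln (y / x) powr (1 - 1 / p)" if "0 < x" "x \<le> y" for x y
          by (rule increment_log_bound[OF p M(1) prim iv le that])
        show "\<exists>y\<ge>x. \<bar>w y\<bar> \<le> M"
          by (rule weighted_Lp_not_bounded_below[OF _ a M(1) that iw]) (use p in simp)
      qed (use False in simp)
      then show ?thesis by (rule add_increasing[OF zero_le])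
    qed
    have meas: "(wpow p a w) \<in> borel_measurable borel" by measurable
    have tonelli: "(\<integral>\<^sup>+ x. \<integral>\<^sup>+ y. f x y \<partial>lborel \<partial>lborel) = ennreal (2 / k * B)"
      using kernel_tonelli[OF k w, of p] B k by (simp add: f_def k_def ennreal_mult'[symmetric])
    have "(\<integral>\<^sup>+ x. ennreal (exp_growth p \<mu>0 (w x) * x powr a) \<partial>lebpos)
      \<le> (\<integral>\<^sup>+ x. ennreal (c1 * M powr q) * (ennreal (\<bar>w x\<bar> powr p * x powr a) * indicator {0<..} x)
          + ennreal (C1 * M powr q) * (\<integral>\<^sup>+ y. f x y \<partial>lborel) \<partial>lborel)"
      unfolding nn_integral_lebpos
    proof (rule nn_integral_mono)
      fix x :: real
      show "ennreal (exp_growth p \<mu>0 (w x) * x powr a) * indicator {0<..} x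
        \<le> ennreal (c1 * M powr q) * (ennreal (\<bar>w x\<bar> powr p * x powr a) * indicator {0<..} x)
          + ennreal (C1 * M powr q) * (\<integral>\<^sup>+ y. f x y \<partial>lborel)"
        using pw[of x] by (cases "x > 0") simp_all
    qed
    also have "\<dots> = ennreal (c1 * M powr q) * (\<integral>\<^sup>+ x. ennreal (\<bar>w x\<bar> powr p * x powr a) * indicator {0<..} x \<partial>lborel)
        + ennreal (C1 * M powr q) * (\<integral>\<^sup>+ x. \<integral>\<^sup>+ y. f x y \<partial>lborel \<partial>lborel)"
    proof -
      have m: "case_prod f \<in> borel_measurable (lborel \<Otimes>\<^sub>M lborel)"
        unfolding f_def case_prod_beta by measurable
      have m2: "(\<lambda>x. \<integral>\<^sup>+ y. f x y \<partial>lborel) \<in> borel_measurable lborel"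
        by (rule lborel.borel_measurable_nn_integral[OF m])
      have m1: "(\<lambda>x. ennreal (\<bar>w x\<bar> powr p * x powr a) * indicator {0<..} x) \<in> borel_measurable lborel"
        by measurable
      show ?thesis
        using m1 m2 by (simp add: nn_integral_add nn_integral_cmult)
    qed
    also have "\<dots> = ennreal (c1 * M powr q) * ennreal B + ennreal (C1 * M powr q) * ennreal (2 / k * B)"
      using B unfolding tonelli nn_integral_lebpos by simp
    also have "\<dots> = ennreal (c1 * M powr q * B) + ennreal (C1 * M powr q * (2 / k * B))"
      using pos by (simp only: ennreal_mult'[symmetric] mult_nonneg_nonneg less_imp_le powr_ge_zero)
    also have "\<dots> = ennreal (c1 * M powr q * B + C1 * M powr q * (2 / k * B))"
      using pos k \<open>B \<ge> 0\<close> by (intro ennreal_plus[symmetric]) (auto intro!: mult_nonneg_nonneg)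
    also have "c1 * M powr q * B + C1 * M powr q * (2 / k * B) = K * M powr q * B"
      by (simp add: K_def algebra_simps)
    finally have le: "(\<integral>\<^sup>+ x. ennreal (exp_growth p \<mu>0 (w x) * x powr a) \<partial>lebpos) \<le> ennreal (K * M powr q * B)" .
    have mE: "(\<lambda>r. exp_growth p \<mu>0 (w r) * r powr a) \<in> borel_measurable lebpos"
      unfolding exp_growth_def
      by (rule measurable_restrict_space1, rule measurable_completion) measurable
    have nonneg: "exp_growth p \<mu>0 (w r) * r powr a \<ge> 0" for r by (simp add: exp_growth_def)
    have int: "integrable lebpos (\<lambda>r. exp_growth p \<mu>0 (w r) * r powr a)"
      by (rule integrableI_bounded[OF mE]) (use le nonneg in \<open>simp add: order_le_less_trans[OF le]\<close>)
    have "ennreal (LINT r|lebpos. exp_growth p \<mu>0 (w r) * r powr a) \<le> ennreal (K * M powr q * B)"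
      using le nn_integral_eq_integral[OF int] nonneg by simp
    then have "(LINT r|lebpos. exp_growth p \<mu>0 (w r) * r powr a) \<le> K * M powr q * B"
      using \<open>K > 0\<close> \<open>B \<ge> 0\<close> by (subst (asm) ennreal_le_iff) auto
    then show ?thesis using int by (simp add: B_def)
  qed
  show ?thesis
  proof (rule that[OF \<open>K > 0\<close> pos(1)])
    fix w v M
    assume *: "is_primitive w v" "0 < M" "M \<le> 1"
      "integrable lebpos (wpow p (p - 1) v)"
      "(wint p (p - 1) v) \<le> M powr p"
      and iw: "integrable lebpos (wpow p a w)"
    \<comment> \<open>The values of w off (0, \<infinity>) are arbitrary. Cutting them to 0 gives a
      Borel function on the whole line, as Tonelli for \<open>lborel\<close> demands.\<close>
    define W where "W = (\<lambda>r. if r > 0 then w r else 0)"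
    have eq: "integrable lebpos (\<lambda>r. F (W r) r) = integrable lebpos (\<lambda>r. F (w r) r)"
      "(LINT r|lebpos. F (W r) r) = (LINT r|lebpos. F (w r) r)" for F :: "real \<Rightarrow> real \<Rightarrow> real"
      by (auto simp: W_def intro!: Bochner_Integration.integrable_cong Bochner_Integration.integral_cong)
    have "integrable lebpos (wpow p a W)"
      using iw eq(1)[of "\<lambda>s r. \<bar>s\<bar> powr p * r powr a"] by simp
    from main[OF * this W_def]
    show "integrable lebpos (\<lambda>r. exp_growth p \<mu>0 (w r) * r powr a) \<and>
      (LINT r|lebpos. exp_growth p \<mu>0 (w r) * r powr a) \<le> K * M powr q * (wint p a w)"
      using eq[of "\<lambda>s r. \<bar>s\<bar> powr p * r powr a"] eq[of "\<lambda>s r. exp_growth p \<mu>0 s * r powr a"] by simp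
  qed
qed

section \<open>The integrand and its derivative\<close>

text \<open>For b = p - 1 this is |x|^(p-2) x, written so that no negative exponent occurs when p <
  2.\<close>

definition signed_powr :: "real \<Rightarrow> real \<Rightarrow> real" where
  "signed_powr b x = sgn x * \<bar>x\<bar> powr b"

lemma abs_signed_powr: "\<bar>signed_powr b x\<bar> = \<bar>x\<bar> powr b"
  by (simp add: signed_powr_def abs_mult sgn_if)

lemma signed_powr_signed_powr: "signed_powr c (signed_powr b x) = signed_powr (b * c) x"
  by (auto simp: signed_powr_def sgn_if abs_mult powr_powr)

lemma signed_powr_1: "signed_powr 1 x = x"
  by (auto simp: signed_powr_def sgn_if)

lemma signed_powr_mult_pos: "0 < y \<Longrightarrow> signed_powr b (x * y) = signed_powr b x * y powr b"
  by (simp add: signed_powr_def sgn_mult abs_mult powr_mult)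

lemma mult_signed_powr: "x * signed_powr b x = \<bar>x\<bar> powr (b + 1)"
proof (cases "x = 0")
  case False
  then have "x * signed_powr b x = \<bar>x\<bar> * \<bar>x\<bar> powr b"
    by (auto simp: signed_powr_def sgn_if)
  then show ?thesis using False by (simp add: powr_add)
qed simp

lemma continuous_on_signed_powr [continuous_intros]:
  assumes "0 < b" "continuous_on S f"
  shows "continuous_on S (\<lambda>x. signed_powr b (f x))"
proof -
  have "signed_powr b = (\<lambda>x. (max x 0) powr b - (max (- x) 0) powr b)"
    by (auto simp: signed_powr_def fun_eq_iff sgn_if max_def)
  then show ?thesis
    using assms by (auto intro!: continuous_intros continuous_on_powr')
qed

lemma signed_powr_measurable [measurable]: "signed_powr b \<in> borel_measurable borel"
  unfolding signed_powr_def by measurable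

text \<open>Only the origin needs an argument: the bound C x^p with p > 1 makes the difference
  quotient O(|y|^(p-1)), so the derivative there is 0, in agreement with sgn 0 = 0.\<close>

lemma has_real_derivative_even_extension:
  fixes H h :: "real \<Rightarrow> real"
  assumes d: "\<And>x. x > 0 \<Longrightarrow> (H has_real_derivative h x) (at x)"
    and p: "1 < p" and H0: "H 0 = 0" and b: "\<And>x. 0 < x \<Longrightarrow> x < 1 \<Longrightarrow> \<bar>H x\<bar> \<le> C * x powr p"
  shows "((\<lambda>x. H \<bar>x\<bar>) has_real_derivative sgn x * h \<bar>x\<bar>) (at x)"
proof -
  consider "x > 0" | "x < 0" | "x = 0" by linarith
  then show ?thesis
  proof cases
    case 1
    then show ?thesis
      using has_field_derivative_transform_within_open[OF d[OF 1] open_greaterThan[of 0], of "\<lambda>x. H \<bar>x\<bar>"]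
      by simp
  next
    case 2
    have "((\<lambda>x. H (- x)) has_real_derivative h (- x) * (- 1)) (at x)"
      by (rule DERIV_chain2[OF d]) (use 2 in \<open>auto intro!: derivative_eq_intros\<close>)
    then show ?thesis
      using has_field_derivative_transform_within_open[OF _ open_lessThan[of 0], of "\<lambda>x. H (- x)" _ x "\<lambda>x. H \<bar>x\<bar>"] 2
      by simp
  next
    case 3
    have "((\<lambda>y. H \<bar>y\<bar> / y) \<longlongrightarrow> 0) (at 0)"
    proof (rule Lim_null_comparison)
      show "\<forall>\<^sub>F y in at 0. norm (H \<bar>y\<bar> / y) \<le> C * \<bar>y\<bar> powr (p - 1)"
        unfolding eventually_at
      proof (intro exI[of _ 1] conjI ballI impI)
        fix y :: real assume "y \<noteq> 0 \<and> dist y 0 < 1"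
        then have y: "0 < \<bar>y\<bar>" "\<bar>y\<bar> < 1" by auto
        have "norm (H \<bar>y\<bar> / y) = \<bar>H \<bar>y\<bar>\<bar> / \<bar>y\<bar>" by simp
        also have "\<dots> \<le> C * \<bar>y\<bar> powr p / \<bar>y\<bar>"
          using b[OF y] y by (intro divide_right_mono) auto
        also have "\<dots> = C * \<bar>y\<bar> powr (p - 1)" using y by (simp add: powr_diff)
        finally show "norm (H \<bar>y\<bar> / y) \<le> C * \<bar>y\<bar> powr (p - 1)" .
      qed simp
      have "((\<lambda>y::real. C * \<bar>y\<bar> powr (p - 1)) \<longlongrightarrow> C * \<bar>0\<bar> powr (p - 1)) (at 0)"
        using p by (intro tendsto_intros tendsto_powr') auto
      then show "((\<lambda>y::real. C * \<bar>y\<bar> powr (p - 1)) \<longlongrightarrow> 0) (at 0)" by simp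
    qed
    then show ?thesis using 3 H0 by (simp add: DERIV_def)
  qed
qed

lemma has_real_derivative_abs_powr:
  assumes "1 < p"
  shows "((\<lambda>x. \<bar>x\<bar> powr p) has_real_derivative p * signed_powr (p - 1) x) (at x)"
proof -
  have d: "((\<lambda>x. x powr p) has_real_derivative p * x powr (p - 1)) (at x)" if "x > 0" for x
    using that by (auto intro!: derivative_eq_intros)
  have "((\<lambda>x. \<bar>x\<bar> powr p) has_real_derivative sgn x * (p * \<bar>x\<bar> powr (p - 1))) (at x)"
    by (rule has_real_derivative_even_extension[OF d assms, where C = 1]) auto
  then show ?thesis by (simp add: signed_powr_def mult_ac)
qed

section \<open>The series exp_p and its differential equation\<close>

lemma Gamma_plus_nat_ge:
  assumes "1 \<le> (p::real)"
  shows "Gamma p * fact j \<le> Gamma (p + real j)"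
proof (induction j)
  case (Suc j)
  have nz: "p + real j \<noteq> 0" using assms by linarith
  have "Gamma (p + real (Suc j)) = (p + real j) * Gamma (p + real j)"
    using Gamma_plus1[of "p + real j"] assms nonpos_Ints_nonpos[of "p + real j"]
    by (auto simp: add_ac)
  \<comment> \<open>The recursion multiplies the left side by j + 1 and the right side by p + j,
    which is at least as large.\<close>
  moreover have "real (Suc j) * (Gamma p * fact j) \<le> (p + real j) * Gamma (p + real j)"
    using Suc.IH assms Gamma_real_pos[of p] by (intro mult_mono) auto
  ultimately show ?case by (simp add: mult_ac)
qed simp

text \<open>\<open>exp_p\<close> without its factor t^(p-1): an everywhere convergent power series,
  to which termwise differentiation applies.\<close>

definition exp_p_series :: "real \<Rightarrow> real \<Rightarrow> real" where
  "exp_p_series p t = (\<Sum>j. (1 / Gamma (p + real j)) * t ^ j)"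

lemma exp_p_series_summable:
  assumes "1 \<le> p"
  shows "summable (\<lambda>j. (1 / Gamma (p + real j)) * t ^ j)"
proof (rule summable_comparison_test')
  have "summable (\<lambda>j. inverse (fact j) * \<bar>t\<bar> ^ j)" by (rule summable_exp)
  then show "summable (\<lambda>j. (1 / Gamma p) * (inverse (fact j) * \<bar>t\<bar> ^ j))" by (rule summable_mult)
  fix j :: nat
  have pos: "Gamma p * fact j > 0" using assms Gamma_real_pos[of p] by simp
  have "1 / Gamma (p + real j) \<le> 1 / (Gamma p * fact j)"
    by (rule frac_le) (use Gamma_plus_nat_ge[OF assms] pos in auto)
  then have "(1 / Gamma (p + real j)) * \<bar>t\<bar> ^ j \<le> (1 / (Gamma p * fact j)) * \<bar>t\<bar> ^ j"
    by (rule mult_right_mono) simp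
  then show "norm ((1 / Gamma (p + real j)) * t ^ j) \<le> (1 / Gamma p) * (inverse (fact j) * \<bar>t\<bar> ^ j)"
    using Gamma_real_pos[of "p + real j"] assms by (simp add: abs_mult power_abs divide_inverse)
qed

lemma exp_p_eq:
  assumes p: "1 < p" and t: "0 \<le> t"
  shows "exp_p p t = t powr (p - 1) * exp_p_series p t"
proof (cases "t = 0")
  case True
  then show ?thesis by (simp add: exp_p_def)
next
  case False
  then have "t powr (p - 1 + real j) / Gamma (p + real j) = t powr (p - 1) * ((1 / Gamma (p + real j)) * t ^ j)" for j
    using t by (simp add: powr_add powr_realpow)
  then show ?thesis
    unfolding exp_p_def exp_p_series_def using p
    by (simp only: suminf_mult[OF exp_p_series_summable[of p t]])
qed

lemma exp_p_series_bounds: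
  assumes p: "1 < p" and t: "0 \<le> t"
  shows "1 / Gamma p \<le> exp_p_series p t" "exp_p_series p t \<le> exp t / Gamma p"
proof -
  have G: "Gamma (p + real j) > 0" for j using p Gamma_real_pos[of "p + real j"] by simp
  note s = exp_p_series_summable[of p t]
  have "(\<Sum>j<Suc 0. (1 / Gamma (p + real j)) * t ^ j) \<le> exp_p_series p t"
    unfolding exp_p_series_def using s p G t by (intro sum_le_suminf) (auto intro: less_imp_le)
  then show "1 / Gamma p \<le> exp_p_series p t" by simp
  have "exp_p_series p t \<le> (\<Sum>j. (1 / Gamma p) * (t ^ j /\<^sub>R fact j))"
    unfolding exp_p_series_def
  proof (rule suminf_le)
    fix j
    have pos: "Gamma p * fact j > 0" using G[of 0] by simp
    have "1 / Gamma (p + real j) \<le> 1 / (Gamma p * fact j)"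
      by (rule frac_le) (use Gamma_plus_nat_ge[of p j] p pos in auto)
    then have "(1 / Gamma (p + real j)) * t ^ j \<le> (1 / (Gamma p * fact j)) * t ^ j"
      by (rule mult_right_mono) (use t in simp)
    then show "(1 / Gamma (p + real j)) * t ^ j \<le> (1 / Gamma p) * (t ^ j /\<^sub>R fact j)"
      by (simp add: field_simps)
    show "summable (\<lambda>j. (1 / Gamma p) * (t ^ j /\<^sub>R fact j))"
      by (rule summable_mult[OF summable_exp_generic])
    show "summable (\<lambda>j. (1 / Gamma (p + real j)) * t ^ j)" using s p by simp
  qed
  also have "\<dots> = exp t / Gamma p"
    by (subst suminf_mult[OF summable_exp_generic]) (simp add: exp_def)
  finally show "exp_p_series p t \<le> exp t / Gamma p" .
qed

lemma exp_p_bounds: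
  assumes p: "1 < p" and t: "0 \<le> t"
  shows "t powr (p - 1) / Gamma p \<le> exp_p p t" "exp_p p t \<le> t powr (p - 1) * exp t / Gamma p" "0 \<le> exp_p p t"
proof -
  have G: "Gamma p > 0" using p by (simp add: Gamma_real_pos)
  show 1: "t powr (p - 1) / Gamma p \<le> exp_p p t"
    using mult_left_mono[OF exp_p_series_bounds(1)[OF p t], of "t powr (p - 1)"]
    unfolding exp_p_eq[OF p t] by simp
  show "exp_p p t \<le> t powr (p - 1) * exp t / Gamma p"
    using mult_left_mono[OF exp_p_series_bounds(2)[OF p t], of "t powr (p - 1)"]
    unfolding exp_p_eq[OF p t] by simp
  show "0 \<le> exp_p p t" using order_trans[OF _ 1, of 0] G by simp
qed

lemma exp_p_mono:
  assumes p: "1 < p" and t: "0 \<le> s" "s \<le> t"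
  shows "exp_p p s \<le> exp_p p t"
proof -
  have G: "Gamma (p + real j) > 0" for j using p Gamma_real_pos[of "p + real j"] by simp
  have "exp_p_series p s \<le> exp_p_series p t"
    unfolding exp_p_series_def
    by (rule suminf_le)
      (use p t G in \<open>auto intro!: exp_p_series_summable divide_right_mono power_mono less_imp_le[OF G]
        simp del: times_divide_eq_left simp: mult_left_mono\<close>)
  moreover have "0 \<le> exp_p_series p s"
    using exp_p_series_bounds(1)[OF p t(1)] G[of 0] by (simp add: order_trans[rotated])
  ultimately show ?thesis
    using t p by (simp add: exp_p_eq) (intro mult_mono powr_mono2, auto)
qed

text \<open>The identity is exp_p' = exp_p + t^(p-2) / Gamma(p - 1) with t^(p-2) divided out. The
  Gamma recursion shifts the index by one, and the extra summand is what the lowest term of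
  \<open>exp_p\<close> leaves behind.\<close>

lemma exp_p_series_deriv:
  assumes p: "1 < p"
  obtains D where "(exp_p_series p has_real_derivative D) (at t)"
    "(p - 1) * exp_p_series p t + t * D = t * exp_p_series p t + 1 / Gamma (p - 1)"
proof -
  define c where "c = (\<lambda>j. 1 / Gamma (p + real j))"
  have s: "summable (\<lambda>j. c j * x ^ j)" for x
    using exp_p_series_summable[of p x] p by (simp add: c_def)
  define D where "D = (\<Sum>j. diffs c j * t ^ j)"
  have d: "(exp_p_series p has_real_derivative D) (at t)"
    unfolding exp_p_series_def D_def c_def[symmetric]
    using termdiffs_strong_converges_everywhere[OF s] by (simp add: c_def)
  have sd: "summable (\<lambda>j. diffs c j * t ^ j)"
    using termdiff_converges_all[OF s] .
  have rec: "(p - 1 + real (Suc j)) * c (Suc j) = c j" for j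
  proof -
    have "p + real j > 0" using p by linarith
    then have "Gamma (p + real (Suc j)) = (p + real j) * Gamma (p + real j)"
      using Gamma_plus1[of "p + real j"] nonpos_Ints_nonpos[of "p + real j"] by (force simp: add_ac)
    then show ?thesis using \<open>p + real j > 0\<close> by (simp add: c_def add_ac)
  qed
  have c0: "(p - 1) * c 0 = 1 / Gamma (p - 1)"
  proof -
    have "Gamma p = (p - 1) * Gamma (p - 1)"
      using Gamma_plus1[of "p - 1"] p nonpos_Ints_nonpos[of "p - 1"] by force
    then show ?thesis using p by (simp add: c_def)
  qed
  have sh: "summable (\<lambda>j. c (Suc j) * t ^ Suc j)" using s[of t] by (subst summable_Suc_iff)
  have E: "exp_p_series p t = c 0 + (\<Sum>j. c (Suc j) * t ^ Suc j)"
    unfolding exp_p_series_def c_def[symmetric] using suminf_split_head[OF s[of t]] by (simp add: c_def)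
  have "(p - 1) * exp_p_series p t + t * D
      = (p - 1) * c 0 + ((\<Sum>j. (p - 1) * (c (Suc j) * t ^ Suc j)) + (\<Sum>j. t * (diffs c j * t ^ j)))"
    unfolding E D_def by (simp only: distrib_left suminf_mult[OF sh] suminf_mult[OF sd] add.assoc)
  also have "(\<Sum>j. (p - 1) * (c (Suc j) * t ^ Suc j)) + (\<Sum>j. t * (diffs c j * t ^ j))
      = (\<Sum>j. (p - 1) * (c (Suc j) * t ^ Suc j) + t * (diffs c j * t ^ j))"
    by (rule suminf_add[OF summable_mult[OF sh] summable_mult[OF sd]])
  also have "(\<lambda>j. (p - 1) * (c (Suc j) * t ^ Suc j) + t * (diffs c j * t ^ j)) = (\<lambda>j. t * (c j * t ^ j))"
  proof
    fix j
    have "(p - 1) * (c (Suc j) * t ^ Suc j) + t * (diffs c j * t ^ j)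
        = ((p - 1 + real (Suc j)) * c (Suc j)) * t ^ Suc j"
      by (simp add: diffs_def algebra_simps)
    then show "(p - 1) * (c (Suc j) * t ^ Suc j) + t * (diffs c j * t ^ j) = t * (c j * t ^ j)"
      unfolding rec by simp
  qed
  also have "(\<Sum>j. t * (c j * t ^ j)) = t * exp_p_series p t"
    unfolding exp_p_series_def c_def[symmetric] using suminf_mult[OF s] by (simp add: c_def)
  finally show ?thesis using that[OF d] c0 by simp
qed

lemma exp_p_series_continuous:
  assumes "1 < p" "continuous_on S f"
  shows "continuous_on S (\<lambda>x. exp_p_series p (f x))"
proof -
  have "isCont (exp_p_series p) t" for t
    using exp_p_series_deriv[OF assms(1), of t] DERIV_isCont by metis
  then have "continuous_on UNIV (exp_p_series p)" by (simp add: continuous_at_imp_continuous_on)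
  from continuous_on_compose2[OF this assms(2)] show ?thesis by simp
qed

lemma exp_p_has_deriv:
  assumes p: "1 < p" and t: "0 < t"
  shows "(exp_p p has_real_derivative exp_p p t + t powr (p - 2) / Gamma (p - 1)) (at t)"
proof -
  obtain D where D: "(exp_p_series p has_real_derivative D) (at t)"
    "(p - 1) * exp_p_series p t + t * D = t * exp_p_series p t + 1 / Gamma (p - 1)"
    by (rule exp_p_series_deriv[OF p])
  have A: "((\<lambda>t. t powr (p - 1) * exp_p_series p t) has_real_derivative
      t powr (p - 1) * D + ((p - 1) * t powr (p - 1 - 1)) * exp_p_series p t) (at t)"
    by (rule DERIV_mult'[OF _ D(1)]) (use t in \<open>auto intro!: derivative_eq_intros\<close>)
  have "t powr (p - 1) = t powr (p - 2) * t"
    using t powr_add[of t "p - 2" 1] by simp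
  then have "t powr (p - 1) * D + ((p - 1) * t powr (p - 1 - 1)) * exp_p_series p t
      = t powr (p - 2) * ((p - 1) * exp_p_series p t + t * D)"
    by (simp add: algebra_simps)
  also have "\<dots> = exp_p p t + t powr (p - 2) / Gamma (p - 1)"
    unfolding D(2) using \<open>t powr (p - 1) = t powr (p - 2) * t\<close> p t by (simp add: exp_p_eq algebra_simps)
  finally have "((\<lambda>t. t powr (p - 1) * exp_p_series p t) has_real_derivative
      exp_p p t + t powr (p - 2) / Gamma (p - 1)) (at t)"
    using A by simp
  then show ?thesis
    by (rule has_field_derivative_transform_within_open[OF _ open_greaterThan[of 0]])
      (use t p in \<open>auto simp: exp_p_eq\<close>)
qed

section \<open>The integrand as a function of the value of u\<close>

abbreviation conj_exp :: "real \<Rightarrow> real" where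
  "conj_exp p \<equiv> p / (p - 1)"

context
  fixes p \<mu> :: real
  assumes p: "1 < p" and \<mu>: "0 < \<mu>"
begin

definition TM_density :: "real \<Rightarrow> real" where
  "TM_density x = exp_p p (\<mu> * \<bar>x\<bar> powr conj_exp p)"

text \<open>The derivative of \<open>TM_density\<close>. The last summand comes from the term j = 0
  of the series; the derivatives of the terms j \<ge> 1 add up, after the index shift, to the full
  series times the derivative of the inner function.\<close>

definition TM_slope :: "real \<Rightarrow> real" where
  "TM_slope x = conj_exp p * \<mu> * (signed_powr (1 / (p - 1)) x * TM_density x)
    + p * \<mu> powr (p - 1) / Gamma p * signed_powr (p - 1) x"

lemma conj_exponent: "conj_exp p > 1" "conj_exp p - 1 = 1 / (p - 1)" "conj_exp p * (p - 1) = p" "conj_exp p * p = p + conj_exp p" "(p - 1) * (1 / (p - 1)) = 1"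
  using p by (auto simp: field_simps)

lemma Gamma_p_pos: "Gamma p > 0"
  using p by (simp add: Gamma_real_pos)

lemma TM_arg_powr: "(\<mu> * \<bar>x\<bar> powr conj_exp p) powr (p - 1) = \<mu> powr (p - 1) * \<bar>x\<bar> powr p"
  using \<mu> conj_exponent(3) by (simp only: powr_mult abs_ge_zero powr_powr powr_ge_zero less_imp_le)

lemma TM_density_eq:
  "TM_density x = \<mu> powr (p - 1) * \<bar>x\<bar> powr p * exp_p_series p (\<mu> * \<bar>x\<bar> powr conj_exp p)"
  unfolding TM_density_def using \<mu> TM_arg_powr p by (simp add: exp_p_eq)

lemma TM_density_continuous [continuous_intros]:
  "continuous_on S f \<Longrightarrow> continuous_on S (\<lambda>x. TM_density (f x))"
  unfolding TM_density_eq using p conj_exponent(1)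
  by (intro continuous_intros continuous_on_powr' exp_p_series_continuous) auto

lemma TM_slope_continuous [continuous_intros]:
  "continuous_on S f \<Longrightarrow> continuous_on S (\<lambda>x. TM_slope (f x))"
  unfolding TM_slope_def using p by (intro continuous_intros) auto

lemma TM_density_ge: "\<mu> powr (p - 1) / Gamma p * \<bar>x\<bar> powr p \<le> TM_density x"
  using exp_p_bounds(1)[OF p, of "\<mu> * \<bar>x\<bar> powr conj_exp p"] \<mu> by (simp add: TM_density_def TM_arg_powr)

lemma TM_density_nonneg: "0 \<le> TM_density x"
  using exp_p_bounds(3)[OF p, of "\<mu> * \<bar>x\<bar> powr conj_exp p"] \<mu> by (simp add: TM_density_def)

lemma TM_density_le: "TM_density x \<le> \<mu> powr (p - 1) / Gamma p * (\<bar>x\<bar> powr p * exp (\<mu> * \<bar>x\<bar> powr conj_exp p))"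
  using exp_p_bounds(2)[OF p, of "\<mu> * \<bar>x\<bar> powr conj_exp p"] \<mu> by (simp add: TM_density_def TM_arg_powr)

text \<open>The inequality exp t \<le> 1 + t exp t separates the p-th power, which the norm
  controls, from a remainder that the exponential inequality controls.\<close>

lemma TM_density_le_growth:
  "TM_density x \<le> \<mu> powr (p - 1) / Gamma p * (\<bar>x\<bar> powr p + \<mu> * exp_growth p \<mu> x)"
proof -
  define t where "t = \<mu> * \<bar>x\<bar> powr conj_exp p"
  have "exp t \<le> 1 + t * exp t"
    using exp_ge_add_one_self[of "- t"] mult_left_mono[of "1 - t" "exp (- t)" "exp t"]
    by (simp add: exp_minus algebra_simps)
  then have "\<bar>x\<bar> powr p * exp t \<le> \<bar>x\<bar> powr p * (1 + t * exp t)"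
    by (rule mult_left_mono) simp
  also have "\<dots> = \<bar>x\<bar> powr p + \<mu> * exp_growth p \<mu> x"
    by (simp add: exp_growth_def t_def powr_add algebra_simps)
  finally have "\<mu> powr (p - 1) / Gamma p * (\<bar>x\<bar> powr p * exp t)
      \<le> \<mu> powr (p - 1) / Gamma p * (\<bar>x\<bar> powr p + \<mu> * exp_growth p \<mu> x)"
    using Gamma_p_pos by (intro mult_left_mono) auto
  then show ?thesis using TM_density_le[of x] unfolding t_def by linarith
qed

text \<open>Integrated along u, this splits the pairing of the functional's derivative with u itself
  into q times the excess and p times the leading term of the functional.\<close>

lemma mult_TM_slope:
  "x * TM_slope x = conj_exp p * (\<mu> * \<bar>x\<bar> powr conj_exp p * TM_density x) + p * (\<mu> powr (p - 1) / Gamma p * \<bar>x\<bar> powr p)"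
proof -
  have "1 / (p - 1) + 1 = conj_exp p" "p - 1 + 1 = p" using p by (auto simp: field_simps)
  then have sp: "x * signed_powr (1 / (p - 1)) x = \<bar>x\<bar> powr conj_exp p" "x * signed_powr (p - 1) x = \<bar>x\<bar> powr p"
    by (simp_all only: mult_signed_powr)
  have "x * TM_slope x = conj_exp p * (\<mu> * (x * signed_powr (1 / (p - 1)) x) * TM_density x)
      + p * (\<mu> powr (p - 1) / Gamma p * (x * signed_powr (p - 1) x))"
    unfolding TM_slope_def by (simp add: algebra_simps)
  then show ?thesis unfolding sp .
qed

lemma TM_excess_le_growth:
  "\<mu> * \<bar>x\<bar> powr conj_exp p * TM_density x \<le> \<mu> powr p / Gamma p * exp_growth p \<mu> x"
proof -
  have "\<mu> * \<bar>x\<bar> powr conj_exp p * TM_density x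
      \<le> \<mu> * \<bar>x\<bar> powr conj_exp p * (\<mu> powr (p - 1) / Gamma p * (\<bar>x\<bar> powr p * exp (\<mu> * \<bar>x\<bar> powr conj_exp p)))"
    using \<mu> by (intro mult_left_mono TM_density_le) auto
  also have "\<dots> = (\<mu> * \<mu> powr (p - 1)) / Gamma p * exp_growth p \<mu> x"
    by (simp add: exp_growth_def powr_add)
  also have "\<mu> * \<mu> powr (p - 1) = \<mu> powr p"
    using \<mu> by (simp add: powr_diff)
  finally show ?thesis .
qed

lemma TM_density_has_deriv: "(TM_density has_real_derivative TM_slope x) (at x)"
proof -
  define H where "H = (\<lambda>x. exp_p p (\<mu> * x powr conj_exp p))"
  define h where "h = (\<lambda>x. (exp_p p (\<mu> * x powr conj_exp p) + (\<mu> * x powr conj_exp p) powr (p - 2) / Gamma (p - 1)) * (\<mu> * (conj_exp p * x powr (conj_exp p - 1))))"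
  have d: "(H has_real_derivative h x) (at x)" if "x > 0" for x
    unfolding H_def h_def
    by (rule DERIV_chain2[OF exp_p_has_deriv[OF p]])
      (use that \<mu> in \<open>auto intro!: derivative_eq_intros\<close>)
  have H0: "H 0 = 0" by (simp add: H_def exp_p_def)
  have b: "\<bar>H x\<bar> \<le> (\<mu> powr (p - 1) / Gamma p * exp \<mu>) * x powr p" if x: "0 < x" "x < 1" for x
  proof -
    have "x powr conj_exp p \<le> 1" using x conj_exponent(1) by (intro powr_le1) auto
    then have "exp (\<mu> * x powr conj_exp p) \<le> exp \<mu>" using \<mu> by simp
    then have "\<mu> powr (p - 1) / Gamma p * (x powr p * exp (\<mu> * x powr conj_exp p)) \<le> \<mu> powr (p - 1) / Gamma p * (x powr p * exp \<mu>)"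
      using Gamma_p_pos by (intro mult_left_mono) auto
    then show ?thesis
      using TM_density_le[of x] TM_density_nonneg[of x] x unfolding TM_density_def H_def by (simp add: mult_ac)
  qed
  have eq: "sgn x * h \<bar>x\<bar> = TM_slope x"
  proof (cases "x = 0")
    case False
    then have ax: "\<bar>x\<bar> > 0" by simp
    have G: "Gamma p = (p - 1) * Gamma (p - 1)"
      using Gamma_plus1[of "p - 1"] p nonpos_Ints_nonpos[of "p - 1"] by force
    have mm: "\<mu> powr (p - 2) * \<mu> = \<mu> powr (p - 1)" using \<mu> powr_add[of \<mu> "p - 2" 1] by simp
    \<comment> \<open>For p < 2 the outer derivative is singular at 0; the inner derivative
      compensates, and the nonsingular power p - 1 remains.\<close>
    have "conj_exp p * (p - 2) + (conj_exp p - 1) = p - 1" using p by (simp add: field_simps)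
    then have xx: "\<bar>x\<bar> powr (conj_exp p * (p - 2)) * \<bar>x\<bar> powr (conj_exp p - 1) = \<bar>x\<bar> powr (p - 1)"
      by (simp only: powr_add[symmetric])
    have "(\<mu> * \<bar>x\<bar> powr conj_exp p) powr (p - 2) / Gamma (p - 1) * (\<mu> * (conj_exp p * \<bar>x\<bar> powr (conj_exp p - 1)))
        = (\<mu> powr (p - 2) * \<mu>) * (\<bar>x\<bar> powr (conj_exp p * (p - 2)) * \<bar>x\<bar> powr (conj_exp p - 1)) * (conj_exp p / Gamma (p - 1))"
      using \<mu> by (simp only: powr_mult abs_ge_zero powr_powr powr_ge_zero less_imp_le) (simp add: mult_ac)
    also have "\<dots> = \<mu> powr (p - 1) * \<bar>x\<bar> powr (p - 1) * (p / Gamma p)"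
      unfolding mm xx G using p by simp
    finally have 2: "(\<mu> * \<bar>x\<bar> powr conj_exp p) powr (p - 2) / Gamma (p - 1) * (\<mu> * (conj_exp p * \<bar>x\<bar> powr (conj_exp p - 1)))
      = \<mu> powr (p - 1) * \<bar>x\<bar> powr (p - 1) * (p / Gamma p)" .
    have "h \<bar>x\<bar> = conj_exp p * \<mu> * (\<bar>x\<bar> powr (conj_exp p - 1) * TM_density x) + \<mu> powr (p - 1) * \<bar>x\<bar> powr (p - 1) * (p / Gamma p)"
      unfolding h_def distrib_right 2 by (simp add: TM_density_def mult_ac)
    then have "sgn x * h \<bar>x\<bar> = conj_exp p * \<mu> * ((sgn x * \<bar>x\<bar> powr (conj_exp p - 1)) * TM_density x)
       + p * \<mu> powr (p - 1) / Gamma p * (sgn x * \<bar>x\<bar> powr (p - 1))"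
      by (simp add: distrib_left mult_ac)
    then show ?thesis
      unfolding TM_slope_def signed_powr_def conj_exponent(2) .
  qed (simp add: TM_slope_def signed_powr_def)
  have "((\<lambda>x. H \<bar>x\<bar>) has_real_derivative sgn x * h \<bar>x\<bar>) (at x)"
    by (rule has_real_derivative_even_extension[OF d p H0 b])
  moreover have "(\<lambda>x. H \<bar>x\<bar>) = TM_density" by (auto simp: H_def TM_density_def)
  ultimately show ?thesis using eq by simp
qed

lemma abs_TM_slope: "\<bar>TM_slope x\<bar> = TM_slope \<bar>x\<bar>"
proof -
  have "TM_slope x = sgn x * TM_slope \<bar>x\<bar>"
    by (auto simp: TM_slope_def signed_powr_def TM_density_def sgn_if)
  moreover have "TM_slope \<bar>x\<bar> \<ge> 0"
    using TM_density_nonneg Gamma_p_pos \<mu> p by (auto simp: TM_slope_def signed_powr_def sgn_if)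
  ultimately show ?thesis by (cases "x = 0") (auto simp: abs_mult sgn_if TM_slope_def signed_powr_def)
qed

text \<open>Both summands have absolute values increasing in |x|. Hence the slope at a common bound
  of a curve dominates all slopes along the curve.\<close>

lemma TM_slope_mono:
  assumes "\<bar>x\<bar> \<le> z"
  shows "\<bar>TM_slope x\<bar> \<le> TM_slope z"
proof -
  have z: "z \<ge> 0" using assms by simp
  have sp: "signed_powr b \<bar>x\<bar> \<le> signed_powr b z" if "b > 0" for b
    using assms that by (auto simp: signed_powr_def sgn_if intro!: powr_mono2)
  have sp0: "0 \<le> signed_powr b z" for b using z by (auto simp: signed_powr_def sgn_if)
  have "\<mu> * \<bar>x\<bar> powr conj_exp p \<le> \<mu> * z powr conj_exp p"
    using assms \<mu> conj_exponent(1) by (intro mult_left_mono powr_mono2) auto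
  then have "TM_density \<bar>x\<bar> \<le> TM_density z"
    unfolding TM_density_def using \<mu> z by (intro exp_p_mono[OF p]) auto
  then have "signed_powr (1 / (p - 1)) \<bar>x\<bar> * TM_density \<bar>x\<bar> \<le> signed_powr (1 / (p - 1)) z * TM_density z"
    using sp[of "1 / (p - 1)"] sp0 p TM_density_nonneg by (intro mult_mono) auto
  then show ?thesis
    unfolding abs_TM_slope unfolding TM_slope_def using sp[of "p - 1"] p \<mu> Gamma_p_pos
    by (intro add_mono mult_left_mono) auto
qed

lemma TM_slope_growth:
  "z * TM_slope z \<le> p * \<mu> powr (p - 1) / Gamma p * \<bar>z\<bar> powr p + conj_exp p * \<mu> powr p / Gamma p * exp_growth p \<mu> z"
  using mult_left_mono[OF TM_excess_le_growth[of z], of "conj_exp p"] conj_exponent(1)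
  unfolding mult_TM_slope by simp

end

section \<open>Differentiation under the integral\<close>

lemma integral_has_real_derivative_dominated:
  fixes f :: "real \<Rightarrow> 'a \<Rightarrow> real"
  assumes \<epsilon>: "0 < \<epsilon>" and meas: "\<And>s. f s \<in> borel_measurable M" and int0: "integrable M (f \<sigma>)"
    and g: "integrable M g"
    and dom: "\<And>s x. \<bar>s - \<sigma>\<bar> < \<epsilon> \<Longrightarrow> x \<in> space M \<Longrightarrow> \<bar>f s x - f \<sigma> x\<bar> \<le> \<bar>s - \<sigma>\<bar> * g x"
    and deriv: "\<And>x. x \<in> space M \<Longrightarrow> ((\<lambda>s. f s x) has_real_derivative f' x) (at \<sigma>)"
  shows "((\<lambda>s. LINT x|M. f s x) has_real_derivative (LINT x|M. f' x)) (at \<sigma>)"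
    and "integrable M f'"
proof -
  have int: "integrable M (f s)" if "\<bar>s - \<sigma>\<bar> < \<epsilon>" for s
  proof -
    have "integrable M (\<lambda>x. f s x - f \<sigma> x)"
      by (rule Bochner_Integration.integrable_bound[OF integrable_mult_right[OF g, of "\<bar>s - \<sigma>\<bar>"]])
        (use meas dom[OF that] in \<open>auto intro!: AE_I2 order_trans[OF _ abs_ge_self]\<close>)
    from Bochner_Integration.integrable_add[OF this int0] show ?thesis by simp
  qed
  have quot: "(\<lambda>n. (f (\<sigma> + X n) x - f \<sigma> x) / X n) \<longlonglongrightarrow> f' x"
    if "\<And>n. X n \<noteq> 0" "X \<longlonglongrightarrow> 0" "x \<in> space M" for X x
    using deriv[OF that(3)] that(1,2) unfolding DERIV_def tendsto_at_iff_sequentially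
    by (auto simp: comp_def)
  have main: "integrable M f' \<and> (\<lambda>n. ((LINT x|M. f (\<sigma> + X n) x) - (LINT x|M. f \<sigma> x)) / X n) \<longlonglongrightarrow> (LINT x|M. f' x)"
    if X: "\<And>n. X n \<noteq> 0" "X \<longlonglongrightarrow> 0" "\<And>n. \<bar>X n\<bar> < \<epsilon>" for X
  proof -
    have bm: "(\<lambda>x. (f (\<sigma> + X n) x - f \<sigma> x) / X n) \<in> borel_measurable M" for n
      using meas by (intro borel_measurable_divide borel_measurable_diff borel_measurable_const)
    have bm': "f' \<in> borel_measurable M"
      by (rule borel_measurable_LIMSEQ_metric[OF bm]) (rule quot[OF X(1,2)])
    have bound: "norm ((f (\<sigma> + X n) x - f \<sigma> x) / X n) \<le> g x" if "x \<in> space M" for n x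
      using dom[of "\<sigma> + X n" x] X(1)[of n] X(3)[of n] that by (simp add: divide_le_eq mult.commute)
    have ae: "AE x in M. (\<lambda>n. (f (\<sigma> + X n) x - f \<sigma> x) / X n) \<longlonglongrightarrow> f' x"
      by (rule AE_I2) (rule quot[OF X(1,2)])
    have ab: "AE x in M. norm ((f (\<sigma> + X n) x - f \<sigma> x) / X n) \<le> g x" for n
      by (rule AE_I2) (rule bound)
    have "integrable M f'"
      by (rule integrable_dominated_convergence[OF bm' bm g ae ab])
    moreover have "(\<lambda>n. LINT x|M. (f (\<sigma> + X n) x - f \<sigma> x) / X n) \<longlonglongrightarrow> (LINT x|M. f' x)"
      by (rule integral_dominated_convergence[OF bm' bm g ae ab])
    moreover have "(LINT x|M. (f (\<sigma> + X n) x - f \<sigma> x) / X n)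
        = ((LINT x|M. f (\<sigma> + X n) x) - (LINT x|M. f \<sigma> x)) / X n" for n
      using int[of "\<sigma> + X n"] X(3)[of n] int0 by simp
    ultimately show ?thesis by (simp only: simp_thms)
  qed
  \<comment> \<open>One concrete null sequence inside the \<epsilon>-ball suffices to read off the
    integrability of f'.\<close>
  have "(\<lambda>n. \<epsilon> / 2 * inverse (real (Suc n))) \<longlonglongrightarrow> \<epsilon> / 2 * 0"
    by (intro tendsto_mult tendsto_const LIMSEQ_inverse_real_of_nat)
  moreover have "\<bar>\<epsilon> / 2 * inverse (real (Suc n))\<bar> < \<epsilon>" for n
  proof -
    have "\<epsilon> / 2 * inverse (real (Suc n)) \<le> \<epsilon> / 2 * 1"
      using \<epsilon> by (intro mult_left_mono) (auto simp: field_simps)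
    then show ?thesis using \<epsilon> by (simp add: abs_mult)
  qed
  ultimately show "integrable M f'"
    using main[of "\<lambda>n. \<epsilon> / 2 * inverse (real (Suc n))"] \<epsilon> by simp
  show "((\<lambda>s. LINT x|M. f s x) has_real_derivative (LINT x|M. f' x)) (at \<sigma>)"
    unfolding DERIV_def tendsto_at_iff_sequentially
  proof (intro allI impI)
    fix X :: "nat \<Rightarrow> real" assume X: "\<forall>i. X i \<in> UNIV - {0}" "X \<longlonglongrightarrow> 0"
    have "\<forall>\<^sub>F n in sequentially. \<bar>X n\<bar> < \<epsilon>"
      using tendsto_rabs_zero[OF X(2)] \<epsilon> by (rule order_tendstoD(2))
    then obtain N where N: "\<And>n. n \<ge> N \<Longrightarrow> \<bar>X n\<bar> < \<epsilon>" by (auto simp: eventually_sequentially)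
    \<comment> \<open>\<open>main\<close> asks for the bound \<epsilon> on every term of the
      sequence, so the first N terms are dropped.\<close>
    have "(\<lambda>n. ((LINT x|M. f (\<sigma> + X (n + N)) x) - (LINT x|M. f \<sigma> x)) / X (n + N)) \<longlonglongrightarrow> (LINT x|M. f' x)"
      using main[of "\<lambda>n. X (n + N)"] X N LIMSEQ_ignore_initial_segment[OF X(2), of N] by simp
    then show "((\<lambda>h. ((LINT x|M. f (\<sigma> + h) x) - (LINT x|M. f \<sigma> x)) / h) \<circ> X) \<longlonglongrightarrow> (LINT x|M. f' x)"
      unfolding comp_def by (rule LIMSEQ_offset)
  qed
qed

text \<open>By the mean value theorem on [-z, z] and the monotonicity of \<tau>, increments of T
  along the curve are at most |s - \<sigma>| C z \<tau>(z), a majorant independent of s. Both the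
  energy, T = |x|^p, and the functional are differentiated this way.\<close>

lemma integral_composition_has_derivative:
  fixes T \<tau> :: "real \<Rightarrow> real" and X :: "real \<Rightarrow> 'a \<Rightarrow> real"
  assumes T: "\<And>x. (T has_real_derivative \<tau> x) (at x)"
    and mono: "\<And>x z. \<bar>x\<bar> \<le> z \<Longrightarrow> \<bar>\<tau> x\<bar> \<le> \<tau> z"
    and \<epsilon>: "0 < \<epsilon>" and Xm: "\<And>s. X s \<in> borel_measurable M"
    and wt: "wt \<in> borel_measurable M" "\<And>r. r \<in> space M \<Longrightarrow> 0 \<le> wt r"
    and Xz: "\<And>s r. \<bar>s - \<sigma>\<bar> < \<epsilon> \<Longrightarrow> r \<in> space M \<Longrightarrow> \<bar>X s r\<bar> \<le> z r"
    and Xd: "\<And>s r. \<bar>s - \<sigma>\<bar> < \<epsilon> \<Longrightarrow> r \<in> space M \<Longrightarrow> \<bar>X s r - X \<sigma> r\<bar> \<le> \<bar>s - \<sigma>\<bar> * (C * z r)"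
    and X': "\<And>r. r \<in> space M \<Longrightarrow> ((\<lambda>s. X s r) has_real_derivative X' r) (at \<sigma>)"
    and zint: "integrable M (\<lambda>r. z r * \<tau> (z r) * wt r)"
    and int0: "integrable M (\<lambda>r. T (X \<sigma> r) * wt r)"
  shows "((\<lambda>s. LINT r|M. T (X s r) * wt r) has_real_derivative (LINT r|M. \<tau> (X \<sigma> r) * X' r * wt r)) (at \<sigma>)"
    and "integrable M (\<lambda>r. \<tau> (X \<sigma> r) * X' r * wt r)"
proof -
  have "continuous_on UNIV T"
    using T DERIV_isCont continuous_at_imp_continuous_on by blast
  then have Tm: "T \<in> borel_measurable borel" by (rule borel_measurable_continuous_onI)
  have meas: "(\<lambda>r. T (X s r) * wt r) \<in> borel_measurable M" for s
    using measurable_compose[OF Xm Tm] wt(1) by (rule borel_measurable_times)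
  have lip: "\<bar>T x - T y\<bar> \<le> \<tau> z * \<bar>x - y\<bar>" if "\<bar>x\<bar> \<le> z" "\<bar>y\<bar> \<le> z" for x y z
  proof -
    have "norm (T x - T y) \<le> \<tau> z * norm (x - y)"
    proof (rule field_differentiable_bound[of "{-z..z}" T \<tau>])
      show "(T has_real_derivative \<tau> u) (at u within {-z..z})" for u
        using T by (rule has_field_derivative_at_within)
      show "norm (\<tau> u) \<le> \<tau> z" if "u \<in> {-z..z}" for u
        using mono[of u z] that by auto
    qed (use that in auto)
    then show ?thesis by simp
  qed
  have dom: "\<bar>T (X s r) * wt r - T (X \<sigma> r) * wt r\<bar> \<le> \<bar>s - \<sigma>\<bar> * (C * (z r * \<tau> (z r) * wt r))"
    if s: "\<bar>s - \<sigma>\<bar> < \<epsilon>" and r: "r \<in> space M" for s r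
  proof -
    have "\<bar>X \<sigma> r\<bar> \<le> z r" using Xz[of \<sigma> r] \<epsilon> r by simp
    then have "\<bar>T (X s r) - T (X \<sigma> r)\<bar> \<le> \<tau> (z r) * \<bar>X s r - X \<sigma> r\<bar>"
      using Xz[OF s r] by (intro lip)
    also have "\<dots> \<le> \<tau> (z r) * (\<bar>s - \<sigma>\<bar> * (C * z r))"
      using mono[of "z r" "z r"] \<open>\<bar>X \<sigma> r\<bar> \<le> z r\<close> by (intro mult_left_mono Xd[OF s r]) simp
    finally have "\<bar>T (X s r) - T (X \<sigma> r)\<bar> * wt r \<le> \<tau> (z r) * (\<bar>s - \<sigma>\<bar> * (C * z r)) * wt r"
      using wt(2)[OF r] by (rule mult_right_mono)
    moreover have "T (X s r) * wt r - T (X \<sigma> r) * wt r = (T (X s r) - T (X \<sigma> r)) * wt r"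
      by (simp only: left_diff_distrib)
    ultimately show ?thesis
      using wt(2)[OF r] by (simp only: abs_mult abs_of_nonneg) (simp add: mult_ac)
  qed
  have der: "((\<lambda>s. T (X s r) * wt r) has_real_derivative \<tau> (X \<sigma> r) * X' r * wt r) (at \<sigma>)"
    if "r \<in> space M" for r
    by (rule DERIV_cmult_right[OF DERIV_chain2[OF T X'[OF that]]])
  show "((\<lambda>s. LINT r|M. T (X s r) * wt r) has_real_derivative (LINT r|M. \<tau> (X \<sigma> r) * X' r * wt r)) (at \<sigma>)"
    by (rule integral_has_real_derivative_dominated(1)[OF \<epsilon> meas int0 integrable_mult_right[OF zint] dom der])
  show "integrable M (\<lambda>r. \<tau> (X \<sigma> r) * X' r * wt r)"
    by (rule integral_has_real_derivative_dominated(2)[where f = "\<lambda>s r. T (X s r) * wt r",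
          OF \<epsilon> meas int0 integrable_mult_right[OF zint] dom der])
qed

section \<open>Weighted Lebesgue norms along lines\<close>

lemma powr_add_le:
  fixes a b p :: real
  assumes "0 \<le> a" "0 \<le> b" "0 < p"
  shows "(a + b) powr p \<le> 2 powr p * (a powr p + b powr p)"
proof -
  have "(a + b) powr p \<le> (2 * max a b) powr p"
    using assms by (intro powr_mono2) auto
  also have "\<dots> = 2 powr p * max a b powr p" using assms by (simp add: powr_mult)
  also have "\<dots> \<le> 2 powr p * (a powr p + b powr p)"
    by (intro mult_left_mono) (auto simp: max_def)
  finally show ?thesis .
qed

lemma powr_lebpos_measurable: "(\<lambda>r. r powr b) \<in> borel_measurable lebpos"
  by (rule continuous_imp_measurable_on_sets_lebesgue) (auto intro!: continuous_intros)

lemma powr_abs_measurable: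
  assumes "f \<in> borel_measurable lebpos"
  shows "(wpow p b f) \<in> borel_measurable lebpos"
  using assms powr_lebpos_measurable[of b] by measurable

text \<open>The crude constant 2^p takes the place of Minkowski's inequality; it serves
  integrability and convergence to 0, where constants do not matter.\<close>

lemma weighted_Lp_linear:
  assumes p: "0 < p" and f: "f \<in> borel_measurable lebpos" and g: "g \<in> borel_measurable lebpos"
    and fi: "integrable lebpos (wpow p b f)"
    and gi: "integrable lebpos (wpow p b g)"
    and h: "h \<in> borel_measurable lebpos" and le: "\<And>r. \<bar>h r\<bar> \<le> \<bar>\<alpha>\<bar> * \<bar>f r\<bar> + \<bar>\<beta>\<bar> * \<bar>g r\<bar>"
  shows "integrable lebpos (wpow p b h)"
    and "(wint p b h)
      \<le> 2 powr p * (\<bar>\<alpha>\<bar> powr p * (wint p b f) + \<bar>\<beta>\<bar> powr p * (wint p b g))"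
proof -
  define D where "D = (\<lambda>r. 2 powr p * (\<bar>\<alpha>\<bar> powr p * (\<bar>f r\<bar> powr p * r powr b) + \<bar>\<beta>\<bar> powr p * (\<bar>g r\<bar> powr p * r powr b)))"
  have Di: "integrable lebpos D"
    unfolding D_def by (intro integrable_mult_right Bochner_Integration.integrable_add fi gi)
  have bd: "\<bar>h r\<bar> powr p * r powr b \<le> D r" for r
  proof -
    have "\<bar>h r\<bar> powr p \<le> (\<bar>\<alpha>\<bar> * \<bar>f r\<bar> + \<bar>\<beta>\<bar> * \<bar>g r\<bar>) powr p"
      using le p by (intro powr_mono2) auto
    also have "\<dots> \<le> 2 powr p * ((\<bar>\<alpha>\<bar> * \<bar>f r\<bar>) powr p + (\<bar>\<beta>\<bar> * \<bar>g r\<bar>) powr p)"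
      using p by (intro powr_add_le) auto
    finally have "\<bar>h r\<bar> powr p * r powr b \<le> 2 powr p * ((\<bar>\<alpha>\<bar> * \<bar>f r\<bar>) powr p + (\<bar>\<beta>\<bar> * \<bar>g r\<bar>) powr p) * r powr b"
      by (rule mult_right_mono) simp
    then show ?thesis by (simp add: D_def powr_mult algebra_simps)
  qed
  show hi: "integrable lebpos (wpow p b h)"
    by (rule Bochner_Integration.integrable_bound[OF Di powr_abs_measurable[OF h]])
      (use bd in \<open>auto intro!: AE_I2 order_trans[OF _ abs_ge_self]\<close>)
  have "(wint p b h) \<le> (LINT r|lebpos. D r)"
    by (rule integral_mono[OF hi Di bd])
  also have "\<dots> = 2 powr p * (\<bar>\<alpha>\<bar> powr p * (wint p b f) + \<bar>\<beta>\<bar> powr p * (wint p b g))"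
    unfolding D_def using fi gi by simp
  finally show "(wint p b h)
      \<le> 2 powr p * (\<bar>\<alpha>\<bar> powr p * (wint p b f) + \<bar>\<beta>\<bar> powr p * (wint p b g))" .
qed

lemma signed_powr_mono:
  assumes "0 < b" "\<bar>x\<bar> \<le> z"
  shows "\<bar>signed_powr b x\<bar> \<le> signed_powr b z"
  unfolding abs_signed_powr using assms by (auto simp: signed_powr_def sgn_if intro!: powr_mono2)

lemma weighted_Lp_line_derivative:
  assumes p: "1 < p" and f: "f \<in> borel_measurable lebpos" and g: "g \<in> borel_measurable lebpos"
    and fi: "integrable lebpos (wpow p b f)"
    and gi: "integrable lebpos (wpow p b g)"
  shows "((\<lambda>s. LINT r|lebpos. \<bar>f r + s * g r\<bar> powr p * r powr b) has_real_derivative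
      p * (LINT r|lebpos. signed_powr (p - 1) (f r + \<sigma> * g r) * g r * r powr b)) (at \<sigma>)"
    and "integrable lebpos (\<lambda>r. signed_powr (p - 1) (f r + \<sigma> * g r) * g r * r powr b)"
proof -
  \<comment> \<open>A common bound for f + s g over all s within distance 1 of \<sigma>.\<close>
  define z where "z = (\<lambda>r. \<bar>f r\<bar> + (\<bar>\<sigma>\<bar> + 1) * \<bar>g r\<bar>)"
  have zm: "z \<in> borel_measurable lebpos" unfolding z_def using f g by measurable
  have z0: "z r \<ge> 0" for r by (simp add: z_def)
  have Xm: "(\<lambda>r. f r + s * g r) \<in> borel_measurable lebpos" for s using f g by measurable
  have bd: "\<bar>f r + s * g r\<bar> \<le> z r" if "\<bar>s - \<sigma>\<bar> < 1" for s r
  proof -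
    have "\<bar>s\<bar> * \<bar>g r\<bar> \<le> (\<bar>\<sigma>\<bar> + 1) * \<bar>g r\<bar>" using that by (intro mult_right_mono) auto
    then show ?thesis unfolding z_def using abs_triangle_ineq[of "f r" "s * g r"] by (simp add: abs_mult)
  qed
  have Xd: "\<bar>(f r + s * g r) - (f r + \<sigma> * g r)\<bar> \<le> \<bar>s - \<sigma>\<bar> * (1 * z r)" for s r
  proof -
    have "\<bar>g r\<bar> \<le> z r" by (simp add: z_def algebra_simps)
    then have "\<bar>s - \<sigma>\<bar> * \<bar>g r\<bar> \<le> \<bar>s - \<sigma>\<bar> * z r" by (rule mult_left_mono) simp
    then show ?thesis by (simp add: abs_mult[symmetric] algebra_simps)
  qed
  have zi: "integrable lebpos (wpow p b z)"
    by (rule weighted_Lp_linear(1)[OF _ f g fi gi zm, where \<alpha> = 1 and \<beta> = "\<bar>\<sigma>\<bar> + 1"])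
      (use p in \<open>auto simp: z_def\<close>)
  have zint: "integrable lebpos (\<lambda>r. z r * (p * signed_powr (p - 1) (z r)) * r powr b)"
    using integrable_mult_right[OF zi, of p] mult_signed_powr[of _ "p - 1"] by (simp add: mult_ac)
  have i0: "integrable lebpos (\<lambda>r. \<bar>f r + \<sigma> * g r\<bar> powr p * r powr b)"
    by (rule weighted_Lp_linear(1)[OF _ f g fi gi Xm, where \<alpha> = 1 and \<beta> = "\<sigma>"])
      (use p in \<open>auto simp: abs_mult[symmetric] abs_triangle_ineq\<close>)
  have mono: "\<bar>p * signed_powr (p - 1) x\<bar> \<le> p * signed_powr (p - 1) y" if "\<bar>x\<bar> \<le> y" for x y
    using signed_powr_mono[of "p - 1" x y] p that by (simp add: abs_mult)
  have X': "((\<lambda>s. f r + s * g r) has_real_derivative g r) (at \<sigma>)" for r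
    by (auto intro!: derivative_eq_intros)
  note * = integral_composition_has_derivative[where T = "\<lambda>x. \<bar>x\<bar> powr p" and \<tau> = "\<lambda>x. p * signed_powr (p - 1) x"
      and M = lebpos and X = "\<lambda>s r. f r + s * g r" and X' = g and wt = "\<lambda>r. r powr b" and z = z and C = 1 and \<sigma> = \<sigma>,
      OF has_real_derivative_abs_powr[OF p] mono zero_less_one Xm powr_lebpos_measurable powr_ge_zero bd Xd X' zint i0]
  show "((\<lambda>s. LINT r|lebpos. \<bar>f r + s * g r\<bar> powr p * r powr b) has_real_derivative
      p * (LINT r|lebpos. signed_powr (p - 1) (f r + \<sigma> * g r) * g r * r powr b)) (at \<sigma>)"
    using *(1) by (simp add: mult.assoc)
  show "integrable lebpos (\<lambda>r. signed_powr (p - 1) (f r + \<sigma> * g r) * g r * r powr b)"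
    using integrable_mult_right[OF *(2), of "1 / p"] p by (simp add: mult.assoc)
qed

section \<open>The Sobolev space\<close>

lemma loc_integrable_mult_continuous:
  assumes u: "loc_integrable u" and a: "0 < a" and f: "continuous_on UNIV f" "\<And>r. r \<notin> {a..b} \<Longrightarrow> f r = 0"
  shows "integrable lebpos (\<lambda>r. u r * f r)"
proof -
  have "compact (f ` {a..b})"
    by (rule compact_continuous_image) (use f(1) continuous_on_subset in auto)
  then obtain C0 where C0: "\<And>r. r \<in> {a..b} \<Longrightarrow> \<bar>f r\<bar> \<le> C0"
    using compact_imp_bounded bounded_iff by (metis imageI real_norm_def)
  have C: "\<bar>f r\<bar> \<le> max C0 0" for r
    using C0[of r] f(2)[of r] by (cases "r \<in> {a..b}") auto
  have fm: "f \<in> borel_measurable lebpos"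
    by (rule continuous_imp_measurable_on_sets_lebesgue) (use f(1) continuous_on_subset in auto)
  have "integrable lebpos (\<lambda>r. max C0 0 * \<bar>indicator {a..b} r * u r\<bar>)"
    by (rule integrable_mult_right[OF integrable_abs[OF loc_integrable_lebpos[OF u a]]])
  then show ?thesis
  proof (rule Bochner_Integration.integrable_bound)
    show "(\<lambda>r. u r * f r) \<in> borel_measurable lebpos"
      by (rule borel_measurable_times[OF loc_integrable_measurable[OF u] fm])
    have "norm (u r * f r) \<le> max C0 0 * \<bar>indicator {a..b} r * u r\<bar>" for r
      by (intro abs_mult_le_indicator f(2) C)
    then show "AE r in lebpos. norm (u r * f r) \<le> norm (max C0 0 * \<bar>indicator {a..b} r * u r\<bar>)"
      by (intro AE_I2) (simp add: order_trans[OF _ abs_ge_self])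
  qed
qed

lemma smooth_continuous: "smooth f \<Longrightarrow> continuous_on S f"
  by (meson DERIV_isCont continuous_at_imp_continuous_on smooth_has_deriv)

lemma loc_integrable_linear:
  assumes "loc_integrable u" "loc_integrable f"
  shows "loc_integrable (\<lambda>r. \<alpha> * u r + \<beta> * f r)"
  using assms unfolding loc_integrable_def by (auto intro!: set_integral_add set_integrable_mult_right)

lemma has_weak_deriv_linear:
  assumes u: "has_weak_deriv u v" and f: "has_weak_deriv f g"
  shows "has_weak_deriv (\<lambda>r. \<alpha> * u r + \<beta> * f r) (\<lambda>r. \<alpha> * v r + \<beta> * g r)"
  unfolding has_weak_deriv_def
proof (intro conjI ballI)
  have loc: "loc_integrable u" "loc_integrable v" "loc_integrable f" "loc_integrable g"
    using u f by (auto simp: has_weak_deriv_def)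
  then show "loc_integrable (\<lambda>r. \<alpha> * u r + \<beta> * f r)" "loc_integrable (\<lambda>r. \<alpha> * v r + \<beta> * g r)"
    by (auto intro: loc_integrable_linear)
  fix \<phi> assume \<phi>: "\<phi> \<in> test_functions {0<..}"
  then obtain a b where ab: "smooth \<phi>" "0 < a" "a < b" "\<And>r. r \<notin> {a..b} \<Longrightarrow> \<phi> r = 0"
    "\<And>r. r \<notin> {a..b} \<Longrightarrow> deriv \<phi> r = 0"
    by (rule test_functionE) (rule that)
  have i: "integrable lebpos (\<lambda>r. h r * \<phi> r)" "integrable lebpos (\<lambda>r. h r * deriv \<phi> r)" if "loc_integrable h" for h
    using loc_integrable_mult_continuous[OF that ab(2) smooth_continuous[OF ab(1)] ab(4)]
      loc_integrable_mult_continuous[OF that ab(2) smooth_continuous[OF smooth_deriv[OF ab(1)]] ab(5)] by auto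
  have lin: "(LINT r|lebpos. (\<alpha> * F r + \<beta> * G r) * H r) = \<alpha> * (LINT r|lebpos. F r * H r) + \<beta> * (LINT r|lebpos. G r * H r)"
    if "integrable lebpos (\<lambda>r. F r * H r)" "integrable lebpos (\<lambda>r. G r * H r)" for F G H :: "real \<Rightarrow> real"
    using that by (simp add: distrib_right mult.assoc)
  have "(LINT r|lebpos. u r * deriv \<phi> r) = - (LINT r|lebpos. v r * \<phi> r)"
    "(LINT r|lebpos. f r * deriv \<phi> r) = - (LINT r|lebpos. g r * \<phi> r)"
    using u f \<phi> unfolding has_weak_deriv_def by auto
  then show "(LINT r|lebpos. (\<alpha> * u r + \<beta> * f r) * deriv \<phi> r) = - (LINT r|lebpos. (\<alpha> * v r + \<beta> * g r) * \<phi> r)"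
    using i loc by (simp add: lin)
qed

lemma has_weak_deriv_test:
  assumes \<phi>: "\<phi> \<in> test_functions {0<..}"
  shows "has_weak_deriv \<phi> (deriv \<phi>)"
  unfolding has_weak_deriv_def
proof (intro conjI ballI)
  have sm: "smooth \<phi>" using test_functionE[OF \<phi>] by blast
  show loc: "loc_integrable \<phi>" "loc_integrable (deriv \<phi>)"
    using sm smooth_deriv smooth_continuous loc_integrable_continuous by blast+
  fix \<psi> assume "\<psi> \<in> test_functions {0<..}"
  then obtain a b where ab: "smooth \<psi>" "0 < a" "a < b" "\<And>r. r \<notin> {a..b} \<Longrightarrow> \<psi> r = 0"
    "\<And>r. r \<notin> {a..b} \<Longrightarrow> deriv \<psi> r = 0"
    by (rule test_functionE) (rule that)
  define F where "F = (\<lambda>r. \<phi> r * deriv \<psi> r + deriv \<phi> r * \<psi> r)"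
  have i1: "integrable lebpos (\<lambda>r. \<phi> r * deriv \<psi> r)"
    by (rule loc_integrable_mult_continuous[OF loc(1) ab(2) smooth_continuous[OF smooth_deriv[OF ab(1)]] ab(5)])
  have i2: "integrable lebpos (\<lambda>r. deriv \<phi> r * \<psi> r)"
    by (rule loc_integrable_mult_continuous[OF loc(2) ab(2) smooth_continuous[OF ab(1)] ab(4)])
  have Fc: "continuous_on S F" for S
    unfolding F_def by (intro continuous_intros smooth_continuous smooth_deriv sm ab(1))
  \<comment> \<open>The interval is enlarged beyond [a, b] so that \<psi> vanishes at both of its
    ends.\<close>
  have "(F has_integral \<phi> (b + 1) * \<psi> (b + 1) - \<phi> (a / 2) * \<psi> (a / 2)) {a / 2..b + 1}"
  proof (rule fundamental_theorem_of_calculus)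
    fix x
    have "((\<lambda>r. \<phi> r * \<psi> r) has_real_derivative F x) (at x)"
      unfolding F_def by (rule DERIV_mult'[OF smooth_has_deriv[OF sm] smooth_has_deriv[OF ab(1)]])
    then show "((\<lambda>r. \<phi> r * \<psi> r) has_vector_derivative F x) (at x within {a / 2..b + 1})"
      by (simp add: has_real_derivative_iff_has_vector_derivative has_vector_derivative_at_within)
  qed (use ab in auto)
  then have "integral {a / 2..b + 1} F = 0"
    using ab(2,3) ab(4)[of "b + 1"] ab(4)[of "a / 2"] by (simp add: integral_unique)
  moreover have "(LINT r|lebpos. indicator {a / 2..b + 1} r * F r) = integral {a / 2..b + 1} F"
    by (rule LINT_lebpos_interval[OF loc_integrable_continuous[OF Fc]]) (use ab in simp)
  moreover have "indicator {a / 2..b + 1} r * F r = F r" for r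
    using ab(4)[of r] ab(5)[of r] ab(2) by (cases "r \<in> {a / 2..b + 1}") (auto simp: F_def)
  ultimately have "(LINT r|lebpos. F r) = 0" by simp
  then show "(LINT r|lebpos. \<phi> r * deriv \<psi> r) = - (LINT r|lebpos. deriv \<phi> r * \<psi> r)"
    unfolding F_def using i1 i2 by simp
qed

text \<open>Membership in the space with an explicit weak derivative, which keeps later arguments
  away from the choice in \<open>weak_deriv\<close>. \<open>X_energy\<close> is then the p-th power
  of the norm.\<close>

definition X_pair :: "real \<Rightarrow> real \<Rightarrow> (real \<Rightarrow> real) \<Rightarrow> (real \<Rightarrow> real) \<Rightarrow> bool" where
  "X_pair p a u v \<longleftrightarrow> has_weak_deriv u v \<and> integrable lebpos (wpow p a u)
     \<and> integrable lebpos (wpow p (p - 1) v)"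

definition X_energy :: "real \<Rightarrow> real \<Rightarrow> (real \<Rightarrow> real) \<Rightarrow> (real \<Rightarrow> real) \<Rightarrow> real" where
  "X_energy p a u v = (wint p (p - 1) v) + (wint p a u)"

lemma X_pair_measurable:
  assumes "X_pair p a u v"
  shows "u \<in> borel_measurable lebpos" "v \<in> borel_measurable lebpos"
  using assms loc_integrable_measurable unfolding X_pair_def has_weak_deriv_def by auto

lemma X_energy_nonneg: "0 \<le> X_energy p a u v"
  unfolding X_energy_def by (intro add_nonneg_nonneg integral_nonneg_AE) auto

lemma X_pair_imp_X_space:
  assumes "X_pair p a u v"
  shows "u \<in> X_space p a (p - 1)"
  using assms X_pair_measurable[OF assms] unfolding X_pair_def X_space_def wLp_space_def by blast

lemma X_spaceE:
  assumes "u \<in> X_space p a (p - 1)"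
  obtains v where "X_pair p a u v"
  using assms unfolding X_pair_def X_space_def wLp_space_def by blast

lemma X_norm_eq:
  assumes uv: "X_pair p a u v" and p: "0 < p"
  shows "X_norm p a (p - 1) u = X_energy p a u v powr (1 / p)"
proof -
  have hw: "has_weak_deriv u v" using uv by (simp add: X_pair_def)
  have wm: "weak_deriv u \<in> borel_measurable lebpos"
    using weak_deriv_AE_eq(2)[OF hw] loc_integrable_measurable by (auto simp: has_weak_deriv_def)
  have "(LINT r|lebpos. \<bar>weak_deriv u r\<bar> powr p * r powr (p - 1)) = (wint p (p - 1) v)"
    by (rule integral_cong_AE[OF powr_abs_measurable[OF wm] powr_abs_measurable[OF X_pair_measurable(2)[OF uv]]])
      (use weak_deriv_AE_eq(1)[OF hw] in auto)
  moreover have "(x powr (1 / p)) powr p = x" if "x \<ge> 0" for x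
    using that p by (simp add: powr_powr)
  moreover have "(wint p b f) \<ge> 0" for f b
    by (rule integral_nonneg_AE) auto
  ultimately show ?thesis
    unfolding X_norm_def wLp_norm_def X_energy_def by simp
qed

lemma X_pair_linear:
  assumes uv: "X_pair p a u v" and fg: "X_pair p a f g" and p: "0 < p"
  shows "X_pair p a (\<lambda>r. \<alpha> * u r + \<beta> * f r) (\<lambda>r. \<alpha> * v r + \<beta> * g r)"
    and "X_energy p a (\<lambda>r. \<alpha> * u r + \<beta> * f r) (\<lambda>r. \<alpha> * v r + \<beta> * g r)
      \<le> 2 powr p * (\<bar>\<alpha>\<bar> powr p * X_energy p a u v + \<bar>\<beta>\<bar> powr p * X_energy p a f g)"
proof -
  note m = X_pair_measurable[OF uv] X_pair_measurable[OF fg]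
  have i: "integrable lebpos (wpow p a u)" "integrable lebpos (wpow p (p - 1) v)"
    "integrable lebpos (wpow p a f)" "integrable lebpos (wpow p (p - 1) g)"
    using uv fg by (auto simp: X_pair_def)
  have tri: "\<bar>\<alpha> * x + \<beta> * y\<bar> \<le> \<bar>\<alpha>\<bar> * \<bar>x\<bar> + \<bar>\<beta>\<bar> * \<bar>y\<bar>" for x y
    by (simp only: abs_mult[symmetric] abs_triangle_ineq)
  have lm: "(\<lambda>r. \<alpha> * u r + \<beta> * f r) \<in> borel_measurable lebpos" "(\<lambda>r. \<alpha> * v r + \<beta> * g r) \<in> borel_measurable lebpos"
    using m by measurable
  note L1 = weighted_Lp_linear[OF p m(1) m(3) i(1) i(3) lm(1) tri]
  note L2 = weighted_Lp_linear[OF p m(2) m(4) i(2) i(4) lm(2) tri]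
  show "X_pair p a (\<lambda>r. \<alpha> * u r + \<beta> * f r) (\<lambda>r. \<alpha> * v r + \<beta> * g r)"
    using uv fg L1(1) L2(1) has_weak_deriv_linear unfolding X_pair_def by blast
  show "X_energy p a (\<lambda>r. \<alpha> * u r + \<beta> * f r) (\<lambda>r. \<alpha> * v r + \<beta> * g r)
      \<le> 2 powr p * (\<bar>\<alpha>\<bar> powr p * X_energy p a u v + \<bar>\<beta>\<bar> powr p * X_energy p a f g)"
    using add_mono[OF L2(2) L1(2)] unfolding X_energy_def by (simp add: algebra_simps)
qed

lemma X_energy_scale:
  assumes "0 \<le> m"
  shows "X_energy p a (\<lambda>r. m * u r) (\<lambda>r. m * v r) = m powr p * X_energy p a u v"
  using assms unfolding X_energy_def by (simp add: abs_mult powr_mult mult.assoc distrib_left)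

lemma integrable_compact_support:
  fixes h :: "real \<Rightarrow> real"
  assumes "0 < a" "continuous_on {0<..} h" "\<And>r. r \<notin> {a..b} \<Longrightarrow> h r = 0"
  shows "integrable lebpos h"
proof -
  have "indicator {a..b} r * h r = h r" for r using assms(3)[of r] by (cases "r \<in> {a..b}") auto
  then have "(\<lambda>r. indicator {a..b} r * h r) = h" by (rule ext)
  then show ?thesis
    using loc_integrable_lebpos[OF loc_integrable_continuous[OF assms(2)] assms(1), of b] by (simp only:)
qed

lemma X_pair_test:
  assumes \<phi>: "\<phi> \<in> test_functions {0<..}" and p: "0 < p"
  shows "X_pair p a \<phi> (deriv \<phi>)"
proof -
  obtain c d where cd: "smooth \<phi>" "0 < c" "c < d" "\<And>r. r \<notin> {c..d} \<Longrightarrow> \<phi> r = 0"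
    "\<And>r. r \<notin> {c..d} \<Longrightarrow> deriv \<phi> r = 0"
    by (rule test_functionE[OF \<phi>]) (rule that)
  have c: "continuous_on {0<..} (wpow p b h)" if "continuous_on {0<..} h" for h b
    using that p by (intro continuous_intros continuous_on_powr') auto
  have "integrable lebpos (\<lambda>r. \<bar>\<phi> r\<bar> powr p * r powr a)"
    by (rule integrable_compact_support[OF cd(2) c[OF smooth_continuous[OF cd(1)]], where b = d]) (simp add: cd(4))
  moreover have "integrable lebpos (\<lambda>r. \<bar>deriv \<phi> r\<bar> powr p * r powr (p - 1))"
    by (rule integrable_compact_support[OF cd(2) c[OF smooth_continuous[OF smooth_deriv[OF cd(1)]]], where b = d]) (simp add: cd(5))
  ultimately show ?thesis
    unfolding X_pair_def using has_weak_deriv_test[OF \<phi>] by blast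
qed

section \<open>The Pohozaev identity\<close>

text \<open>Each interval has length one for dr / r, so somewhere on it |Z| hardly exceeds its
  average. These averages tend to 0 by dominated convergence, because the intervals eventually leave
  every point.\<close>

lemma log_average_small:
  assumes h: "integrable lebpos (\<lambda>r. Z r / r)" and \<alpha>: "\<And>n::nat. 0 < \<alpha> n"
    and out: "\<And>r. 0 < r \<Longrightarrow> \<forall>\<^sub>F n in sequentially. r \<notin> {\<alpha> n..exp 1 * \<alpha> n}"
  obtains y where "\<And>n. \<alpha> n \<le> y n" "\<And>n. y n \<le> exp 1 * \<alpha> n" "(\<lambda>n. Z (y n)) \<longlonglongrightarrow> (0::real)"
proof -
  define I where "I = (\<lambda>n. LINT r|lebpos. indicator {\<alpha> n..exp 1 * \<alpha> n} r * \<bar>Z r / r\<bar>)"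
  have im: "indicat_real {\<alpha> n..exp 1 * \<alpha> n} \<in> borel_measurable lebpos" for n
    by (intro measurable_restrict_space1 borel_measurable_indicator) auto
  have habs: "integrable lebpos (\<lambda>r. \<bar>Z r / r\<bar>)" using h by (rule integrable_abs)
  have mm: "(\<lambda>r. indicator {\<alpha> n..exp 1 * \<alpha> n} r * \<bar>Z r / r\<bar>) \<in> borel_measurable lebpos" for n
    using im habs by (intro borel_measurable_times) auto
  have Iint: "integrable lebpos (\<lambda>r. indicator {\<alpha> n..exp 1 * \<alpha> n} r * \<bar>Z r / r\<bar>)" for n
    by (rule Bochner_Integration.integrable_bound[OF habs mm]) (auto intro!: AE_I2 simp: indicator_def)
  have "I \<longlonglongrightarrow> (LINT r|lebpos. 0)"
    unfolding I_def
  proof (rule integral_dominated_convergence[where w = "\<lambda>r. \<bar>Z r / r\<bar>"])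
    show "AE r in lebpos. (\<lambda>n. indicator {\<alpha> n..exp 1 * \<alpha> n} r * \<bar>Z r / r\<bar>) \<longlonglongrightarrow> 0"
    proof (rule AE_I2)
      fix r assume "r \<in> space lebpos"
      then have "\<forall>\<^sub>F n in sequentially. r \<notin> {\<alpha> n..exp 1 * \<alpha> n}" using out by simp
      then have "\<forall>\<^sub>F n in sequentially. indicator {\<alpha> n..exp 1 * \<alpha> n} r * \<bar>Z r / r\<bar> = 0"
        by (rule eventually_mono) simp
      then show "(\<lambda>n. indicator {\<alpha> n..exp 1 * \<alpha> n} r * \<bar>Z r / r\<bar>) \<longlonglongrightarrow> 0"
        by (rule tendsto_eventually)
    qed
    show "AE r in lebpos. norm (indicator {\<alpha> n..exp 1 * \<alpha> n} r * \<bar>Z r / r\<bar>) \<le> \<bar>Z r / r\<bar>" for n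
      by (auto intro!: AE_I2 simp: indicator_def)
  qed (use habs mm in auto)
  \<comment> \<open>The added 1 / (n + 1) makes the bound strictly larger than the average, so that
    |Z| cannot exceed it on the whole interval.\<close>
  then have lim: "(\<lambda>n. I n + inverse (real (Suc n))) \<longlonglongrightarrow> 0"
    using tendsto_add[OF _ LIMSEQ_inverse_real_of_nat, of I 0] by simp
  have "\<exists>y\<in>{\<alpha> n..exp 1 * \<alpha> n}. \<bar>Z y\<bar> \<le> I n + inverse (real (Suc n))" for n
  proof (rule ccontr)
    define c where "c = I n + inverse (real (Suc n))"
    assume "\<not> ?thesis"
    then have big: "c < \<bar>Z y\<bar>" if "y \<in> {\<alpha> n..exp 1 * \<alpha> n}" for y
      using that unfolding c_def by force
    have loc1: "loc_integrable (\<lambda>r. 1 / r)"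
      by (rule loc_integrable_continuous) (auto intro!: continuous_intros)
    have le: "\<alpha> n \<le> exp 1 * \<alpha> n" using \<alpha>[of n] by simp
    have "(LINT r|lebpos. indicator {\<alpha> n..exp 1 * \<alpha> n} r * (1 / r)) = 1"
      unfolding LINT_lebpos_interval[OF loc1 \<alpha>]
      using has_integral_inverse_ln[OF \<alpha> le] \<alpha>[of n] by (simp add: integral_unique)
    then have "c = (LINT r|lebpos. c * (indicator {\<alpha> n..exp 1 * \<alpha> n} r * (1 / r)))"
      by (simp only: integral_mult_right_zero mult_1_right)
    also have "\<dots> \<le> I n"
      unfolding I_def
    proof (rule integral_mono[OF _ Iint])
      show "integrable lebpos (\<lambda>r. c * (indicator {\<alpha> n..exp 1 * \<alpha> n} r * (1 / r)))"
        by (intro integrable_mult_right loc_integrable_lebpos[OF loc1 \<alpha>])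
      fix r assume "r \<in> space lebpos"
      then show "c * (indicator {\<alpha> n..exp 1 * \<alpha> n} r * (1 / r)) \<le> indicator {\<alpha> n..exp 1 * \<alpha> n} r * \<bar>Z r / r\<bar>"
        using big[of r] by (cases "r \<in> {\<alpha> n..exp 1 * \<alpha> n}") (auto intro!: divide_right_mono)
    qed
    finally show False by (simp add: c_def)
  qed
  then obtain y where y: "\<And>n. y n \<in> {\<alpha> n..exp 1 * \<alpha> n}" "\<And>n. \<bar>Z (y n)\<bar> \<le> I n + inverse (real (Suc n))"
    by metis
  have "(\<lambda>n. Z (y n)) \<longlonglongrightarrow> 0"
    by (rule Lim_null_comparison[OF _ lim]) (use y(2) in auto)
  then show ?thesis using y(1) by (intro that[of y]) auto
qed

text \<open>Integrability of Z / r gives no limits of Z at 0 or \<infinity>, but it gives points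
  tending to either end along which Z tends to 0. Integrating Z' between such points
  suffices.\<close>

lemma integral_derivative_eq_0:
  assumes d: "\<And>r. 0 < r \<Longrightarrow> (Z has_real_derivative Z' r) (at r)"
    and int': "integrable lebpos Z'" and int: "integrable lebpos (\<lambda>r. Z r / r)"
  shows "(LINT r|lebpos. Z' r) = 0"
proof -
  obtain y where y: "\<And>n. real (Suc n) \<le> y n" "(\<lambda>n. Z (y n)) \<longlonglongrightarrow> 0"
  proof (rule log_average_small[OF int, of "\<lambda>n. real (Suc n)"])
    fix r :: real
    have "\<forall>\<^sub>F n in sequentially. r < real (Suc n)" by real_asymp
    then show "\<forall>\<^sub>F n in sequentially. r \<notin> {real (Suc n)..exp 1 * real (Suc n)}"
      by (rule eventually_mono) simp
  qed (use that in auto)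
  \<comment> \<open>The factor exp (- 1) puts the right end of the interval at 1 / (n + 1), so that
    x n tends to 0.\<close>
  obtain x where x: "\<And>n. exp (- 1) / real (Suc n) \<le> x n" "\<And>n. x n \<le> exp 1 * (exp (- 1) / real (Suc n))"
    "(\<lambda>n. Z (x n)) \<longlonglongrightarrow> 0"
  proof (rule log_average_small[OF int, of "\<lambda>n. exp (- 1) / real (Suc n)"])
    fix r :: real assume "0 < r"
    then have "\<forall>\<^sub>F n in sequentially. 1 / real (Suc n) < r" by real_asymp
    then show "\<forall>\<^sub>F n in sequentially. r \<notin> {exp (- 1) / real (Suc n)..exp 1 * (exp (- 1) / real (Suc n))}"
      by (rule eventually_mono) (simp add: exp_minus)
  qed (use that in auto)
  have x': "0 < x n" "x n \<le> 1 / real (Suc n)" for n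
  proof -
    have "0 < exp (- 1) / real (Suc n)" by simp
    then show "0 < x n" using x(1)[of n] by linarith
    show "x n \<le> 1 / real (Suc n)" using x(2)[of n] by (simp add: exp_minus)
  qed
  have "1 / real (Suc n) \<le> real (Suc n)" for n by (simp add: field_simps)
  then have xy: "x n \<le> y n" for n using x'(2)[of n] y(1)[of n] by (meson order_trans)
  have im: "(\<lambda>r. indicator {x n..y n} r * Z' r) \<in> borel_measurable lebpos" for n
    by (rule borel_measurable_times[OF measurable_restrict_space1[OF borel_measurable_indicator]
          borel_measurable_integrable[OF int']]) simp
  have diff: "(LINT r|lebpos. indicator {x n..y n} r * Z' r) = Z (y n) - Z (x n)" for n
  proof -
    have hi: "(Z' has_integral Z (y n) - Z (x n)) {x n..y n}"
      by (rule fundamental_theorem_of_calculus[OF xy])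
        (use d x'(1)[of n] in \<open>auto simp: has_real_derivative_iff_has_vector_derivative[symmetric]
          intro: has_field_derivative_at_within\<close>)
    have "integrable lebpos (\<lambda>r. indicator {x n..y n} r * Z' r)"
      by (rule Bochner_Integration.integrable_bound[OF int' im]) (auto intro!: AE_I2 simp: indicator_def)
    then have "integrable lebesgue (\<lambda>r. indicator {0<..} r *\<^sub>R (indicator {x n..y n} r * Z' r))"
      by (subst (asm) integrable_restrict_space) auto
    also have "(\<lambda>r. indicator {0<..} r *\<^sub>R (indicator {x n..y n} r * Z' r)) = (\<lambda>r. indicator {x n..y n} r *\<^sub>R Z' r)"
      using x'(1)[of n] by (auto simp: indicator_def)
    finally have si: "Z' absolutely_integrable_on {x n..y n}"
      by (simp add: set_integrable_def)
    have "(LINT r|lebpos. indicator {x n..y n} r * Z' r) = (LINT r:{x n..y n}|lebesgue. Z' r)"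
      unfolding set_lebesgue_integral_def
      by (subst integral_restrict_space)
        (use x'(1)[of n] in \<open>auto simp: indicator_def intro!: Bochner_Integration.integral_cong\<close>)
    also have "\<dots> = integral {x n..y n} Z'"
      using si set_lebesgue_integral_eq_integral(2) by blast
    finally show ?thesis using hi by (simp add: integral_unique)
  qed
  have "(\<lambda>n. LINT r|lebpos. indicator {x n..y n} r * Z' r) \<longlonglongrightarrow> (LINT r|lebpos. Z' r)"
  proof (rule integral_dominated_convergence[where w = "\<lambda>r. \<bar>Z' r\<bar>"])
    show "AE r in lebpos. (\<lambda>n. indicator {x n..y n} r * Z' r) \<longlonglongrightarrow> Z' r"
    proof (rule AE_I2)
      fix r assume "r \<in> space lebpos"
      then have "r > 0" by simp
      then have "\<forall>\<^sub>F n in sequentially. 1 / real (Suc n) < r" by real_asymp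
      moreover have "\<forall>\<^sub>F n in sequentially. r < real (Suc n)" by real_asymp
      ultimately have "\<forall>\<^sub>F n in sequentially. indicator {x n..y n} r * Z' r = Z' r"
      proof eventually_elim
        case (elim n)
        then have "r \<in> {x n..y n}" using x'(2)[of n] y(1)[of n] by auto
        then show ?case by simp
      qed
      then show "(\<lambda>n. indicator {x n..y n} r * Z' r) \<longlonglongrightarrow> Z' r" by (rule tendsto_eventually)
    qed
    show "AE r in lebpos. norm (indicator {x n..y n} r * Z' r) \<le> \<bar>Z' r\<bar>" for n
      by (auto intro!: AE_I2 simp: indicator_def)
  qed (use int' im in auto)
  moreover have "(\<lambda>n. LINT r|lebpos. indicator {x n..y n} r * Z' r) \<longlonglongrightarrow> 0"
    unfolding diff using tendsto_diff[OF y(2) x(3)] by simp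
  ultimately show ?thesis by (rule LIMSEQ_unique)
qed

lemma is_primitive_has_derivative:
  assumes prim: "is_primitive w k" and k: "continuous_on {0<..} k" and r: "0 < r"
  shows "(w has_real_derivative k r) (at r)"
proof -
  have "continuous_on {r/2..r+1} k" by (rule continuous_on_subset[OF k]) (use r in auto)
  then have "((\<lambda>x. integral {r/2..x} k) has_real_derivative k r) (at r within {r/2..r+1})"
    by (rule integral_has_real_derivative) (use r in auto)
  then have "((\<lambda>x. integral {r/2..x} k) has_real_derivative k r) (at r)"
    using r by (simp add: at_within_Icc_at)
  then have "((\<lambda>x. w (r/2) + integral {r/2..x} k) has_real_derivative k r) (at r)"
    by (auto intro!: derivative_eq_intros)
  then show ?thesis
  proof (rule has_field_derivative_transform_within_open[OF _ open_greaterThan[of "r/2"]])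
    fix x assume "x \<in> {r/2<..}"
    then have "w x - w (r/2) = integral {r/2..x} k" using prim r by (simp add: is_primitive_def)
    then show "w (r/2) + integral {r/2..x} k = w x" by simp
  qed (use r in simp)
qed

lemma is_primitive_cong_AE:
  assumes "is_primitive w v" "AE r in lebpos. v r = v' r" "loc_integrable v'"
  shows "is_primitive w v'"
proof -
  obtain N where N: "negligible N" "\<And>r. r > 0 \<Longrightarrow> r \<notin> N \<Longrightarrow> v r = v' r"
    using assms(2) unfolding AE_lebpos_iff_negligible by blast
  have "integral {c..d} v = integral {c..d} v'" if "0 < c" for c d
    by (rule integral_spike[OF N(1)]) (use N(2) that in force)
  then show ?thesis using assms(1,3) unfolding is_primitive_def by simp
qed

text \<open>Weak solutions of \<open>-(r\<^sup>p\<^sup>-\<^sup>1|u'|\<^sup>p\<^sup>-\<^sup>2u')' = f(u)r\<^sup>a\<close> are classical, and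
  \<open>|W|\<^sup>q/q + r\<^sup>a\<^sup>+\<^sup>1\<Psi>(u)\<close> with \<open>W = r\<^sup>p\<^sup>-\<^sup>1|u'|\<^sup>p\<^sup>-\<^sup>2u'\<close> has derivative \<open>(a+1)r\<^sup>a\<Psi>(u)\<close>
  because the terms containing \<open>f(u)u'\<close> cancel.\<close>

theorem pohozaev_identity:
  assumes p: "1 < p" and a: "-1 < a" and prim: "is_primitive u v"
    and f: "continuous_on UNIV f" and \<Psi>: "\<And>x. (\<Psi> has_real_derivative f x) (at x)"
    and weak: "has_weak_deriv (\<lambda>r. signed_powr (p - 1) (v r) * r powr (p - 1)) (\<lambda>r. - (f (u r) * r powr a))"
    and iv: "integrable lebpos (wpow p (p - 1) v)"
    and i\<Psi>: "integrable lebpos (\<lambda>r. \<Psi> (u r) * r powr a)"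
  shows "(LINT r|lebpos. \<Psi> (u r) * r powr a) = 0"
proof -
  define q where "q = conj_exp p"
  have q: "q > 1" "q - 1 = 1 / (p - 1)" "(p - 1) * (1 / (p - 1)) = 1" "(p - 1) * q = p"
    using p by (auto simp: q_def field_simps)
  obtain W where W: "is_primitive W (\<lambda>r. - (f (u r) * r powr a))"
    and Wv: "AE r in lebpos. signed_powr (p - 1) (v r) * r powr (p - 1) = W r"
    using has_weak_deriv_imp_primitive[OF weak] by blast
  have uc: "continuous_on {0<..} u" by (rule is_primitive_continuous[OF prim])
  have Wc: "continuous_on {0<..} W" by (rule is_primitive_continuous[OF W])
  \<comment> \<open>The flux relation solved for the derivative: |v|^(p-2) v r^(p-1) = W inverts to
    v = |W|^(q-2) W / r. The continuity of W then makes u continuously differentiable.\<close>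
  define v' where "v' = (\<lambda>r. signed_powr (q - 1) (W r) / r)"
  have v'c: "continuous_on {0<..} v'"
    unfolding v'_def using q(1) by (intro continuous_intros Wc) auto
  have vv: "v r = signed_powr (q - 1) (signed_powr (p - 1) (v r) * r powr (p - 1)) / r" if "r > 0" for r
  proof -
    have "signed_powr (q - 1) (signed_powr (p - 1) (v r) * r powr (p - 1)) = v r * r"
      using that q by (simp add: signed_powr_mult_pos signed_powr_signed_powr powr_powr signed_powr_1)
    then show ?thesis using that by simp
  qed
  have "AE r in lebpos. v r = v' r"
    using Wv AE_space
  proof eventually_elim
    case (elim r)
    then show ?case using vv[of r] unfolding v'_def by simp
  qed
  then have prim': "is_primitive u v'"
    by (rule is_primitive_cong_AE[OF prim _ loc_integrable_continuous[OF v'c]])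
  have ud: "(u has_real_derivative v' r) (at r)" if "r > 0" for r
    by (rule is_primitive_has_derivative[OF prim' v'c that])
  have fu: "continuous_on {0<..} (\<lambda>r. f (u r))"
    using continuous_on_compose2[OF f uc] by simp
  have Wd: "(W has_real_derivative - (f (u r) * r powr a)) (at r)" if "r > 0" for r
    by (rule is_primitive_has_derivative[OF W _ that]) (intro continuous_intros fu, auto)
  define Z where "Z = (\<lambda>r. \<bar>W r\<bar> powr q / q + r powr (a + 1) * \<Psi> (u r))"
  have Zd: "(Z has_real_derivative (a + 1) * (\<Psi> (u r) * r powr a)) (at r)" if r: "r > 0" for r
  proof -
    have "((\<lambda>r. \<bar>W r\<bar> powr q) has_real_derivative q * signed_powr (q - 1) (W r) * (- (f (u r) * r powr a))) (at r)"
      by (rule DERIV_chain2[OF has_real_derivative_abs_powr[OF q(1)] Wd[OF r]])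
    then have 1: "((\<lambda>r. \<bar>W r\<bar> powr q / q) has_real_derivative q * signed_powr (q - 1) (W r) * (- (f (u r) * r powr a)) / q) (at r)"
      by (rule DERIV_cdivide)
    have 2: "((\<lambda>r. r powr (a + 1) * \<Psi> (u r)) has_real_derivative
        r powr (a + 1) * (f (u r) * v' r) + ((a + 1) * r powr a) * \<Psi> (u r)) (at r)"
      by (rule DERIV_mult'[OF _ DERIV_chain2[OF \<Psi> ud[OF r]]])
        (use r in \<open>auto intro!: derivative_eq_intros\<close>)
    have e: "q * signed_powr (q - 1) (W r) * (- (f (u r) * r powr a)) / q
        + (r powr (a + 1) * (f (u r) * v' r) + ((a + 1) * r powr a) * \<Psi> (u r)) = (a + 1) * (\<Psi> (u r) * r powr a)"
    proof -
      have "q * signed_powr (q - 1) (W r) * (- (f (u r) * r powr a)) / q = - (v' r * r) * (f (u r) * r powr a)"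
        using r q(1) by (simp add: v'_def)
      moreover have "r powr (a + 1) = r * r powr a" using r by (simp add: powr_add)
      ultimately show ?thesis by (simp add: algebra_simps)
    qed
    from DERIV_add[OF 1 2] show ?thesis unfolding e Z_def .
  qed
  \<comment> \<open>Almost everywhere |W|^q = |v|^p r^p, so this is the gradient density in terms of
    the flux. It yields the integrability of Z / r.\<close>
  have iW: "integrable lebpos (\<lambda>r. \<bar>W r\<bar> powr q / r)"
  proof -
    have Wm: "(\<lambda>r. \<bar>W r\<bar> powr q / r) \<in> borel_measurable lebpos"
      by (rule continuous_imp_measurable_on_sets_lebesgue)
        (use q(1) in \<open>auto intro!: continuous_intros continuous_on_powr' Wc\<close>)
    have "AE r in lebpos. \<bar>v r\<bar> powr p * r powr (p - 1) = \<bar>W r\<bar> powr q / r"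
      using Wv AE_space
    proof eventually_elim
      case (elim r)
      then have r: "r > 0" by simp
      have "\<bar>W r\<bar> = \<bar>v r\<bar> powr (p - 1) * r powr (p - 1)"
        unfolding elim(1)[symmetric] by (simp add: abs_mult abs_signed_powr)
      then have "\<bar>W r\<bar> powr q = \<bar>v r\<bar> powr p * r powr p"
        using q(4) by (simp add: powr_mult powr_powr)
      then show ?case using r by (simp add: powr_diff)
    qed
    from integrable_cong_AE[OF borel_measurable_integrable[OF iv] Wm this] iv
    show ?thesis by (simp only:)
  qed
  have "integrable lebpos (\<lambda>r. (1 / q) * (\<bar>W r\<bar> powr q / r) + \<Psi> (u r) * r powr a)"
    by (intro Bochner_Integration.integrable_add integrable_mult_right iW i\<Psi>)
  also have "integrable lebpos (\<lambda>r. (1 / q) * (\<bar>W r\<bar> powr q / r) + \<Psi> (u r) * r powr a) = integrable lebpos (\<lambda>r. Z r / r)"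
    by (rule Bochner_Integration.integrable_cong) (auto simp: Z_def powr_add field_simps)
  finally have "(LINT r|lebpos. (a + 1) * (\<Psi> (u r) * r powr a)) = 0"
    by (intro integral_derivative_eq_0[OF Zd integrable_mult_right[OF i\<Psi>]]) auto
  then show ?thesis using a by simp
qed

section \<open>Curves on the sphere and critical points\<close>

text \<open>One p-th of the derivative of \<open>X_energy\<close> at (u, v) in the direction (f,
  g).\<close>

definition X_pairing :: "real \<Rightarrow> real \<Rightarrow> (real \<Rightarrow> real) \<Rightarrow> (real \<Rightarrow> real) \<Rightarrow> (real \<Rightarrow> real) \<Rightarrow> (real \<Rightarrow> real) \<Rightarrow> real" where
  "X_pairing p a u v f g = (LINT r|lebpos. signed_powr (p - 1) (v r) * g r * r powr (p - 1))
    + (LINT r|lebpos. signed_powr (p - 1) (u r) * f r * r powr a)"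

lemma X_energy_line_derivative:
  assumes p: "1 < p" and uv: "X_pair p a u v" and fg: "X_pair p a f g"
  shows "((\<lambda>s. X_energy p a (\<lambda>r. u r + s * f r) (\<lambda>r. v r + s * g r)) has_real_derivative
    p * X_pairing p a (\<lambda>r. u r + \<sigma> * f r) (\<lambda>r. v r + \<sigma> * g r) f g) (at \<sigma>)"
proof -
  note m = X_pair_measurable[OF uv] X_pair_measurable[OF fg]
  have i: "integrable lebpos (wpow p a u)" "integrable lebpos (wpow p (p - 1) v)"
    "integrable lebpos (wpow p a f)" "integrable lebpos (wpow p (p - 1) g)"
    using uv fg by (auto simp: X_pair_def)
  show ?thesis
    unfolding X_energy_def X_pairing_def distrib_left
    by (rule DERIV_add[OF weighted_Lp_line_derivative(1)[OF p m(2) m(4) i(2) i(4)]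
          weighted_Lp_line_derivative(1)[OF p m(1) m(3) i(1) i(3)]])
qed

text \<open>The line u + s f is projected radially, with m(s) = N(s)^(-1/p) for N the energy along
  the line. As N(0) = 1 and N'(0) is p times the pairing, m'(0) is minus the pairing.\<close>

lemma sphere_curve:
  assumes p: "1 < p" and uv: "X_pair p a u v" and one: "X_energy p a u v = 1" and fg: "X_pair p a f g"
  obtains m where "m 0 = 1" "(m has_real_derivative - X_pairing p a u v f g) (at 0)"
    "diff_curve_through p a (p - 1) (X_sphere p a (p - 1)) u (\<lambda>s r. m s * (u r + s * f r))"
proof -
  define N where "N = (\<lambda>s. X_energy p a (\<lambda>r. u r + s * f r) (\<lambda>r. v r + s * g r))"
  define m where "m = (\<lambda>s. N s powr (- 1 / p))"
  have Nd: "\<exists>D. (N has_real_derivative D) (at s)" for s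
    using X_energy_line_derivative[OF p uv fg] unfolding N_def by blast
  have N0: "N 0 = 1" using one by (simp add: N_def)
  have "isCont N 0" using Nd DERIV_isCont by blast
  then have "\<forall>\<^sub>F s in at 0. 1 / 2 < N s"
    by (intro order_tendstoD(1)[of N 1]) (auto simp: isCont_def N0)
  then obtain \<epsilon> where \<epsilon>: "\<epsilon> > 0" "\<And>s. s \<noteq> 0 \<Longrightarrow> \<bar>s\<bar> < \<epsilon> \<Longrightarrow> 1 / 2 < N s"
    unfolding eventually_at by (auto simp: dist_real_def)
  have Npos: "N s > 0" if "\<bar>s\<bar> < \<epsilon>" for s
    using \<epsilon>(2)[of s] that N0 by (cases "s = 0") auto
  have md: "(m has_real_derivative - 1 / p * N s powr (- 1 / p - 1) * D) (at s)"
    if "\<bar>s\<bar> < \<epsilon>" "(N has_real_derivative D) (at s)" for s D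
    unfolding m_def
    by (rule DERIV_chain2[where f = "\<lambda>x. x powr (- 1 / p)", OF _ that(2)])
      (use Npos[OF that(1)] in \<open>auto intro!: derivative_eq_intros\<close>)
  have m0: "m 0 = 1" by (simp add: m_def N0)
  have "(N has_real_derivative p * X_pairing p a u v f g) (at 0)"
    using X_energy_line_derivative[OF p uv fg, of 0] by (simp add: N_def)
  from md[OF _ this] have m0d: "(m has_real_derivative - X_pairing p a u v f g) (at 0)"
    using \<epsilon>(1) N0 p by simp
  have p0: "0 < p" using p by simp
  have pr: "X_pair p a (\<lambda>r. u r + s * f r) (\<lambda>r. v r + s * g r)" for s
    using X_pair_linear(1)[OF uv fg p0, of 1 s] by simp
  have pm: "X_pair p a (\<lambda>r. c * (u r + s * f r)) (\<lambda>r. c * (v r + s * g r))" for c s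
    using X_pair_linear(1)[OF pr fg p0, of c s 0] by simp
  have sphere: "(\<lambda>r. m s * (u r + s * f r)) \<in> X_sphere p a (p - 1)" if "\<bar>s\<bar> < \<epsilon>" for s
  proof -
    have "X_energy p a (\<lambda>r. m s * (u r + s * f r)) (\<lambda>r. m s * (v r + s * g r)) = m s powr p * N s"
      unfolding N_def by (rule X_energy_scale) (simp add: m_def)
    also have "m s powr p = N s powr (- 1 / p * p)"
      by (simp only: m_def powr_powr)
    also have "\<dots> * N s = 1"
      using Npos[OF that] p by (simp add: powr_neg_one)
    finally have "X_norm p a (p - 1) (\<lambda>r. m s * (u r + s * f r)) = 1"
      using X_norm_eq[OF pm p0] by simp
    then show ?thesis
      using X_pair_imp_X_space[OF pm] unfolding X_sphere_def by simp
  qed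
  have deriv: "\<exists>w. has_X_derivative p a (p - 1) (\<lambda>s r. m s * (u r + s * f r)) w s" if s: "\<bar>s\<bar> < \<epsilon>" for s
  proof -
    obtain m' where m': "(m has_real_derivative m') (at s)" using md[OF s] Nd by blast
    define w where "w = (\<lambda>r. m' * (u r + s * f r) + m s * f r)"
    \<comment> \<open>The error of the difference quotient is exactly A(h) (u + s f) + B(h) f: A is
      the error for m itself, B measures its continuity. Both scalars tend to 0, and the fixed
      functions have finite energy.\<close>
    define A where "A = (\<lambda>h. (m (s + h) - m s) / h - m')"
    define B where "B = (\<lambda>h. m (s + h) - m s)"
    have A0: "A \<midarrow>0\<rightarrow> 0"
      using m' unfolding A_def DERIV_def by (simp add: LIM_zero)
    have "isCont m s" using m' DERIV_isCont by blast
    then have B0: "B \<midarrow>0\<rightarrow> 0"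
      unfolding B_def isCont_iff by (simp add: LIM_zero)
    have wX: "w \<in> X_space p a (p - 1)"
      unfolding w_def by (rule X_pair_imp_X_space[OF X_pair_linear(1)[OF pr fg p0]])
    define E1 where "E1 = X_energy p a (\<lambda>r. u r + s * f r) (\<lambda>r. v r + s * g r)"
    define E2 where "E2 = X_energy p a f g"
    have le: "X_norm p a (p - 1) (\<lambda>r. (m (s + h) * (u r + (s + h) * f r) - m s * (u r + s * f r)) / h - w r)
        \<le> (2 powr p * (\<bar>A h\<bar> powr p * E1 + \<bar>B h\<bar> powr p * E2)) powr (1 / p)" if h: "h \<noteq> 0" for h
    proof -
      have "(\<lambda>r. (m (s + h) * (u r + (s + h) * f r) - m s * (u r + s * f r)) / h - w r)
          = (\<lambda>r. A h * (u r + s * f r) + B h * f r)"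
        using h by (auto simp: A_def B_def w_def field_simps)
      moreover have "X_norm p a (p - 1) (\<lambda>r. A h * (u r + s * f r) + B h * f r)
          \<le> (2 powr p * (\<bar>A h\<bar> powr p * E1 + \<bar>B h\<bar> powr p * E2)) powr (1 / p)"
        unfolding X_norm_eq[OF X_pair_linear(1)[OF pr fg p0] p0] E1_def E2_def
        using X_pair_linear(2)[OF pr fg p0] X_energy_nonneg p0 by (intro powr_mono2) auto
      ultimately show ?thesis by simp
    qed
    have nn: "0 \<le> X_norm p a (p - 1) h" for h by (simp add: X_norm_def)
    have "((\<lambda>h. X_norm p a (p - 1) (\<lambda>r. (m (s + h) * (u r + (s + h) * f r) - m s * (u r + s * f r)) / h - w r)) \<longlongrightarrow> 0) (at 0)"
    proof (rule Lim_null_comparison)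
      show "\<forall>\<^sub>F h in at 0. norm (X_norm p a (p - 1) (\<lambda>r. (m (s + h) * (u r + (s + h) * f r) - m s * (u r + s * f r)) / h - w r))
          \<le> (2 powr p * (\<bar>A h\<bar> powr p * E1 + \<bar>B h\<bar> powr p * E2)) powr (1 / p)"
        using le nn by (auto simp: eventually_at intro!: exI[of _ 1])
      have "((\<lambda>h. (2 powr p * (\<bar>A h\<bar> powr p * E1 + \<bar>B h\<bar> powr p * E2)) powr (1 / p)) \<longlongrightarrow>
          (2 powr p * (\<bar>0\<bar> powr p * E1 + \<bar>0\<bar> powr p * E2)) powr (1 / p)) (at 0)"
        using p0 X_energy_nonneg
        by (intro tendsto_powr' tendsto_intros A0 B0) (auto simp: E1_def E2_def intro!: always_eventually add_nonneg_nonneg)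
      then show "((\<lambda>h. (2 powr p * (\<bar>A h\<bar> powr p * E1 + \<bar>B h\<bar> powr p * E2)) powr (1 / p)) \<longlongrightarrow> 0) (at 0)"
        by simp
    qed
    then show ?thesis using wX unfolding has_X_derivative_def by blast
  qed
  have "diff_curve_through p a (p - 1) (X_sphere p a (p - 1)) u (\<lambda>s r. m s * (u r + s * f r))"
    unfolding diff_curve_through_def
  proof (intro conjI exI[of _ \<epsilon>] ballI \<epsilon>(1))
    show "(\<lambda>r. m 0 * (u r + 0 * f r)) = u" by (simp add: m0)
    fix s assume "s \<in> {- \<epsilon><..<\<epsilon>}"
    then have "\<bar>s\<bar> < \<epsilon>" by auto
    then show "(\<lambda>r. m s * (u r + s * f r)) \<in> X_sphere p a (p - 1)"
      "\<exists>w. has_X_derivative p a (p - 1) (\<lambda>s r. m s * (u r + s * f r)) w s"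
      by (rule sphere, rule deriv)
  qed
  then show ?thesis using that m0 m0d by blast
qed

section \<open>Differentiating the functional along curves on the sphere\<close>

lemma exp_growth_nonneg: "0 \<le> exp_growth p \<mu> x"
  by (simp add: exp_growth_def)

lemma exp_growth_scale:
  assumes p: "1 < p" and c: "0 < c" and "\<mu> * c powr conj_exp p \<le> \<mu>0"
  shows "exp_growth p \<mu> (c * x) \<le> c powr (p + conj_exp p) * exp_growth p \<mu>0 x"
proof -
  have "\<mu> * \<bar>c * x\<bar> powr conj_exp p = (\<mu> * c powr conj_exp p) * \<bar>x\<bar> powr conj_exp p"
    using c by (simp add: abs_mult powr_mult)
  also have "\<dots> \<le> \<mu>0 * \<bar>x\<bar> powr conj_exp p"
    using assms(3) by (rule mult_right_mono) simp
  finally have "\<bar>c * x\<bar> powr (p + conj_exp p) * exp (\<mu> * \<bar>c * x\<bar> powr conj_exp p)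
      \<le> \<bar>c * x\<bar> powr (p + conj_exp p) * exp (\<mu>0 * \<bar>x\<bar> powr conj_exp p)"
    by (intro mult_left_mono) auto
  also have "\<dots> = c powr (p + conj_exp p) * exp_growth p \<mu>0 x"
    using c by (simp add: exp_growth_def abs_mult powr_mult)
  finally show ?thesis by (simp add: exp_growth_def)
qed

lemma exp_growth_measurable [measurable]: "exp_growth p \<mu> \<in> borel_measurable borel"
  unfolding exp_growth_def by measurable

lemma exp_growth_continuous:
  "1 < p \<Longrightarrow> continuous_on S f \<Longrightarrow> continuous_on S (\<lambda>x. exp_growth p \<mu> (f x))"
  unfolding exp_growth_def by (intro continuous_intros continuous_on_powr') (auto simp: add_pos_pos)

lemma TM_density_measurable:
  assumes "1 < p" "0 < \<mu>"
  shows "TM_density p \<mu> \<in> borel_measurable borel" "TM_slope p \<mu> \<in> borel_measurable borel"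
  using TM_density_continuous[OF assms, of UNIV "\<lambda>x. x"] TM_slope_continuous[OF assms, of UNIV "\<lambda>x. x"]
  by (auto intro!: borel_measurable_continuous_onI)

lemma weighted_comp_measurable:
  assumes "T \<in> borel_measurable borel" "f \<in> borel_measurable lebpos"
  shows "(\<lambda>r. T (f r) * r powr b) \<in> borel_measurable lebpos"
  by (rule borel_measurable_times[OF measurable_compose[OF assms(2,1)] powr_lebpos_measurable])

lemma TM_density_integrable:
  assumes p: "1 < p" and \<mu>: "0 < \<mu>" and um: "u \<in> borel_measurable lebpos"
    and up: "integrable lebpos (wpow p a u)"
    and ue: "integrable lebpos (\<lambda>r. exp_growth p \<mu> (u r) * r powr a)"
  shows "integrable lebpos (\<lambda>r. TM_density p \<mu> (u r) * r powr a)"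
    and "integrable lebpos (\<lambda>r. u r * TM_slope p \<mu> (u r) * r powr a)"
proof -
  define c where "c = \<mu> powr (p - 1) / Gamma p"
  have c: "c > 0" using Gamma_p_pos[OF p] \<mu> by (simp add: c_def)
  have "integrable lebpos (\<lambda>r. c * (\<bar>u r\<bar> powr p * r powr a) + c * \<mu> * (exp_growth p \<mu> (u r) * r powr a))"
    by (intro Bochner_Integration.integrable_add integrable_mult_right up ue)
  then show "integrable lebpos (\<lambda>r. TM_density p \<mu> (u r) * r powr a)"
  proof (rule Bochner_Integration.integrable_bound)
    show "(\<lambda>r. TM_density p \<mu> (u r) * r powr a) \<in> borel_measurable lebpos"
      by (rule weighted_comp_measurable[OF TM_density_measurable(1)[OF p \<mu>] um])
    have "TM_density p \<mu> (u r) * r powr a \<le> c * (\<bar>u r\<bar> powr p * r powr a) + c * \<mu> * (exp_growth p \<mu> (u r) * r powr a)" for r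
      using mult_right_mono[OF TM_density_le_growth[OF p \<mu>, of "u r"], of "r powr a"]
      by (simp add: c_def[symmetric] algebra_simps)
    then show "AE r in lebpos. norm (TM_density p \<mu> (u r) * r powr a)
        \<le> norm (c * (\<bar>u r\<bar> powr p * r powr a) + c * \<mu> * (exp_growth p \<mu> (u r) * r powr a))"
      using TM_density_nonneg[OF p \<mu>] by (intro AE_I2) (auto intro: order_trans[OF _ abs_ge_self])
  qed
  define d where "d = conj_exp p * \<mu> powr p / Gamma p"
  have "integrable lebpos (\<lambda>r. p * c * (\<bar>u r\<bar> powr p * r powr a) + d * (exp_growth p \<mu> (u r) * r powr a))"
    by (intro Bochner_Integration.integrable_add integrable_mult_right up ue)
  then show "integrable lebpos (\<lambda>r. u r * TM_slope p \<mu> (u r) * r powr a)"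
  proof (rule Bochner_Integration.integrable_bound)
    show "(\<lambda>r. u r * TM_slope p \<mu> (u r) * r powr a) \<in> borel_measurable lebpos"
      by (intro borel_measurable_times um measurable_compose[OF um TM_density_measurable(2)[OF p \<mu>]] powr_lebpos_measurable)
    have nn: "0 \<le> x * TM_slope p \<mu> x" for x
      unfolding mult_TM_slope[OF p \<mu>] using TM_density_nonneg[OF p \<mu>] p \<mu> Gamma_p_pos[OF p] by auto
    have "u r * TM_slope p \<mu> (u r) * r powr a \<le> p * c * (\<bar>u r\<bar> powr p * r powr a) + d * (exp_growth p \<mu> (u r) * r powr a)" for r
      using mult_right_mono[OF TM_slope_growth[OF p \<mu>, of "u r"], of "r powr a"]
      by (simp add: c_def d_def algebra_simps)
    then show "AE r in lebpos. norm (u r * TM_slope p \<mu> (u r) * r powr a)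
        \<le> norm (p * c * (\<bar>u r\<bar> powr p * r powr a) + d * (exp_growth p \<mu> (u r) * r powr a))"
      using nn by (intro AE_I2) (auto simp: abs_mult[of _ "_ powr _"] intro: order_trans[OF _ abs_ge_self])
  qed
qed

text \<open>If the integral diverges, both sides take the default value 0.\<close>

lemma TM_functional_eq_integral:
  assumes "1 < p" "0 < \<mu>" and um: "u \<in> borel_measurable lebpos"
  shows "enn2real (TM_functional p a \<mu> u) = (LINT r|lebpos. TM_density p \<mu> (u r) * r powr a)"
proof -
  have "(LINT r|lebpos. TM_density p \<mu> (u r) * r powr a)
      = enn2real (\<integral>\<^sup>+ r. ennreal (TM_density p \<mu> (u r) * r powr a) \<partial>lebpos)"
    by (rule integral_eq_nn_integral[OF weighted_comp_measurable[OF TM_density_measurable(1)[OF assms(1,2)] um]])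
      (use TM_density_nonneg[OF assms(1,2)] in auto)
  then show ?thesis unfolding TM_functional_def TM_density_def[OF assms(1,2)] by simp
qed

text \<open>Near s = 0 the curve stays below z = 2 (|u| + |\<phi>|) \<le> 4 max(|u|, |\<phi>|).
  Where |u| dominates, the room between \<mu> and \<mu>0 absorbs the 4; where |\<phi>| dominates,
  compact support does. This is the origin of \<open>4 powr conj_exp p\<close>.\<close>

lemma TM_curve_derivative:
  assumes p: "1 < p" and \<mu>: "0 < \<mu>" and um: "u \<in> borel_measurable lebpos"
    and up: "integrable lebpos (wpow p a u)"
    and ue: "integrable lebpos (\<lambda>r. exp_growth p \<mu>0 (u r) * r powr a)" and \<mu>0: "\<mu> * 4 powr conj_exp p \<le> \<mu>0"
    and \<phi>: "\<phi> \<in> test_functions {0<..}" and m0: "m 0 = 1" and md: "(m has_real_derivative d) (at 0)"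
  shows "((\<lambda>s. LINT r|lebpos. TM_density p \<mu> (m s * (u r + s * \<phi> r)) * r powr a) has_real_derivative
      (LINT r|lebpos. TM_slope p \<mu> (u r) * (d * u r + \<phi> r) * r powr a)) (at 0)"
    and "integrable lebpos (\<lambda>r. TM_slope p \<mu> (u r) * (d * u r + \<phi> r) * r powr a)"
proof -
  obtain c e where ce: "smooth \<phi>" "0 < c" "c < e" "\<And>r. r \<notin> {c..e} \<Longrightarrow> \<phi> r = 0"
    "\<And>r. r \<notin> {c..e} \<Longrightarrow> deriv \<phi> r = 0"
    by (rule test_functionE[OF \<phi>]) (rule that)
  have \<phi>p: "X_pair p a \<phi> (deriv \<phi>)" by (rule X_pair_test[OF \<phi>]) (use p in simp)
  note \<phi>m = X_pair_measurable(1)[OF \<phi>p]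
  define z where "z = (\<lambda>r. 2 * (\<bar>u r\<bar> + \<bar>\<phi> r\<bar>))"
  have zm: "z \<in> borel_measurable lebpos" unfolding z_def using um \<phi>m by measurable
  have zp: "integrable lebpos (wpow p a z)"
    by (rule weighted_Lp_linear(1)[OF _ um \<phi>m up _ zm, where \<alpha> = 2 and \<beta> = 2])
      (use p \<phi>p in \<open>auto simp: z_def X_pair_def\<close>)
  have \<phi>e: "integrable lebpos (\<lambda>r. exp_growth p \<mu> (4 * \<phi> r) * r powr a)"
  proof (rule integrable_compact_support[OF ce(2)])
    show "continuous_on {0<..} (\<lambda>r. exp_growth p \<mu> (4 * \<phi> r) * r powr a)"
      by (intro continuous_intros exp_growth_continuous[OF p] smooth_continuous[OF ce(1)]) auto
    show "exp_growth p \<mu> (4 * \<phi> r) * r powr a = 0" if "r \<notin> {c..e}" for r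
      using ce(4)[OF that] by (simp add: exp_growth_def)
  qed
  have "integrable lebpos (\<lambda>r. 4 powr (p + conj_exp p) * (exp_growth p \<mu>0 (u r) * r powr a) + exp_growth p \<mu> (4 * \<phi> r) * r powr a)"
    by (intro Bochner_Integration.integrable_add integrable_mult_right ue \<phi>e)
  then have ze: "integrable lebpos (\<lambda>r. exp_growth p \<mu> (z r) * r powr a)"
  proof (rule Bochner_Integration.integrable_bound)
    show "(\<lambda>r. exp_growth p \<mu> (z r) * r powr a) \<in> borel_measurable lebpos"
      by (rule weighted_comp_measurable[OF exp_growth_measurable zm])
    have "exp_growth p \<mu> (z r) \<le> 4 powr (p + conj_exp p) * exp_growth p \<mu>0 (u r) + exp_growth p \<mu> (4 * \<phi> r)" for r
    proof (cases "\<bar>\<phi> r\<bar> \<le> \<bar>u r\<bar>")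
      case True
      then have "exp_growth p \<mu> (z r) \<le> exp_growth p \<mu> (4 * u r)"
        using p \<mu> by (intro exp_growth_mono) (auto simp: z_def)
      also have "\<dots> \<le> 4 powr (p + conj_exp p) * exp_growth p \<mu>0 (u r)"
        by (rule exp_growth_scale[OF p _ \<mu>0]) simp
      finally show ?thesis using exp_growth_nonneg[of p \<mu> "4 * \<phi> r"] by linarith
    next
      case False
      then have "exp_growth p \<mu> (z r) \<le> exp_growth p \<mu> (4 * \<phi> r)"
        using p \<mu> by (intro exp_growth_mono) (auto simp: z_def)
      moreover have "0 \<le> 4 powr (p + conj_exp p) * exp_growth p \<mu>0 (u r)"
        by (intro mult_nonneg_nonneg exp_growth_nonneg) simp
      ultimately show ?thesis by linarith
    qed
    then have "exp_growth p \<mu> (z r) * r powr a \<le> (4 powr (p + conj_exp p) * exp_growth p \<mu>0 (u r) + exp_growth p \<mu> (4 * \<phi> r)) * r powr a" for r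
      by (rule mult_right_mono) simp
    then show "AE r in lebpos. norm (exp_growth p \<mu> (z r) * r powr a)
        \<le> norm (4 powr (p + conj_exp p) * (exp_growth p \<mu>0 (u r) * r powr a) + exp_growth p \<mu> (4 * \<phi> r) * r powr a)"
      by (intro AE_I2 order_trans[OF _ abs_ge_self[of "_ + _", folded real_norm_def]])
        (simp add: exp_growth_nonneg distrib_right mult.assoc)
  qed
  have zint: "integrable lebpos (\<lambda>r. z r * TM_slope p \<mu> (z r) * r powr a)"
    by (rule TM_density_integrable(2)[OF p \<mu> zm zp ze])
  have ue': "integrable lebpos (\<lambda>r. exp_growth p \<mu> (u r) * r powr a)"
  proof (rule Bochner_Integration.integrable_bound[OF ze])
    show "(\<lambda>r. exp_growth p \<mu> (u r) * r powr a) \<in> borel_measurable lebpos"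
      by (rule weighted_comp_measurable[OF exp_growth_measurable um])
    have "exp_growth p \<mu> (u r) * r powr a \<le> exp_growth p \<mu> (z r) * r powr a" for r
      using p \<mu> by (intro mult_right_mono exp_growth_mono) (auto simp: z_def)
    then show "AE r in lebpos. norm (exp_growth p \<mu> (u r) * r powr a) \<le> norm (exp_growth p \<mu> (z r) * r powr a)"
      by (intro AE_I2) (simp add: abs_mult exp_growth_nonneg)
  qed
  note int0 = TM_density_integrable(1)[OF p \<mu> um up ue']
  have "isCont m 0" using md by (rule DERIV_isCont)
  then have "\<forall>\<^sub>F s in at 0. \<bar>m s - 1\<bar> < 1"
    by (intro order_tendstoD(2)[of _ 0] tendsto_rabs_zero) (simp_all add: isCont_def m0 LIM_zero)
  moreover have "\<forall>\<^sub>F s in at 0. \<bar>(m s - 1) / s - d\<bar> < 1"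
    using md by (intro order_tendstoD(2)[of _ 0] tendsto_rabs_zero) (simp_all add: DERIV_def m0 LIM_zero)
  ultimately have "\<forall>\<^sub>F s in at 0. \<bar>m s - 1\<bar> < 1 \<and> \<bar>(m s - 1) / s - d\<bar> < 1"
    by (rule eventually_conj)
  then obtain \<epsilon>0 where \<epsilon>0: "\<epsilon>0 > 0" "\<And>s. s \<noteq> 0 \<Longrightarrow> \<bar>s\<bar> < \<epsilon>0 \<Longrightarrow> \<bar>m s - 1\<bar> < 1 \<and> \<bar>(m s - 1) / s - d\<bar> < 1"
    unfolding eventually_at by (auto simp: dist_real_def)
  \<comment> \<open>Besides the bounds on m, |s| \<le> 1 is required so that |s \<phi>| \<le>
    |\<phi>|.\<close>
  define \<epsilon> where "\<epsilon> = min \<epsilon>0 1"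
  have \<epsilon>: "\<epsilon> > 0" using \<epsilon>0(1) by (simp add: \<epsilon>_def)
  have m2: "\<bar>m s\<bar> \<le> 2" if "\<bar>s\<bar> < \<epsilon>" for s
    using \<epsilon>0(2)[of s] that m0 by (cases "s = 0") (auto simp: \<epsilon>_def)
  have m1: "\<bar>m s - 1\<bar> \<le> \<bar>s\<bar> * (\<bar>d\<bar> + 1)" if "\<bar>s\<bar> < \<epsilon>" for s
  proof (cases "s = 0")
    case False
    then have "\<bar>(m s - 1) / s - d\<bar> < 1" using \<epsilon>0(2)[of s] that by (simp add: \<epsilon>_def)
    then have "\<bar>(m s - 1) / s\<bar> \<le> \<bar>d\<bar> + 1" by linarith
    then show ?thesis using False by (simp add: pos_divide_le_eq mult.commute)
  qed (simp add: m0)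
  have s1: "\<bar>s\<bar> \<le> 1" if "\<bar>s\<bar> < \<epsilon>" for s using that by (simp add: \<epsilon>_def)
  have Xm: "(\<lambda>r. m s * (u r + s * \<phi> r)) \<in> borel_measurable lebpos" for s
    using um \<phi>m by measurable
  have Xz: "\<bar>m s * (u r + s * \<phi> r)\<bar> \<le> z r" if s: "\<bar>s - 0\<bar> < \<epsilon>" for s r
  proof -
    have "\<bar>s * \<phi> r\<bar> \<le> \<bar>\<phi> r\<bar>"
      using mult_right_mono[OF s1[of s], of "\<bar>\<phi> r\<bar>"] s by (simp add: abs_mult)
    then have "\<bar>u r + s * \<phi> r\<bar> \<le> \<bar>u r\<bar> + \<bar>\<phi> r\<bar>" by linarith
    then show ?thesis
      unfolding z_def abs_mult using m2[of s] s by (intro mult_mono) auto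
  qed
  have Xd: "\<bar>m s * (u r + s * \<phi> r) - m 0 * (u r + 0 * \<phi> r)\<bar> \<le> \<bar>s - 0\<bar> * ((\<bar>d\<bar> + 2) * z r)"
    if s: "\<bar>s - 0\<bar> < \<epsilon>" for s r
  proof -
    have "m s * (u r + s * \<phi> r) - m 0 * (u r + 0 * \<phi> r) = (m s - 1) * u r + s * (m s * \<phi> r)"
      by (simp add: m0 algebra_simps)
    also have "\<bar>\<dots>\<bar> \<le> \<bar>m s - 1\<bar> * \<bar>u r\<bar> + \<bar>s\<bar> * (\<bar>m s\<bar> * \<bar>\<phi> r\<bar>)"
      by (simp only: abs_mult[symmetric] abs_triangle_ineq)
    also have "\<dots> \<le> (\<bar>s\<bar> * (\<bar>d\<bar> + 1)) * \<bar>u r\<bar> + \<bar>s\<bar> * (2 * \<bar>\<phi> r\<bar>)"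
      using m1[of s] m2[of s] s by (intro add_mono mult_right_mono mult_left_mono) auto
    also have "\<dots> = \<bar>s\<bar> * ((\<bar>d\<bar> + 1) * \<bar>u r\<bar> + 2 * \<bar>\<phi> r\<bar>)" by (simp add: algebra_simps)
    also have "\<dots> \<le> \<bar>s\<bar> * ((\<bar>d\<bar> + 2) * z r)"
    proof (rule mult_left_mono)
      have "(\<bar>d\<bar> + 2) * z r = (\<bar>d\<bar> + 1) * \<bar>u r\<bar> + 2 * \<bar>\<phi> r\<bar> + ((\<bar>d\<bar> + 3) * \<bar>u r\<bar> + (2 * \<bar>d\<bar> + 2) * \<bar>\<phi> r\<bar>)"
        by (simp add: z_def algebra_simps)
      moreover have "0 \<le> (\<bar>d\<bar> + 3) * \<bar>u r\<bar> + (2 * \<bar>d\<bar> + 2) * \<bar>\<phi> r\<bar>" by simp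
      ultimately show "(\<bar>d\<bar> + 1) * \<bar>u r\<bar> + 2 * \<bar>\<phi> r\<bar> \<le> (\<bar>d\<bar> + 2) * z r" by linarith
    qed simp
    finally show ?thesis by simp
  qed
  have X': "((\<lambda>s. m s * (u r + s * \<phi> r)) has_real_derivative d * u r + \<phi> r) (at 0)" for r
  proof -
    have "((\<lambda>s. u r + s * \<phi> r) has_real_derivative \<phi> r) (at 0)" by (auto intro!: derivative_eq_intros)
    from DERIV_mult'[OF md this] show ?thesis by (simp add: m0 add.commute)
  qed
  have int0': "integrable lebpos (\<lambda>r. TM_density p \<mu> (m 0 * (u r + 0 * \<phi> r)) * r powr a)"
    using int0 by (simp add: m0)
  have mono: "\<bar>TM_slope p \<mu> x\<bar> \<le> TM_slope p \<mu> y" if "\<bar>x\<bar> \<le> y" for x y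
    by (rule TM_slope_mono[OF p \<mu> that])
  note * = integral_composition_has_derivative[where T = "TM_density p \<mu>" and \<tau> = "TM_slope p \<mu>"
      and M = lebpos and X = "\<lambda>s r. m s * (u r + s * \<phi> r)" and X' = "\<lambda>r. d * u r + \<phi> r" and wt = "\<lambda>r. r powr a"
      and z = z and C = "\<bar>d\<bar> + 2" and \<sigma> = 0,
      OF TM_density_has_deriv[OF p \<mu>] mono \<epsilon> Xm powr_lebpos_measurable powr_ge_zero Xz Xd X' zint int0']
  show "((\<lambda>s. LINT r|lebpos. TM_density p \<mu> (m s * (u r + s * \<phi> r)) * r powr a) has_real_derivative
      (LINT r|lebpos. TM_slope p \<mu> (u r) * (d * u r + \<phi> r) * r powr a)) (at 0)"
    using *(1) by (simp add: m0)
  show "integrable lebpos (\<lambda>r. TM_slope p \<mu> (u r) * (d * u r + \<phi> r) * r powr a)"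
    using *(2) by (simp add: m0)
qed

text \<open>The curve through u in the direction \<phi> has velocity \<phi> - L u, where L is the
  pairing with \<phi>. Criticality equates the derivative in the direction \<phi> with L times that
  in the direction u, so the Lagrange multiplier appears explicitly.\<close>

lemma critical_point_imp_weak_equation:
  assumes p: "1 < p" and \<mu>: "0 < \<mu>" and uv: "X_pair p a u v" and one: "X_energy p a u v = 1"
    and ue: "integrable lebpos (\<lambda>r. exp_growth p \<mu>0 (u r) * r powr a)" and \<mu>0: "\<mu> * 4 powr conj_exp p \<le> \<mu>0"
    and crit: "critical_point_on p a (p - 1) (X_sphere p a (p - 1)) (\<lambda>v. enn2real (TM_functional p a \<mu> v)) u"
    and \<phi>: "\<phi> \<in> test_functions {0<..}"
  shows "integrable lebpos (\<lambda>r. TM_slope p \<mu> (u r) * \<phi> r * r powr a)"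
    and "(LINT r|lebpos. TM_slope p \<mu> (u r) * \<phi> r * r powr a)
      = (LINT r|lebpos. u r * TM_slope p \<mu> (u r) * r powr a) * X_pairing p a u v \<phi> (deriv \<phi>)"
proof -
  define L where "L = X_pairing p a u v \<phi> (deriv \<phi>)"
  have \<phi>p: "X_pair p a \<phi> (deriv \<phi>)" by (rule X_pair_test[OF \<phi>]) (use p in simp)
  note um = X_pair_measurable(1)[OF uv] and \<phi>m = X_pair_measurable(1)[OF \<phi>p]
  have up: "integrable lebpos (wpow p a u)" using uv by (simp add: X_pair_def)
  obtain m where m: "m 0 = 1" "(m has_real_derivative - L) (at 0)"
    "diff_curve_through p a (p - 1) (X_sphere p a (p - 1)) u (\<lambda>s r. m s * (u r + s * \<phi> r))"
    using sphere_curve[OF p uv one \<phi>p] unfolding L_def by blast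
  note d = TM_curve_derivative[OF p \<mu> um up ue \<mu>0 \<phi> m(1,2)]
  have mm: "(\<lambda>r. m s * (u r + s * \<phi> r)) \<in> borel_measurable lebpos" for s using um \<phi>m by measurable
  have "((\<lambda>s. enn2real (TM_functional p a \<mu> (\<lambda>r. m s * (u r + s * \<phi> r)))) has_real_derivative
      (LINT r|lebpos. TM_slope p \<mu> (u r) * (- L * u r + \<phi> r) * r powr a)) (at 0)"
    unfolding TM_functional_eq_integral[OF p \<mu> mm] by (rule d(1))
  then have zero: "(LINT r|lebpos. TM_slope p \<mu> (u r) * (- L * u r + \<phi> r) * r powr a) = 0"
    using crit m(3) unfolding critical_point_on_def by blast
  have "integrable lebpos (\<lambda>r. exp_growth p \<mu> (u r) * r powr a)"
  proof (rule Bochner_Integration.integrable_bound[OF ue])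
    show "(\<lambda>r. exp_growth p \<mu> (u r) * r powr a) \<in> borel_measurable lebpos"
      by (rule weighted_comp_measurable[OF exp_growth_measurable um])
    have "\<mu> \<le> \<mu> * 4 powr conj_exp p"
      using \<mu> p ge_one_powr_ge_zero[of 4 "conj_exp p"] by simp
    then have "\<mu> * 1 powr conj_exp p \<le> \<mu>0" using \<mu>0 by simp
    from exp_growth_scale[OF p zero_less_one this] have "exp_growth p \<mu> (u r) \<le> exp_growth p \<mu>0 (u r)" for r
      by simp
    then show "AE r in lebpos. norm (exp_growth p \<mu> (u r) * r powr a) \<le> norm (exp_growth p \<mu>0 (u r) * r powr a)"
      by (intro AE_I2) (simp add: abs_mult exp_growth_nonneg mult_right_mono)
  qed
  note ui = TM_density_integrable(2)[OF p \<mu> um up this]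
  have split: "TM_slope p \<mu> (u r) * \<phi> r * r powr a
      = TM_slope p \<mu> (u r) * (- L * u r + \<phi> r) * r powr a + L * (u r * TM_slope p \<mu> (u r) * r powr a)" for r
    by (simp add: algebra_simps)
  show "integrable lebpos (\<lambda>r. TM_slope p \<mu> (u r) * \<phi> r * r powr a)"
    unfolding split by (intro Bochner_Integration.integrable_add d(2) integrable_mult_right ui)
  show "(LINT r|lebpos. TM_slope p \<mu> (u r) * \<phi> r * r powr a)
      = (LINT r|lebpos. u r * TM_slope p \<mu> (u r) * r powr a) * X_pairing p a u v \<phi> (deriv \<phi>)"
    unfolding split using Bochner_Integration.integral_add[OF d(2) integrable_mult_right[OF ui, of L]] zero
    by (simp add: L_def mult.commute)
qed

section \<open>From the weak equation to the Pohozaev identity\<close>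

lemma loc_integrableI:
  assumes "\<And>c d. 0 < c \<Longrightarrow> integrable lebpos (\<lambda>r. indicator {c..d} r * h r)"
  shows "loc_integrable h"
  unfolding loc_integrable_def
proof (intro allI impI)
  fix c d :: real assume c: "0 < c"
  have "integrable lebesgue (\<lambda>r. indicator {0<..} r *\<^sub>R (indicator {c..d} r * h r))"
    using assms[OF c, of d] by (subst (asm) integrable_restrict_space) auto
  also have "(\<lambda>r. indicator {0<..} r *\<^sub>R (indicator {c..d} r * h r)) = (\<lambda>r. indicator {c..d} r *\<^sub>R h r)"
    using c by (auto simp: indicator_def)
  finally show "h absolutely_integrable_on {c..d}" by (simp add: set_integrable_def)
qed

text \<open>On compact intervals |v|^(p-1) \<le> 1 + |v|^p suffices.\<close>

lemma loc_integrable_flux: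
  assumes p: "1 < p" and vm: "v \<in> borel_measurable lebpos"
    and iv: "integrable lebpos (wpow p (p - 1) v)"
  shows "loc_integrable (\<lambda>r. signed_powr (p - 1) (v r) * r powr (p - 1))"
proof (rule loc_integrableI)
  fix c d :: real assume c: "0 < c"
  have loc: "loc_integrable (\<lambda>r. r powr (p - 1))"
    by (rule loc_integrable_continuous) (auto intro!: continuous_intros)
  have im: "indicat_real {c..d} \<in> borel_measurable lebpos"
    by (intro measurable_restrict_space1 borel_measurable_indicator) auto
  have "integrable lebpos (\<lambda>r. indicator {c..d} r * r powr (p - 1) + \<bar>v r\<bar> powr p * r powr (p - 1))"
    by (intro Bochner_Integration.integrable_add loc_integrable_lebpos[OF loc c] iv)
  then show "integrable lebpos (\<lambda>r. indicator {c..d} r * (signed_powr (p - 1) (v r) * r powr (p - 1)))"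
  proof (rule Bochner_Integration.integrable_bound)
    show "(\<lambda>r. indicator {c..d} r * (signed_powr (p - 1) (v r) * r powr (p - 1))) \<in> borel_measurable lebpos"
      by (rule borel_measurable_times[OF im weighted_comp_measurable[OF signed_powr_measurable vm]])
    have bd: "x powr (p - 1) \<le> 1 + x powr p" if "0 \<le> x" for x :: real
    proof (cases "x \<le> 1")
      case True
      then have "x powr (p - 1) \<le> 1" using p that by (simp add: powr_le1)
      then show ?thesis by (simp add: add_increasing2)
    next
      case False
      then have "x powr (p - 1) \<le> x powr p" by (intro powr_mono) auto
      then show ?thesis by simp
    qed
    have "\<bar>indicator {c..d} r * (signed_powr (p - 1) (v r) * r powr (p - 1))\<bar>
        \<le> indicator {c..d} r * r powr (p - 1) + \<bar>v r\<bar> powr p * r powr (p - 1)" for r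
    proof (cases "r \<in> {c..d}")
      case True
      then show ?thesis
        using mult_right_mono[OF bd[of "\<bar>v r\<bar>"], of "r powr (p - 1)"]
        by (simp add: abs_mult abs_signed_powr distrib_right)
    qed simp
    then show "AE r in lebpos. norm (indicator {c..d} r * (signed_powr (p - 1) (v r) * r powr (p - 1)))
        \<le> norm (indicator {c..d} r * r powr (p - 1) + \<bar>v r\<bar> powr p * r powr (p - 1))"
      by (intro AE_I2) (auto intro: order_trans[OF _ abs_ge_self])
  qed
qed

lemma X_pair_primitive:
  assumes "X_pair p a u v"
  obtains w where "is_primitive w v" "AE r in lebpos. u r = w r" "w \<in> borel_measurable lebpos"
proof -
  obtain w where w: "is_primitive w v" "AE r in lebpos. u r = w r"
    using has_weak_deriv_imp_primitive assms unfolding X_pair_def by blast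
  moreover have "w \<in> borel_measurable lebpos"
    by (rule continuous_imp_measurable_on_sets_lebesgue[OF is_primitive_continuous[OF w(1)]]) simp
  ultimately show ?thesis using that by blast
qed

lemma weighted_comp_cong_AE:
  assumes T: "T \<in> borel_measurable borel" and "f \<in> borel_measurable lebpos" "g \<in> borel_measurable lebpos"
    and ae: "AE r in lebpos. f r = g r"
  shows "integrable lebpos (\<lambda>r. T (f r) * r powr b) \<longleftrightarrow> integrable lebpos (\<lambda>r. T (g r) * r powr b)"
    and "(LINT r|lebpos. T (f r) * r powr b) = (LINT r|lebpos. T (g r) * r powr b)"
proof -
  have e: "AE r in lebpos. T (f r) * r powr b = T (g r) * r powr b"
    using ae by eventually_elim simp
  note m = weighted_comp_measurable[OF T assms(2), of b] weighted_comp_measurable[OF T assms(3), of b]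
  show "integrable lebpos (\<lambda>r. T (f r) * r powr b) \<longleftrightarrow> integrable lebpos (\<lambda>r. T (g r) * r powr b)"
    "(LINT r|lebpos. T (f r) * r powr b) = (LINT r|lebpos. T (g r) * r powr b)"
    by (rule integrable_cong_AE[OF m e], rule integral_cong_AE[OF m e])
qed

lemma abs_powr_measurable: "(\<lambda>x::real. \<bar>x\<bar> powr p) \<in> borel_measurable borel"
  by measurable

text \<open>The exponential inequality concerns the continuous representative w; its conclusions
  depend only on almost everywhere classes and pass to u.\<close>

lemma X_pair_growth:
  assumes uv: "X_pair p a u v"
    and bound: "\<And>w. is_primitive w v \<Longrightarrow> integrable lebpos (wpow p a w) \<Longrightarrow>
      integrable lebpos (\<lambda>r. exp_growth p \<mu>0 (w r) * r powr a) \<and>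
      (LINT r|lebpos. exp_growth p \<mu>0 (w r) * r powr a) \<le> C * (wint p a w)"
  shows "integrable lebpos (\<lambda>r. exp_growth p \<mu>0 (u r) * r powr a)"
    and "(LINT r|lebpos. exp_growth p \<mu>0 (u r) * r powr a) \<le> C * (wint p a u)"
proof -
  obtain w where w: "is_primitive w v" "AE r in lebpos. u r = w r" "w \<in> borel_measurable lebpos"
    by (rule X_pair_primitive[OF uv]) (rule that)
  note um = X_pair_measurable(1)[OF uv]
  note c1 = weighted_comp_cong_AE[OF abs_powr_measurable um w(3,2), of p a]
  note c2 = weighted_comp_cong_AE[OF exp_growth_measurable um w(3,2), of p \<mu>0 a]
  have "integrable lebpos (wpow p a w)" using uv c1(1) by (simp add: X_pair_def)
  from bound[OF w(1) this] show "integrable lebpos (\<lambda>r. exp_growth p \<mu>0 (u r) * r powr a)"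
    "(LINT r|lebpos. exp_growth p \<mu>0 (u r) * r powr a) \<le> C * (wint p a u)"
    using c1 c2 by auto
qed

text \<open>If u vanishes almost everywhere, its continuous representative vanishes identically and
  0 is a density of it. On the sphere this forces B > 0.\<close>

lemma X_pair_zero:
  assumes p: "1 < p" and uv: "X_pair p a u v" and z: "(wint p a u) = 0"
  shows "X_energy p a u v = 0"
proof -
  have "AE r in lebpos. \<bar>u r\<bar> powr p * r powr a = 0"
    using z uv by (subst (asm) integral_nonneg_eq_0_iff_AE) (auto simp: X_pair_def)
  then have u0: "AE r in lebpos. u r = 0"
    using AE_space by eventually_elim auto
  obtain w where w: "is_primitive w v" "AE r in lebpos. u r = w r" "w \<in> borel_measurable lebpos"
    by (rule X_pair_primitive[OF uv]) (rule that)
  have "AE r in lebpos. w r = 0" using w(2) u0 by eventually_elim simp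
  then have "w r = 0" if "r > 0" for r
    using continuous_AE_eq_imp_eq[OF is_primitive_continuous[OF w(1)] continuous_on_const _ that] by blast
  then have "is_primitive w (\<lambda>r. 0)"
    unfolding is_primitive_def using loc_integrable_continuous[OF continuous_on_const] by simp
  then have "AE r in lebpos. v r = 0" by (rule is_primitive_unique[OF w(1)])
  then have "AE r in lebpos. \<bar>v r\<bar> powr p * r powr (p - 1) = 0" by eventually_elim simp
  then have "(wint p (p - 1) v) = 0"
    using integral_cong_AE[OF powr_abs_measurable[OF X_pair_measurable(2)[OF uv]], of "\<lambda>_. 0"] by simp
  then show ?thesis using z by (simp add: X_energy_def)
qed

text \<open>Division by the multiplier \<Lambda> brings the equation into the form of
  \<open>pohozaev_identity\<close>, with f = \<open>TM_slope\<close> / \<Lambda> - |x|^(p-2) x. The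
  vanishing integral of its primitive \<open>\<Psi>\<close> is the claim.\<close>

lemma critical_point_pohozaev:
  assumes p: "1 < p" and a: "-1 < a" and \<mu>: "0 < \<mu>" and uv: "X_pair p a u v" and one: "X_energy p a u v = 1"
    and ue: "integrable lebpos (\<lambda>r. exp_growth p \<mu>0 (u r) * r powr a)" and \<mu>0: "\<mu> * 4 powr conj_exp p \<le> \<mu>0"
    and i\<Psi>: "integrable lebpos (\<lambda>r. TM_density p \<mu> (u r) * r powr a)"
    and crit: "critical_point_on p a (p - 1) (X_sphere p a (p - 1)) (\<lambda>v. enn2real (TM_functional p a \<mu> v)) u"
    and \<Lambda>: "(LINT r|lebpos. u r * TM_slope p \<mu> (u r) * r powr a) = \<Lambda>" "\<Lambda> \<noteq> 0"
  shows "p * (LINT r|lebpos. TM_density p \<mu> (u r) * r powr a) = \<Lambda> * (wint p a u)"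
proof -
  obtain w where w: "is_primitive w v" "AE r in lebpos. u r = w r" "w \<in> borel_measurable lebpos"
    by (rule X_pair_primitive[OF uv]) (rule that)
  note um = X_pair_measurable(1)[OF uv] and vm = X_pair_measurable(2)[OF uv]
  have up: "integrable lebpos (wpow p a u)"
    and iv: "integrable lebpos (wpow p (p - 1) v)"
    using uv by (auto simp: X_pair_def)
  define f where "f = (\<lambda>x. TM_slope p \<mu> x / \<Lambda> - signed_powr (p - 1) x)"
  define \<Psi> where "\<Psi> = (\<lambda>x. TM_density p \<mu> x / \<Lambda> - \<bar>x\<bar> powr p / p)"
  have fc: "continuous_on S f" for S
    unfolding f_def using p \<Lambda>(2) by (intro continuous_intros TM_slope_continuous[OF p \<mu>]) auto
  have \<Psi>d: "(\<Psi> has_real_derivative f x) (at x)" for x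
  proof -
    have "((\<lambda>x. TM_density p \<mu> x / \<Lambda> - \<bar>x\<bar> powr p / p) has_real_derivative
        TM_slope p \<mu> x / \<Lambda> - p * signed_powr (p - 1) x / p) (at x)"
      by (intro DERIV_diff DERIV_cdivide TM_density_has_deriv[OF p \<mu>] has_real_derivative_abs_powr[OF p])
    then show ?thesis using p unfolding \<Psi>_def f_def by simp
  qed
  have fm: "f \<in> borel_measurable borel" by (rule borel_measurable_continuous_onI[OF fc])
  have \<Psi>m: "\<Psi> \<in> borel_measurable borel"
    by (rule borel_measurable_continuous_onI) (use \<Psi>d DERIV_isCont continuous_at_imp_continuous_on in blast)
  have weak: "has_weak_deriv (\<lambda>r. signed_powr (p - 1) (v r) * r powr (p - 1)) (\<lambda>r. - (f (w r) * r powr a))"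
    unfolding has_weak_deriv_def
  proof (intro conjI ballI)
    show "loc_integrable (\<lambda>r. signed_powr (p - 1) (v r) * r powr (p - 1))"
      by (rule loc_integrable_flux[OF p vm iv])
    show "loc_integrable (\<lambda>r. - (f (w r) * r powr a))"
      by (intro loc_integrable_continuous continuous_intros
          continuous_on_compose2[OF fc[of UNIV] is_primitive_continuous[OF w(1)]]) auto
    fix \<phi> assume \<phi>: "\<phi> \<in> test_functions {0<..}"
    have \<phi>p: "X_pair p a \<phi> (deriv \<phi>)" by (rule X_pair_test[OF \<phi>]) (use p in simp)
    note \<phi>m = X_pair_measurable(1)[OF \<phi>p]
    have i2: "integrable lebpos (\<lambda>r. signed_powr (p - 1) (u r) * \<phi> r * r powr a)"
      using weighted_Lp_line_derivative(2)[OF p um \<phi>m up, of 0] \<phi>p by (simp add: X_pair_def)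
    note el = critical_point_imp_weak_equation[OF p \<mu> uv one ue \<mu>0 crit \<phi>]
    have "AE r in lebpos. - (f (w r) * r powr a) * \<phi> r = - (f (u r) * r powr a) * \<phi> r"
      using w(2) by eventually_elim simp
    moreover have m: "(\<lambda>r. - (f (h r) * r powr a) * \<phi> r) \<in> borel_measurable lebpos" if "h \<in> borel_measurable lebpos" for h
      by (intro borel_measurable_times borel_measurable_uminus \<phi>m powr_lebpos_measurable measurable_compose[OF that fm])
    ultimately have "- (LINT r|lebpos. - (f (w r) * r powr a) * \<phi> r) = - (LINT r|lebpos. - (f (u r) * r powr a) * \<phi> r)"
      using integral_cong_AE[OF m[OF w(3)] m[OF um]] by simp
    also have "\<dots> = (LINT r|lebpos. (1 / \<Lambda>) * (TM_slope p \<mu> (u r) * \<phi> r * r powr a) - signed_powr (p - 1) (u r) * \<phi> r * r powr a)"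
      unfolding Bochner_Integration.integral_minus[symmetric]
      by (rule Bochner_Integration.integral_cong) (auto simp: f_def algebra_simps)
    also have "\<dots> = (1 / \<Lambda>) * (LINT r|lebpos. TM_slope p \<mu> (u r) * \<phi> r * r powr a)
        - (LINT r|lebpos. signed_powr (p - 1) (u r) * \<phi> r * r powr a)"
      by (simp only: Bochner_Integration.integral_diff[OF integrable_mult_right[OF el(1)] i2] integral_mult_right_zero)
    also have "\<dots> = (LINT r|lebpos. signed_powr (p - 1) (v r) * deriv \<phi> r * r powr (p - 1))"
      using \<Lambda> unfolding el(2) X_pairing_def by simp
    also have "\<dots> = (LINT r|lebpos. signed_powr (p - 1) (v r) * r powr (p - 1) * deriv \<phi> r)"
      by (simp only: mult.assoc mult.commute[of "deriv \<phi> _"])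
    finally show "(LINT r|lebpos. signed_powr (p - 1) (v r) * r powr (p - 1) * deriv \<phi> r)
        = - (LINT r|lebpos. - (f (w r) * r powr a) * \<phi> r)" by simp
  qed
  have \<Psi>eq: "\<Psi> (u r) * r powr a = (1 / \<Lambda>) * (TM_density p \<mu> (u r) * r powr a) - (1 / p) * (\<bar>u r\<bar> powr p * r powr a)" for r
    by (simp add: \<Psi>_def algebra_simps)
  have \<Psi>i: "integrable lebpos (\<lambda>r. \<Psi> (u r) * r powr a)"
    unfolding \<Psi>eq by (intro Bochner_Integration.integrable_diff integrable_mult_right i\<Psi> up)
  note cong = weighted_comp_cong_AE[OF \<Psi>m um w(3,2), of a]
  have "(LINT r|lebpos. \<Psi> (w r) * r powr a) = 0"
    by (rule pohozaev_identity[OF p a w(1) fc \<Psi>d weak iv]) (use \<Psi>i cong(1) in simp)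
  then have "(LINT r|lebpos. \<Psi> (u r) * r powr a) = 0" using cong(2) by simp
  then have "(1 / \<Lambda>) * (LINT r|lebpos. TM_density p \<mu> (u r) * r powr a) = (1 / p) * (wint p a u)"
    unfolding \<Psi>eq Bochner_Integration.integral_diff[OF integrable_mult_right[OF i\<Psi>] integrable_mult_right[OF up]]
    by (simp only: integral_mult_right_zero)
  then show ?thesis using \<Lambda>(2) p by (simp add: field_simps)
qed

section \<open>Non-existence of critical points and maximizers\<close>

lemma X_sphereE:
  assumes "u \<in> X_sphere p a (p - 1)" "0 < p"
  obtains v where "X_pair p a u v" "X_energy p a u v = 1"
proof -
  obtain v where v: "X_pair p a u v"
    using assms(1) X_spaceE unfolding X_sphere_def by blast
  then have "X_energy p a u v powr (1 / p) = 1"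
    using assms X_norm_eq[OF v] unfolding X_sphere_def by simp
  then have "(X_energy p a u v powr (1 / p)) powr p = 1" by simp
  then have "X_energy p a u v = 1"
    using assms(2) X_energy_nonneg[of p a u v] by (simp add: powr_powr)
  then show ?thesis using that v by blast
qed

text \<open>A maximum on S is a local maximum along each curve in S. Finiteness of F u bounds F on
  all of S by a finite value, so \<open>enn2real\<close> preserves the order.\<close>

lemma maximizer_imp_critical_point:
  assumes max: "u \<in> S" "F u = (SUP v\<in>S. F v)" and fin: "F u < \<infinity>"
  shows "critical_point_on p a b S (\<lambda>v. enn2real (F v)) u"
  unfolding critical_point_on_def
proof (intro conjI allI impI max(1))
  fix \<gamma> D
  assume \<gamma>: "diff_curve_through p a b S u \<gamma>"
    and D: "((\<lambda>t. enn2real (F (\<gamma> t))) has_real_derivative D) (at 0)"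
  obtain \<epsilon> where \<epsilon>: "\<epsilon> > 0" "\<And>s. s \<in> {-\<epsilon><..<\<epsilon>} \<Longrightarrow> \<gamma> s \<in> S" and "\<gamma> 0 = u"
    using \<gamma> unfolding diff_curve_through_def by blast
  show "D = 0"
  proof (rule DERIV_local_max[OF D \<epsilon>(1)], intro allI impI)
    fix s assume "\<bar>0 - s\<bar> < \<epsilon>"
    then have "\<gamma> s \<in> S" using \<epsilon>(2)[of s] by (auto simp: abs_less_iff)
    then have "F (\<gamma> s) \<le> F u" unfolding max(2) by (rule SUP_upper)
    then show "enn2real (F (\<gamma> s)) \<le> enn2real (F (\<gamma> 0))"
      unfolding \<open>\<gamma> 0 = u\<close> using fin by (intro enn2real_mono) auto
  qed
qed

theorem theorem1p5:
  fixes p \<alpha>\<^sub>0 :: real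
  assumes "1 < p" and "p \<le> 2" and "\<alpha>\<^sub>0 > -1"
  shows "\<exists>\<mu>star>0. \<forall>\<mu>. 0 < \<mu> \<and> \<mu> < \<mu>star \<longrightarrow>
    \<not> (\<exists>u\<in>X_sphere p \<alpha>\<^sub>0 (p - 1).
         TM_functional p \<alpha>\<^sub>0 \<mu> u = (SUP v\<in>X_sphere p \<alpha>\<^sub>0 (p - 1). TM_functional p \<alpha>\<^sub>0 \<mu> v)) \<and>
    \<not> (\<exists>u. critical_point_on p \<alpha>\<^sub>0 (p - 1) (X_sphere p \<alpha>\<^sub>0 (p - 1))
         (\<lambda>v. enn2real (TM_functional p \<alpha>\<^sub>0 \<mu> v)) u)"
proof -
  define a where "a = \<alpha>\<^sub>0"
  note p = assms(1)
  have a: "-1 < a" using assms(3) by (simp add: a_def)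
  have p0: "0 < p" using p by simp
  define q where "q = conj_exp p"
  have q: "q > 0" using p by (simp add: q_def)
  have G: "Gamma p > 0" using p by (simp add: Gamma_real_pos)
  obtain K \<mu>0 where K: "0 < K" and \<mu>0: "0 < \<mu>0"
    and bound: "\<And>w v M. is_primitive w v \<Longrightarrow> 0 < M \<Longrightarrow> M \<le> 1 \<Longrightarrow>
      integrable lebpos (wpow p (p - 1) v) \<Longrightarrow>
      (wint p (p - 1) v) \<le> M powr p \<Longrightarrow>
      integrable lebpos (wpow p a w) \<Longrightarrow>
      integrable lebpos (\<lambda>r. exp_growth p \<mu>0 (w r) * r powr a) \<and>
      (LINT r|lebpos. exp_growth p \<mu>0 (w r) * r powr a) \<le> K * M powr conj_exp p * (wint p a w)"
    by (rule scale_exp_bound[OF p a]) (rule that)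
  define \<mu>star where "\<mu>star = min (\<mu>0 / 4 powr q) ((p - 1) / K)"
  have "\<mu>star > 0" using p K \<mu>0 by (simp add: \<mu>star_def)
  moreover have "\<not> (\<exists>u\<in>X_sphere p a (p - 1).
         TM_functional p a \<mu> u = (SUP v\<in>X_sphere p a (p - 1). TM_functional p a \<mu> v)) \<and>
    \<not> (\<exists>u. critical_point_on p a (p - 1) (X_sphere p a (p - 1)) (\<lambda>v. enn2real (TM_functional p a \<mu> v)) u)"
    if \<mu>': "0 < \<mu> \<and> \<mu> < \<mu>star" for \<mu>
  proof -
    have \<mu>: "0 < \<mu>" using \<mu>' by simp
    have \<mu>q: "\<mu> * 4 powr conj_exp p \<le> \<mu>0"
      using \<mu>' by (simp add: \<mu>star_def q_def[symmetric] less_divide_eq)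
    have \<mu>K: "\<mu> * K < p - 1" using \<mu>' K by (simp add: \<mu>star_def less_divide_eq)
    have "\<mu> * 1 \<le> \<mu> * 4 powr conj_exp p"
      using \<mu> q by (intro mult_left_mono ge_one_powr_ge_zero) (auto simp: q_def)
    then have \<mu>1: "\<mu> * 1 powr conj_exp p \<le> \<mu>0" using \<mu>q by simp
    define c0 where "c0 = \<mu> powr (p - 1) / Gamma p"
    have c0: "c0 > 0" using \<mu> G by (simp add: c0_def)
    have growth_le: "exp_growth p \<mu> x \<le> exp_growth p \<mu>0 x" for x
      using exp_growth_scale[OF p zero_less_one \<mu>1, of x] by simp
    have growth_int: "integrable lebpos (\<lambda>r. exp_growth p \<mu>0 (u r) * r powr a)"
      and growth_bd: "\<And>M. 0 < M \<Longrightarrow> M \<le> 1 \<Longrightarrow> (wint p (p - 1) v) \<le> M powr p \<Longrightarrow>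
        (LINT r|lebpos. exp_growth p \<mu>0 (u r) * r powr a) \<le> K * M powr q * (wint p a u)"
      and dens_int: "integrable lebpos (\<lambda>r. TM_density p \<mu> (u r) * r powr a)"
      and slope_int: "integrable lebpos (\<lambda>r. u r * TM_slope p \<mu> (u r) * r powr a)"
      and growth\<mu>: "integrable lebpos (\<lambda>r. exp_growth p \<mu> (u r) * r powr a)"
      if uv: "X_pair p a u v" and one: "X_energy p a u v = 1" for u v
    proof -
      have iv: "integrable lebpos (wpow p (p - 1) v)"
        and up: "integrable lebpos (wpow p a u)"
        using uv by (auto simp: X_pair_def)
      note um = X_pair_measurable(1)[OF uv]
      have "(wint p a u) \<ge> 0" by (rule integral_nonneg_AE) auto
      then have "(wint p (p - 1) v) \<le> 1"
        using one unfolding X_energy_def by linarith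
      \<comment> \<open>M = 1 is admissible at every point of the sphere and yields integrability;
        the bound in terms of A uses the sharp M.\<close>
      then have A1: "(wint p (p - 1) v) \<le> 1 powr p" by simp
      show int: "integrable lebpos (\<lambda>r. exp_growth p \<mu>0 (u r) * r powr a)"
        by (rule X_pair_growth(1)[OF uv bound[OF _ zero_less_one order_refl iv A1]])
      show "(LINT r|lebpos. exp_growth p \<mu>0 (u r) * r powr a) \<le> K * M powr q * (wint p a u)"
        if "0 < M" "M \<le> 1" "(wint p (p - 1) v) \<le> M powr p" for M
        unfolding q_def by (rule X_pair_growth(2)[OF uv bound[OF _ that(1,2) iv that(3)]])
      show int\<mu>: "integrable lebpos (\<lambda>r. exp_growth p \<mu> (u r) * r powr a)"
      proof (rule Bochner_Integration.integrable_bound[OF int])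
        show "(\<lambda>r. exp_growth p \<mu> (u r) * r powr a) \<in> borel_measurable lebpos"
          by (rule weighted_comp_measurable[OF exp_growth_measurable um])
        show "AE r in lebpos. norm (exp_growth p \<mu> (u r) * r powr a) \<le> norm (exp_growth p \<mu>0 (u r) * r powr a)"
          using growth_le by (intro AE_I2) (simp add: abs_mult exp_growth_nonneg mult_right_mono)
      qed
      show "integrable lebpos (\<lambda>r. TM_density p \<mu> (u r) * r powr a)"
        "integrable lebpos (\<lambda>r. u r * TM_slope p \<mu> (u r) * r powr a)"
        by (rule TM_density_integrable[OF p \<mu> um up int\<mu>])+
    qed
    have no_crit: False
      if crit: "critical_point_on p a (p - 1) (X_sphere p a (p - 1)) (\<lambda>v. enn2real (TM_functional p a \<mu> v)) u" for u
    proof -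
      have "u \<in> X_sphere p a (p - 1)" using crit by (simp add: critical_point_on_def)
      then obtain v where uv: "X_pair p a u v" and one: "X_energy p a u v = 1"
        using X_sphereE p0 by metis
      have up: "integrable lebpos (wpow p a u)" using uv by (simp add: X_pair_def)
      define A where "A = (wint p (p - 1) v)"
      define B where "B = (wint p a u)"
      define F where "F = (LINT r|lebpos. TM_density p \<mu> (u r) * r powr a)"
      define E where "E = (LINT r|lebpos. exp_growth p \<mu>0 (u r) * r powr a)"
      define T where "T = (LINT r|lebpos. (\<mu> * \<bar>u r\<bar> powr q * TM_density p \<mu> (u r)) * r powr a)"
      define \<Lambda> where "\<Lambda> = (LINT r|lebpos. u r * TM_slope p \<mu> (u r) * r powr a)"
      have AB: "A + B = 1" using one by (simp add: A_def B_def X_energy_def)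
      have A: "A \<ge> 0" and B0: "B \<ge> 0" and E0: "E \<ge> 0"
        unfolding A_def B_def E_def by (auto intro!: integral_nonneg_AE AE_I2 simp: exp_growth_nonneg)
      have "B \<noteq> 0"
        using X_pair_zero[OF p uv] one unfolding B_def by fastforce
      then have B: "B > 0" using B0 by linarith
      have Ebd: "E \<le> K * M powr q * B" if "0 < M" "M \<le> 1" "A \<le> M powr p" for M
        unfolding E_def B_def by (rule growth_bd[OF uv one that(1,2)]) (use that(3) in \<open>simp add: A_def\<close>)
      \<comment> \<open>If A were 0, the inequality would hold for every M in (0, 1]. Letting M tend
        to 0 gives E = 0, hence u = 0 almost everywhere, against B > 0.\<close>
      have Apos: "A > 0"
      proof (rule ccontr)
        assume "\<not> A > 0"
        then have "A = 0" using A by simp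
        then have le: "E \<le> K * M powr q * B" if "0 < M" "M \<le> 1" for M using Ebd that by simp
        have "((\<lambda>M. K * M powr q * B) \<longlongrightarrow> K * 0 powr q * B) (at_right 0)"
          using q by (intro tendsto_intros tendsto_powr') (auto simp: eventually_at_right_field intro!: exI[of _ 1])
        moreover have "\<forall>\<^sub>F M in at_right 0. E \<le> K * M powr q * B"
          unfolding eventually_at_right_field by (intro exI[of _ 1]) (use le in auto)
        ultimately have "E \<le> K * 0 powr q * B"
          by (intro tendsto_lowerbound[where F = "at_right 0"]) auto
        then have "E = 0" using E0 by simp
        then have "AE r in lebpos. exp_growth p \<mu>0 (u r) * r powr a = 0"
          unfolding E_def using growth_int[OF uv one]
          by (subst (asm) integral_nonneg_eq_0_iff_AE) (auto simp: exp_growth_nonneg)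
        then have "AE r in lebpos. \<bar>u r\<bar> powr p * r powr a = 0"
          using AE_space by eventually_elim (auto simp: exp_growth_def)
        then have "B = 0"
          unfolding B_def using up by (subst integral_nonneg_eq_0_iff_AE) auto
        then show False using B by simp
      qed
      have "E \<le> K * A * B"
      proof -
        \<comment> \<open>The smallest admissible M. Then M^q = A^(1/(p-1)), and this is at most A
          because A \<le> 1 and 1 / (p - 1) \<ge> 1.\<close>
        define M where "M = A powr (1 / p)"
        have "M powr q = A powr (1 / (p - 1))" using p by (simp add: M_def q_def powr_powr)
        also have "\<dots> \<le> A powr 1"
          using Apos AB B assms(2) p by (intro powr_mono') (auto simp: le_divide_eq)
        finally have MA: "M powr q \<le> A" using Apos by simp
        have "0 < M" "M \<le> 1" "A \<le> M powr p"
          using Apos AB B p by (auto simp: M_def powr_powr powr_le1)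
        from Ebd[OF this] have "E \<le> K * M powr q * B" .
        also have "\<dots> \<le> K * A * B" using MA K B by (intro mult_right_mono mult_left_mono) auto
        finally show ?thesis .
      qed
      note um = X_pair_measurable(1)[OF uv]
      have slope: "x * TM_slope p \<mu> x = q * (\<mu> * \<bar>x\<bar> powr q * TM_density p \<mu> x) + p * (c0 * \<bar>x\<bar> powr p)" for x
        using mult_TM_slope[OF p \<mu>, of x] by (simp add: q_def c0_def)
      \<comment> \<open>Solving the splitting of x times the slope for the excess yields both its
        integrability and \<Lambda> = q T + p c0 B.\<close>
      have Teq: "(\<mu> * \<bar>u r\<bar> powr q * TM_density p \<mu> (u r)) * r powr a
          = (1 / q) * (u r * TM_slope p \<mu> (u r) * r powr a) - (p * c0 / q) * (\<bar>u r\<bar> powr p * r powr a)" for r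
        unfolding slope using q by (simp add: field_simps)
      have Tint: "integrable lebpos (\<lambda>r. (\<mu> * \<bar>u r\<bar> powr q * TM_density p \<mu> (u r)) * r powr a)"
        unfolding Teq
        by (intro Bochner_Integration.integrable_diff integrable_mult_right slope_int[OF uv one] up)
      have "T = (1 / q) * \<Lambda> - (p * c0 / q) * B"
        unfolding T_def Teq \<Lambda>_def B_def
        by (simp only: Bochner_Integration.integral_diff[OF integrable_mult_right[OF slope_int[OF uv one]] integrable_mult_right[OF up]]
            integral_mult_right_zero)
      then have \<Lambda>: "\<Lambda> = q * T + p * c0 * B" using q by (simp add: field_simps)
      have T0: "T \<ge> 0"
        unfolding T_def using TM_density_nonneg[OF p \<mu>] \<mu> by (intro integral_nonneg_AE AE_I2) simp
      have "\<Lambda> > 0" unfolding \<Lambda> using T0 q p c0 B by (simp add: add_nonneg_pos)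
      have "p * F = \<Lambda> * B"
        unfolding F_def B_def
        by (rule critical_point_pohozaev[OF p a \<mu> uv one growth_int[OF uv one] \<mu>q dens_int[OF uv one] crit])
          (use \<open>\<Lambda> > 0\<close> in \<open>auto simp: \<Lambda>_def\<close>)
      have "c0 * B \<le> F"
      proof -
        have "c0 * B = (LINT r|lebpos. c0 * (\<bar>u r\<bar> powr p * r powr a))" by (simp add: B_def)
        also have "\<dots> \<le> F"
          unfolding F_def
        proof (rule integral_mono[OF integrable_mult_right[OF up] dens_int[OF uv one]])
          show "c0 * (\<bar>u r\<bar> powr p * r powr a) \<le> TM_density p \<mu> (u r) * r powr a" for r
            using mult_right_mono[OF TM_density_ge[OF p \<mu>, of "u r"], of "r powr a"] by (simp add: c0_def mult_ac)
        qed
        finally show ?thesis .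
      qed
      have "T \<le> \<mu> powr p / Gamma p * E"
      proof -
        have "T \<le> (LINT r|lebpos. \<mu> powr p / Gamma p * (exp_growth p \<mu>0 (u r) * r powr a))"
          unfolding T_def
        proof (rule integral_mono[OF Tint integrable_mult_right[OF growth_int[OF uv one]]])
          fix r
          have "\<mu> * \<bar>u r\<bar> powr q * TM_density p \<mu> (u r) \<le> \<mu> powr p / Gamma p * exp_growth p \<mu> (u r)"
            using TM_excess_le_growth[OF p \<mu>, of "u r"] by (simp add: q_def)
          also have "\<dots> \<le> \<mu> powr p / Gamma p * exp_growth p \<mu>0 (u r)"
            using G growth_le by (intro mult_left_mono) auto
          finally have "\<mu> * \<bar>u r\<bar> powr q * TM_density p \<mu> (u r) \<le> \<mu> powr p / Gamma p * exp_growth p \<mu>0 (u r)" .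
          from mult_right_mono[OF this powr_ge_zero[of r a]]
          show "(\<mu> * \<bar>u r\<bar> powr q * TM_density p \<mu> (u r)) * r powr a
              \<le> \<mu> powr p / Gamma p * (exp_growth p \<mu>0 (u r) * r powr a)"
            by (simp only: mult.assoc)
        qed
        then show ?thesis by (simp add: E_def)
      qed
      also have "\<mu> powr p / Gamma p * E \<le> \<mu> powr p / Gamma p * (K * A * B)"
        using \<open>E \<le> K * A * B\<close> G by (intro mult_left_mono) auto
      also have "\<mu> powr p / Gamma p = c0 * \<mu>" using \<mu> by (simp add: c0_def powr_diff)
      finally have T_le: "T \<le> c0 * \<mu> * (K * A * B)" .
      \<comment> \<open>From p c0 B \<le> p F = \<Lambda> B and A + B = 1 follows \<Lambda> A \<le>
        \<Lambda> - p c0 B = q T, while \<Lambda> \<ge> p c0 B bounds \<Lambda> A from below. After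
        division by c0 B A only constants remain.\<close>
      have "p * (c0 * B) * A \<le> \<Lambda> * A"
        using T0 q Apos by (intro mult_right_mono) (simp_all add: \<Lambda>)
      moreover have "\<Lambda> * A + \<Lambda> * B = \<Lambda>"
        using AB by (simp only: distrib_left[symmetric] mult_1_right)
      moreover have "p * (c0 * B) \<le> p * F"
        using \<open>c0 * B \<le> F\<close> p by (intro mult_left_mono) auto
      moreover have "\<Lambda> = q * T + p * (c0 * B)" using \<Lambda> by simp
      moreover have "q * T \<le> q * (c0 * \<mu> * (K * A * B))" using T_le q by (intro mult_left_mono) auto
      ultimately have "p * (c0 * B) * A \<le> q * (c0 * \<mu> * (K * A * B))"
        using \<open>p * F = \<Lambda> * B\<close> by linarith
      then have "p * (c0 * B * A) \<le> (q * (\<mu> * K)) * (c0 * B * A)" by (simp add: mult_ac)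
      moreover have "0 < c0 * B * A" using c0 B Apos by simp
      ultimately have "p \<le> q * (\<mu> * K)" by (rule mult_right_le_imp_le)
      also have "\<dots> < q * (p - 1)" using \<mu>K q by simp
      also have "\<dots> = p" using p by (simp add: q_def)
      finally show False by simp
    qed
    have "\<not> (\<exists>u\<in>X_sphere p a (p - 1).
         TM_functional p a \<mu> u = (SUP v\<in>X_sphere p a (p - 1). TM_functional p a \<mu> v))"
    proof
      assume "\<exists>u\<in>X_sphere p a (p - 1). TM_functional p a \<mu> u = (SUP v\<in>X_sphere p a (p - 1). TM_functional p a \<mu> v)"
      then obtain u where u: "u \<in> X_sphere p a (p - 1)"
        "TM_functional p a \<mu> u = (SUP v\<in>X_sphere p a (p - 1). TM_functional p a \<mu> v)" by blast
      obtain v where uv: "X_pair p a u v" and one: "X_energy p a u v = 1"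
        using X_sphereE[OF u(1) p0] by metis
      have "TM_functional p a \<mu> u = (\<integral>\<^sup>+ r. ennreal (TM_density p \<mu> (u r) * r powr a) \<partial>lebpos)"
        unfolding TM_functional_def TM_density_def[OF p \<mu>] ..
      also have "\<dots> = ennreal (LINT r|lebpos. TM_density p \<mu> (u r) * r powr a)"
        by (rule nn_integral_eq_integral[OF dens_int[OF uv one]]) (use TM_density_nonneg[OF p \<mu>] in auto)
      finally have "TM_functional p a \<mu> u < \<infinity>" by simp
      from maximizer_imp_critical_point[of u "X_sphere p a (p - 1)" "TM_functional p a \<mu>", OF u this]
      show False by (rule no_crit)
    qed
    then show ?thesis using no_crit by blast
  qed
  ultimately show ?thesis unfolding a_def by blast
qed

end
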